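(* For any $p\in[0,1]$, the recursive separable permuton $\boldsymbol{\mu}^{\mathrm{rec}}_p$ satisfies $\boldsymbol{\mu}^{\mathrm{rec}}_p\stackrel{d}{=}\Phi_p(\boldsymbol{\mu}^{\mathrm{rec}}_p)$. Moreover, the distribution of $\boldsymbol{\mu}^{\mathrm{rec}}_p$ is characterized by this property: if a random permuton $\boldsymbol{\nu}$ satisfies $\boldsymbol{\nu}\stackrel{d}{=}\Phi_p(\boldsymbol{\nu})$, then $\boldsymbol{\nu}\stackrel{d}{=}\boldsymbol{\mu}^{\mathrm{rec}}_p$.
   Context: $\mathrm{Leb}$ is Lebesgue measure on $[0,1]$. A permuton is a Borel probability measure on $[0,1]^2$ with both marginals equal to $\mathrm{Leb}$; the space of permutons carries the weak topology. Recursive separable permuton $\boldsymbol{\mu}^{\mathrm{rec}}_p$: let $(U_j)_{j\ge1}$ be i.i.d. uniform in $[0,1]$ and $(S_j)_{j\ge1}$ be i.i.d. signs in $\{\oplus,\ominus\}$ with $\mathbb P(S_j=\oplus)=p$, the two sequences being independent. For $x<y$ in $[0,1]$ let $j$ be the minimal index $j\ge 1$ such that $U_j\in(x,y]$; set $x\prec y$ if $S_j=\oplus$ and $y\prec x$ if $S_j=\ominus$ (no comparison if there is no such $j$). Let $\phi(x)=\mathrm{Leb}(\{y\in[0,1]: y\prec x\})$ and let $\boldsymbol{\mu}^{\mathrm{rec}}_p$ be the push-forward of $\mathrm{Leb}$ by the map $x\mapsto(x,\phi(x))$; this is almost surely a permuton. Operation $\otimes_{(u,S)}$: given permutons $\mu,\nu$,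 $u\in[0,1]$ and a sign $S\in\{\oplus,\ominus\}$, the permuton $\rho=\mu\otimes_{(u,S)}\nu$ is defined as follows. If $S=\oplus$, $\rho$ is supported on $[0,u]^2\cup[u,1]^2$, its restriction to $[0,u]^2$ being the (affinely) rescaled version of $\mu$ of total weight $u$ and its restriction to $[u,1]^2$ being the rescaled version of $\nu$ of total weight $1-u$. If $S=\ominus$, $\rho$ is supported on $[0,u]\times[1-u,1]\,\cup\,[u,1]\times[0,1-u]$, its restriction to $[0,u]\times[1-u,1]$ being the rescaled version of $\mu$ of total weight $u$ and its restriction to $[u,1]\times[0,1-u]$ being the rescaled version of $\nu$ of total weight $1-u$. Map $\Phi_p$: given a random permuton $\boldsymbol{\mu}$, $\Phi_p(\boldsymbol{\mu})$ is the random permuton $\boldsymbol{\mu}_0\otimes_{(U,S)}\boldsymbol{\mu}_1$, where $\boldsymbol{\mu}_0,\boldsymbol{\mu}_1$ are copies of $\boldsymbol{\mu}$, $U$ is uniform in $[0,1]$, $S$ is a random sign with $\mathbb P(S=\oplus)=p$, and $\boldsymbol{\mu}_0,\boldsymbol{\mu}_1,U,S$ are independent. *)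

theory Defs
  imports "HOL-Probability.Probability"
begin

section \<open>Permutons and the weak topology\<close>

definition Leb :: "real measure" where
  "Leb = restrict_space lborel {0..1}"

definition square_borel :: "(real \<times> real) measure" where
  "square_borel = restrict_space borel ({0..1} \<times> {0..1})"

definition permuton :: "(real \<times> real) measure \<Rightarrow> bool" where
  "permuton \<mu> \<longleftrightarrow> prob_space \<mu> \<and> sets \<mu> = sets square_borel \<and>
     distr \<mu> Leb fst = Leb \<and> distr \<mu> Leb snd = Leb"

text \<open>The weak topology on the set of permutons is the coarsest one making
  \<open>\<mu> \<mapsto> \<integral> f d\<mu>\<close> continuous for every continuous (hence bounded)
  \<open>f\<close> on the unit square.\<close>

definition weak_topology :: "(real \<times> real) measure topology" where
  "weak_topology = topology_generated_by
     {{\<mu>. permuton \<mu> \<and> (\<integral>z. f z \<partial>\<mu>) \<in> V} | (f :: real \<times> real \<Rightarrow> real) V.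
        continuous_on ({0..1} \<times> {0..1}) f \<and> open V}"

definition permuton_space :: "(real \<times> real) measure measure" where
  "permuton_space = sigma {\<mu>. permuton \<mu>} {W. openin weak_topology W}"

definition random_permuton :: "'a measure \<Rightarrow> ('a \<Rightarrow> (real \<times> real) measure) \<Rightarrow> bool" where
  "random_permuton M X \<longleftrightarrow> prob_space M \<and> X \<in> measurable M permuton_space"


section \<open>The recursive separable permuton\<close>

text \<open>Signs are booleans, with \<open>True\<close> standing for \<open>\<oplus>\<close> and \<open>False\<close>
  for \<open>\<ominus>\<close>. Sequences are indexed from \<open>0\<close> instead of \<open>1\<close>.\<close>

locale driving_sequences = prob_space M
  for M :: "'a measure" and p :: real and U :: "nat \<Rightarrow> 'a \<Rightarrow> real" and S :: "nat \<Rightarrow> 'a \<Rightarrow> bool" +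
  assumes U_iid: "indep_vars (\<lambda>_. Leb) U UNIV" "\<And>j. distr M Leb (U j) = Leb"
    and S_iid: "indep_vars (\<lambda>_. count_space UNIV) S UNIV"
      "\<And>j. distr M (count_space UNIV) (S j) = measure_pmf (bernoulli_pmf p)"
    and U_S_indep:
      "indep_set
         (sets (vimage_algebra (space M) (\<lambda>\<omega> j. U j \<omega>) (\<Pi>\<^sub>M j\<in>UNIV. Leb)))
         (sets (vimage_algebra (space M) (\<lambda>\<omega> j. S j \<omega>) (\<Pi>\<^sub>M j\<in>UNIV. count_space UNIV)))"

definition rec_prec :: "(nat \<Rightarrow> real) \<Rightarrow> (nat \<Rightarrow> bool) \<Rightarrow> real \<Rightarrow> real \<Rightarrow> bool" where
  "rec_prec u s a b \<longleftrightarrow>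
     (a < b \<and> (\<exists>j. u j \<in> {a<..b}) \<and> s (LEAST j. u j \<in> {a<..b})) \<or>
     (b < a \<and> (\<exists>j. u j \<in> {b<..a}) \<and> \<not> s (LEAST j. u j \<in> {b<..a}))"

definition rec_phi :: "(nat \<Rightarrow> real) \<Rightarrow> (nat \<Rightarrow> bool) \<Rightarrow> real \<Rightarrow> real" where
  "rec_phi u s x = measure Leb {y \<in> {0..1}. rec_prec u s y x}"

definition rec_measure :: "(nat \<Rightarrow> real) \<Rightarrow> (nat \<Rightarrow> bool) \<Rightarrow> (real \<times> real) measure" where
  "rec_measure u s = distr Leb square_borel (\<lambda>x. (x, rec_phi u s x))"

text \<open>The push-forward is a permuton only almost surely. To obtain a random element of the
  space of permutons, it is replaced by the diagonal permuton on the exceptional null event.\<close>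

definition rec_permuton :: "(nat \<Rightarrow> real) \<Rightarrow> (nat \<Rightarrow> bool) \<Rightarrow> (real \<times> real) measure" where
  "rec_permuton u s =
     (if permuton (rec_measure u s) then rec_measure u s
      else distr Leb square_borel (\<lambda>x. (x, x)))"

definition random_rec_permuton ::
  "(nat \<Rightarrow> 'a \<Rightarrow> real) \<Rightarrow> (nat \<Rightarrow> 'a \<Rightarrow> bool) \<Rightarrow> 'a \<Rightarrow> (real \<times> real) measure" where
  "random_rec_permuton U S = (\<lambda>\<omega>. rec_permuton (\<lambda>j. U j \<omega>) (\<lambda>j. S j \<omega>))"


section \<open>The operation \<open>\<otimes>\<close> and the map \<open>\<Phi>\<close>\<close>

definition permuton_tensor ::
  "real \<Rightarrow> bool \<Rightarrow> (real \<times> real) measure \<Rightarrow> (real \<times> real) measure \<Rightarrow> (real \<times> real) measure" where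
  "permuton_tensor u s \<mu> \<nu> =
     measure_of ({0..1} \<times> {0..1}) (sets square_borel)
       (\<lambda>A. ennreal u * emeasure (distr \<mu> square_borel
                (\<lambda>(x, y). (u * x, if s then u * y else (1 - u) + u * y))) A
          + ennreal (1 - u) * emeasure (distr \<nu> square_borel
                (\<lambda>(x, y). (u + (1 - u) * x, if s then u + (1 - u) * y else (1 - u) * y))) A)"

text \<open>For a random permuton \<open>X\<close> on \<open>M\<close>, the random permuton \<open>\<Phi>\<^sub>p(X)\<close> lives on the product of
  two copies of \<open>M\<close> (carrying the two independent copies of \<open>X\<close>), the unit interval
  (carrying \<open>U\<close>) and the signs (carrying \<open>S\<close>).\<close>

definition Phi_space :: "real \<Rightarrow> 'a measure \<Rightarrow> ('a \<times> 'a \<times> real \<times> bool) measure" where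
  "Phi_space p M = M \<Otimes>\<^sub>M M \<Otimes>\<^sub>M Leb \<Otimes>\<^sub>M measure_pmf (bernoulli_pmf p)"

definition Phi :: "('a \<Rightarrow> (real \<times> real) measure) \<Rightarrow> 'a \<times> 'a \<times> real \<times> bool \<Rightarrow> (real \<times> real) measure" where
  "Phi X = (\<lambda>(\<omega>\<^sub>0, \<omega>\<^sub>1, u, s). permuton_tensor u s (X \<omega>\<^sub>0) (X \<omega>\<^sub>1))"

definition eq_in_law ::
  "'a measure \<Rightarrow> ('a \<Rightarrow> (real \<times> real) measure) \<Rightarrow> 'b measure \<Rightarrow> ('b \<Rightarrow> (real \<times> real) measure) \<Rightarrow> bool" where
  "eq_in_law M X N Y \<longleftrightarrow> distr M permuton_space X = distr N permuton_space Y"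

end

theory Submission
  imports Defs
begin

text \<open>The sequence of marks \<open>(U\<^sub>j, S\<^sub>j)\<close> is cut at its first term \<open>(U, S)\<close>. Every later \<open>U\<^sub>j\<close> falls to the left
or to the right of \<open>U\<close>, and after affine rescaling the left and the right marks form two independent
copies of the original sequence, independent of \<open>(U, S)\<close>. Two points on the same side of \<open>U\<close> are
compared by the marks of that side only, while points on different sides are compared by \<open>S\<close>. Hence the
graph measure of the whole sequence is the tensor of the graph measures of the two halves
(\<open>seq_measure_tensor\<close>). Independence of the halves is proved backwards: two independent sequences and a
sequence of coins are interleaved, and the result has the law of the original sequence (\<open>merge_marks_law\<close>,
\<open>glue_law\<close>).

The recursion also shows that the graph measure is almost surely a permuton. Its first marginal is
uniform by construction. Let the defect be the \<open>L\<^sup>1\<close> distance between the distribution function of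
the second marginal and the identity. A tensor with cut \<open>u\<close> has defect \<open>u\<^sup>2 a + (1 - u)\<^sup>2 b\<close> if the
factors have defects \<open>a\<close> and \<open>b\<close>. Taking expectations, the mean defect equals \<open>2/3\<close> of itself, so that
it vanishes (\<open>AE_permuton_seq_measure\<close>).

Uniqueness is a contraction argument. If integrals of \<open>L\<close>-Lipschitz functions against \<open>\<mu>\<close> and \<open>\<mu>'\<close>
differ by at most \<open>L r\<close>, and against \<open>\<nu>\<close> and \<open>\<nu>'\<close> by at most \<open>L q\<close>, then those against the two tensors
differ by at most \<open>L (u\<^sup>2 r + (1 - u)\<^sup>2 q)\<close>, because the rescaling maps contract by \<open>u\<close> and \<open>1 - u\<close> and carry
the masses \<open>u\<close> and \<open>1 - u\<close>. Two invariant laws are coupled independently at first; one application of the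
tensor with shared cut and sign keeps both marginals and multiplies the expected radius by \<open>2/3\<close>
(\<open>coupling_marginals\<close>, \<open>coupling_radius\<close>). In the limit both laws give the same mean to every bounded
functional that is Lipschitz in this sense, and such functionals approximate the indicators of a
generating \<open>\<pi>\<close>-system (\<open>fixed_law_unique\<close>).

Both parts need to know which maps into the space of permutons are measurable. The weak topology is
generated by countably many cell masses, so its Borel structure is the one inherited from the Giry monad
(\<open>measurable_permuton_space_iff\<close>).\<close>

section \<open>Lebesgue measure on the unit interval\<close>

abbreviation unit_square :: "(real \<times> real) set" where
  "unit_square \<equiv> {0..1} \<times> {0..1}"

lemma space_Leb [simp]: "space Leb = {0..1}"
  by (simp add: Leb_def)

lemma space_square_borel [simp]: "space square_borel = unit_square"
  by (simp add: square_borel_def space_restrict_space)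

lemma sets_Leb: "sets Leb = sets (restrict_space borel {0..1})"
  unfolding Leb_def by (rule sets_restrict_space_cong) simp

lemma measurable_Leb_iff:
  "f \<in> measurable M Leb \<longleftrightarrow> f \<in> borel_measurable M \<and> (\<forall>x\<in>space M. f x \<in> {0..1})"
  by (simp add: measurable_cong_sets[OF refl sets_Leb] measurable_restrict_space2_iff Pi_iff)

lemma measurable_square_borel_iff:
  "f \<in> measurable M square_borel \<longleftrightarrow>
     f \<in> borel_measurable M \<and> (\<forall>x\<in>space M. f x \<in> unit_square)"
  by (simp add: square_borel_def measurable_restrict_space2_iff Pi_iff)

lemma borel_measurable_Leb [measurable]: "(\<lambda>x. x) \<in> borel_measurable Leb"
  using measurable_Leb_iff[of "\<lambda>x. x" Leb] by simp

lemma Leb_borel [measurable (raw)]: "f \<in> measurable M Leb \<Longrightarrow> f \<in> borel_measurable M"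
  by (simp add: measurable_Leb_iff)

lemma prob_space_Leb: "prob_space Leb"
  by (rule prob_spaceI) (simp add: Leb_def emeasure_restrict_space)

interpretation Leb: prob_space Leb by (rule prob_space_Leb)

lemma AE_Leb_neq: "AE x in Leb. x \<noteq> c"
proof -
  have "AE x in lborel. x \<noteq> c" by (rule AE_lborel_singleton)
  then show ?thesis
    unfolding Leb_def by (subst AE_restrict_space_iff) (auto elim: eventually_mono)
qed

lemma nn_integral_Leb:
  "(\<integral>\<^sup>+x. f x \<partial>Leb) = (\<integral>\<^sup>+x. f x * indicator {0..1} x \<partial>lborel)"
  by (simp add: Leb_def nn_integral_restrict_space)

text \<open>Lebesgue measure on the unit interval is the mixture, with weights \<open>u\<close> and \<open>1 - u\<close>, of its rescaled
copies on the two sides of \<open>u\<close>. This self-similarity is behind every recursion below.\<close>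

lemma nn_integral_Leb_split:
  assumes u: "0 \<le> u" "u \<le> 1" and f [measurable]: "f \<in> borel_measurable Leb"
  shows "(\<integral>\<^sup>+x. f x \<partial>Leb) =
    ennreal u * (\<integral>\<^sup>+x. f (u * x) \<partial>Leb) + ennreal (1 - u) * (\<integral>\<^sup>+x. f (u + (1 - u) * x) \<partial>Leb)"
proof -
  consider "u = 0" | "u = 1" | "0 < u" "u < 1" using u by linarith
  then show ?thesis
  proof cases
    case 1
    then show ?thesis by simp
  next
    case 2
    then show ?thesis by simp
  next
    case 3
    define g where "g x = f x * indicator {0..1} x" for x
    have g [measurable]: "g \<in> borel_measurable borel"
      using f unfolding g_def
      by (subst borel_measurable_restrict_space_iff_ennreal[symmetric])
        (auto simp: measurable_cong_sets[OF sets_Leb refl])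
    have "(\<integral>\<^sup>+x. f x \<partial>Leb) = (\<integral>\<^sup>+x. g x * indicator {..u} x + g x * indicator {u<..} x \<partial>lborel)"
      unfolding nn_integral_Leb by (rule nn_integral_cong) (auto simp: g_def indicator_def)
    also have "\<dots> = (\<integral>\<^sup>+x. g x * indicator {..u} x \<partial>lborel) + (\<integral>\<^sup>+x. g x * indicator {u<..} x \<partial>lborel)"
      by (rule nn_integral_add) auto
    also have "(\<integral>\<^sup>+x. g x * indicator {..u} x \<partial>lborel)
        = ennreal u * (\<integral>\<^sup>+x. g (0 + u * x) * indicator {..u} (0 + u * x) \<partial>lborel)"
      using 3 by (subst nn_integral_real_affine[where c = u and t = 0]) auto
    also have "(\<integral>\<^sup>+x. g (0 + u * x) * indicator {..u} (0 + u * x) \<partial>lborel) = (\<integral>\<^sup>+x. f (u * x) \<partial>Leb)"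
      unfolding nn_integral_Leb
    proof (rule nn_integral_cong)
      fix x :: real
      have "u * x \<le> u * 1 \<longleftrightarrow> x \<le> 1" "0 \<le> u * x \<longleftrightarrow> 0 \<le> x"
        using 3 by (simp_all only: mult_le_cancel_left_pos zero_le_mult_iff) auto
      moreover have "x \<le> 1 \<Longrightarrow> u * x \<le> 1" if "0 \<le> x"
        using 3 that by (intro mult_le_one) auto
      ultimately show "g (0 + u * x) * indicator {..u} (0 + u * x) = f (u * x) * indicator {0..1} x"
        by (cases "0 \<le> x \<and> x \<le> 1") (auto simp: g_def)
    qed
    also have "(\<integral>\<^sup>+x. g x * indicator {u<..} x \<partial>lborel)
        = ennreal (1 - u) * (\<integral>\<^sup>+x. g (u + (1 - u) * x) * indicator {u<..} (u + (1 - u) * x) \<partial>lborel)"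
      using 3 by (subst nn_integral_real_affine[where c = "1 - u" and t = u]) auto
    also have "(\<integral>\<^sup>+x. g (u + (1 - u) * x) * indicator {u<..} (u + (1 - u) * x) \<partial>lborel)
        = (\<integral>\<^sup>+x. f (u + (1 - u) * x) \<partial>Leb)"
      unfolding nn_integral_Leb
    proof (rule nn_integral_cong_AE)
      have *: "g (u + (1 - u) * x) * indicator {u<..} (u + (1 - u) * x) =
            f (u + (1 - u) * x) * indicator {0..1} x" if "x \<noteq> 0" for x
      proof -
        have "(1 - u) * x \<le> (1 - u) * 1 \<longleftrightarrow> x \<le> 1" "0 < (1 - u) * x \<longleftrightarrow> 0 < x"
          using 3 by (simp_all only: mult_le_cancel_left_pos zero_less_mult_iff) auto
        then have "u + (1 - u) * x \<le> 1 \<longleftrightarrow> x \<le> 1" "u < u + (1 - u) * x \<longleftrightarrow> 0 < x"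
          by (auto simp: algebra_simps)
        then show ?thesis
          using that 3 by (cases "0 < x \<and> x \<le> 1") (auto simp: g_def)
      qed
      then show "AE x in lborel. g (u + (1 - u) * x) * indicator {u<..} (u + (1 - u) * x) =
            f (u + (1 - u) * x) * indicator {0..1} x"
        by (rule eventually_mono[OF AE_lborel_singleton[of 0]]) (simp add: *)
    qed
    finally show ?thesis .
  qed
qed

section \<open>The tensor operation on permutons\<close>

text \<open>These are the affine maps of the unit square onto the two blocks that carry the factors of a tensor.\<close>

definition left_map :: "real \<Rightarrow> bool \<Rightarrow> real \<times> real \<Rightarrow> real \<times> real" where
  "left_map u s = (\<lambda>(x, y). (u * x, if s then u * y else (1 - u) + u * y))"

definition right_map :: "real \<Rightarrow> bool \<Rightarrow> real \<times> real \<Rightarrow> real \<times> real" where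
  "right_map u s = (\<lambda>(x, y). (u + (1 - u) * x, if s then u + (1 - u) * y else (1 - u) * y))"

lemma affine_in_unit:
  fixes u x :: real
  assumes "0 \<le> u" "u \<le> 1" "0 \<le> x" "x \<le> 1"
  shows "0 \<le> u * x" "u * x \<le> u" "u * x \<le> 1" "0 \<le> (1 - u) * x" "u + (1 - u) * x \<le> 1" "(1 - u) * x \<le> 1"
    "1 - u + u * x \<le> 1" "0 \<le> u + (1 - u) * x" "0 \<le> 1 - u + u * x"
proof -
  show 1: "0 \<le> u * x" "0 \<le> (1 - u) * x" using assms by simp_all
  have "u * x \<le> u * 1" "(1 - u) * x \<le> (1 - u) * 1"
    using assms by (intro mult_left_mono; simp)+
  then have 2: "u * x \<le> u" "(1 - u) * x \<le> 1 - u" by simp_all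
  show "u * x \<le> u" "u * x \<le> 1" "u + (1 - u) * x \<le> 1" "(1 - u) * x \<le> 1"
    "1 - u + u * x \<le> 1" "0 \<le> u + (1 - u) * x" "0 \<le> 1 - u + u * x"
    using 1 2 assms by linarith+
qed

lemma fst_borel_square [measurable]: "fst \<in> borel_measurable square_borel"
  and snd_borel_square [measurable]: "snd \<in> borel_measurable square_borel"
  unfolding square_borel_def
  by (rule measurable_restrict_space1, simp add: borel_prod[symmetric])+

lemma fst_square [measurable]: "fst \<in> measurable square_borel Leb"
  and snd_square [measurable]: "snd \<in> measurable square_borel Leb"
  by (auto simp: measurable_Leb_iff)

lemma left_map_measurable:
  assumes "0 \<le> u" "u \<le> 1" shows "left_map u s \<in> measurable square_borel square_borel"
  unfolding measurable_square_borel_iff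
proof
  show "left_map u s \<in> borel_measurable square_borel"
    unfolding left_map_def split_beta' by measurable
qed (use assms in \<open>auto simp: left_map_def affine_in_unit\<close>)

lemma right_map_measurable:
  assumes "0 \<le> u" "u \<le> 1" shows "right_map u s \<in> measurable square_borel square_borel"
  unfolding measurable_square_borel_iff
proof
  show "right_map u s \<in> borel_measurable square_borel"
    unfolding right_map_def split_beta' by measurable
qed (use assms in \<open>auto simp: right_map_def affine_in_unit\<close>)

lemma permuton_tensor_alt:
  "permuton_tensor u s \<mu> \<nu> = measure_of unit_square (sets square_borel)
     (\<lambda>A. ennreal u * emeasure (distr \<mu> square_borel (left_map u s)) A
        + ennreal (1 - u) * emeasure (distr \<nu> square_borel (right_map u s)) A)"
  by (simp add: permuton_tensor_def left_map_def right_map_def)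

lemma sets_permuton_tensor [simp]: "sets (permuton_tensor u s \<mu> \<nu>) = sets square_borel"
  unfolding permuton_tensor_alt
  using sets.space_closed[of square_borel] sets.sigma_sets_eq[of square_borel] by (simp add: sets_measure_of)

lemma space_permuton_tensor [simp]: "space (permuton_tensor u s \<mu> \<nu>) = unit_square"
  using sets_eq_imp_space_eq[OF sets_permuton_tensor] by simp

lemma emeasure_permuton_tensor:
  assumes A: "A \<in> sets square_borel"
  shows "emeasure (permuton_tensor u s \<mu> \<nu>) A =
    ennreal u * emeasure (distr \<mu> square_borel (left_map u s)) A
      + ennreal (1 - u) * emeasure (distr \<nu> square_borel (right_map u s)) A"
proof (rule emeasure_measure_of[OF permuton_tensor_alt])
  let ?D = "distr \<mu> square_borel (left_map u s)" and ?E = "distr \<nu> square_borel (right_map u s)"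
  show "sets square_borel \<subseteq> Pow unit_square"
    using sets.space_closed[of square_borel] by simp
  show "countably_additive (sets (permuton_tensor u s \<mu> \<nu>))
      (\<lambda>A. ennreal u * emeasure ?D A + ennreal (1 - u) * emeasure ?E A)"
  proof (rule countably_additiveI)
    fix B :: "nat \<Rightarrow> (real \<times> real) set"
    assume "range B \<subseteq> sets (permuton_tensor u s \<mu> \<nu>)" "disjoint_family B"
    then have "(\<Sum>i. emeasure ?D (B i)) = emeasure ?D (\<Union>i. B i)"
        "(\<Sum>i. emeasure ?E (B i)) = emeasure ?E (\<Union>i. B i)"
      by (intro suminf_emeasure; simp)+
    then show "(\<Sum>i. ennreal u * emeasure ?D (B i) + ennreal (1 - u) * emeasure ?E (B i)) =
        ennreal u * emeasure ?D (\<Union>i. B i) + ennreal (1 - u) * emeasure ?E (\<Union>i. B i)"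
      by (simp add: suminf_add[OF summableI summableI, symmetric])
  qed
  show "A \<in> sets (permuton_tensor u s \<mu> \<nu>)" using A by simp
qed (simp add: positive_def)

lemma nn_integral_permuton_tensor:
  assumes u: "0 \<le> u" "u \<le> 1" and [measurable_cong]: "sets \<mu> = sets square_borel" "sets \<nu> = sets square_borel"
    and f: "f \<in> borel_measurable square_borel"
  shows "(\<integral>\<^sup>+z. f z \<partial>permuton_tensor u s \<mu> \<nu>) =
    ennreal u * (\<integral>\<^sup>+z. f (left_map u s z) \<partial>\<mu>) + ennreal (1 - u) * (\<integral>\<^sup>+z. f (right_map u s z) \<partial>\<nu>)"
proof -
  note [measurable] = left_map_measurable[OF u] right_map_measurable[OF u]
  have [measurable_cong]: "sets (permuton_tensor u s \<mu> \<nu>) = sets square_borel" by simp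
  let ?D = "distr \<mu> square_borel (left_map u s)" and ?E = "distr \<nu> square_borel (right_map u s)"
  have "(\<integral>\<^sup>+z. f z \<partial>permuton_tensor u s \<mu> \<nu>) =
      ennreal u * (\<integral>\<^sup>+z. f z \<partial>?D) + ennreal (1 - u) * (\<integral>\<^sup>+z. f z \<partial>?E)"
    using f
  proof (induction rule: borel_measurable_induct)
    case (cong f g)
    have "integral\<^sup>N K f = integral\<^sup>N K g" if "space K = space square_borel" for K
      using cong(3) that by (intro nn_integral_cong) auto
    with cong show ?case by simp
  next
    case (set A)
    then show ?case by (simp add: emeasure_permuton_tensor)
  next
    case (mult f c)
    then show ?case by (simp add: nn_integral_cmult distrib_left mult.left_commute)
  next
    case (add f g)
    then show ?case by (simp add: nn_integral_add distrib_left ac_simps)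
  next
    case (seq F)
    note [measurable] = seq(1)
    have "(\<integral>\<^sup>+z. (SUP i. F i) z \<partial>K) = (SUP i. integral\<^sup>N K (F i))" if "sets K = sets square_borel" for K
      unfolding SUP_apply
      by (rule nn_integral_monotone_convergence_SUP[OF seq(3)])
        (use seq(1) that in \<open>simp add: measurable_cong_sets[OF that refl]\<close>)
    moreover have "incseq (\<lambda>i. integral\<^sup>N K (F i))" for K
      using seq(3) by (auto simp: incseq_def le_fun_def intro!: nn_integral_mono)
    ultimately show ?case
      using seq(4) by (simp add: seq.IH SUP_mult_left_ennreal ennreal_SUP_add incseq_def mult_left_mono)
  qed
  also have "(\<integral>\<^sup>+z. f z \<partial>?D) = (\<integral>\<^sup>+z. f (left_map u s z) \<partial>\<mu>)"
    using f by (subst nn_integral_distr) simp_all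
  also have "(\<integral>\<^sup>+z. f z \<partial>?E) = (\<integral>\<^sup>+z. f (right_map u s z) \<partial>\<nu>)"
    using f by (subst nn_integral_distr) simp_all
  finally show ?thesis .
qed

lemma permuton_sets: "permuton \<mu> \<Longrightarrow> sets \<mu> = sets square_borel"
  and permuton_prob_space: "permuton \<mu> \<Longrightarrow> prob_space \<mu>"
  by (auto simp: permuton_def)

lemma permuton_space: "permuton \<mu> \<Longrightarrow> space \<mu> = unit_square"
  using sets_eq_imp_space_eq[OF permuton_sets] by simp

lemma permuton_nn_integral:
  assumes "permuton \<mu>" and [measurable]: "f \<in> borel_measurable Leb"
  shows "(\<integral>\<^sup>+z. f (fst z) \<partial>\<mu>) = (\<integral>\<^sup>+x. f x \<partial>Leb)" "(\<integral>\<^sup>+z. f (snd z) \<partial>\<mu>) = (\<integral>\<^sup>+x. f x \<partial>Leb)"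
proof -
  have [measurable_cong]: "sets \<mu> = sets square_borel" using assms by (simp add: permuton_def)
  have "(\<integral>\<^sup>+x. f x \<partial>Leb) = (\<integral>\<^sup>+x. f x \<partial>distr \<mu> Leb fst)" "(\<integral>\<^sup>+x. f x \<partial>Leb) = (\<integral>\<^sup>+x. f x \<partial>distr \<mu> Leb snd)"
    using assms by (simp_all add: permuton_def)
  then show "(\<integral>\<^sup>+z. f (fst z) \<partial>\<mu>) = (\<integral>\<^sup>+x. f x \<partial>Leb)" "(\<integral>\<^sup>+z. f (snd z) \<partial>\<mu>) = (\<integral>\<^sup>+x. f x \<partial>Leb)"
    by (simp_all add: nn_integral_distr)
qed

text \<open>Testing the marginals with nonnegative functions instead of sets lets the integral formula for the
tensor be combined directly with the self-similarity of Lebesgue measure.\<close>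

lemma permutonI:
  assumes [measurable_cong]: "sets \<mu> = sets square_borel"
    and fst: "\<And>f. f \<in> borel_measurable Leb \<Longrightarrow> (\<integral>\<^sup>+z. f (fst z) \<partial>\<mu>) = (\<integral>\<^sup>+x. f x \<partial>Leb)"
    and snd: "\<And>f. f \<in> borel_measurable Leb \<Longrightarrow> (\<integral>\<^sup>+z. f (snd z) \<partial>\<mu>) = (\<integral>\<^sup>+x. f x \<partial>Leb)"
  shows "permuton \<mu>"
  unfolding permuton_def
proof (intro conjI)
  show "prob_space \<mu>"
    using fst[of "\<lambda>_. 1"] Leb.emeasure_space_1 by (intro prob_spaceI) simp
  have "emeasure (distr \<mu> Leb fst) A = emeasure Leb A" "emeasure (distr \<mu> Leb snd) A = emeasure Leb A"
    if "A \<in> sets Leb" for A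
    using fst[of "indicator A"] snd[of "indicator A"] that
    by (simp_all add: nn_integral_indicator[symmetric] nn_integral_distr del: nn_integral_indicator)
  then show "distr \<mu> Leb fst = Leb" "distr \<mu> Leb snd = Leb"
    by (auto intro!: measure_eqI)
qed (fact assms)

lemma affine_measurable_Leb [measurable]:
  assumes "0 \<le> u" "u \<le> 1"
  shows "(\<lambda>x. u * x) \<in> measurable Leb Leb" "(\<lambda>x. u + (1 - u) * x) \<in> measurable Leb Leb"
    "(\<lambda>x. (1 - u) * x) \<in> measurable Leb Leb" "(\<lambda>x. 1 - u + u * x) \<in> measurable Leb Leb"
  using assms by (auto simp: measurable_Leb_iff affine_in_unit)

text \<open>Along the first axis, and along the second one for a positive sign, the blocks are cut at \<open>u\<close>; for a
negative sign the second axis is cut at \<open>1 - u\<close> with the factors exchanged. In each case the marginal is a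
mixture of rescaled uniform laws.\<close>

lemma permuton_tensor_permuton:
  assumes u: "0 \<le> u" "u \<le> 1" and \<mu>: "permuton \<mu>" and \<nu>: "permuton \<nu>"
  shows "permuton (permuton_tensor u s \<mu> \<nu>)"
proof (rule permutonI)
  note [measurable] = affine_measurable_Leb[OF u]
  fix f :: "real \<Rightarrow> ennreal" assume f [measurable]: "f \<in> borel_measurable Leb"
  have *: "(\<integral>\<^sup>+z. f (fst z) \<partial>permuton_tensor u s \<mu> \<nu>) =
    ennreal u * (\<integral>\<^sup>+z. f (fst (left_map u s z)) \<partial>\<mu>) + ennreal (1 - u) * (\<integral>\<^sup>+z. f (fst (right_map u s z)) \<partial>\<nu>)"
    "(\<integral>\<^sup>+z. f (snd z) \<partial>permuton_tensor u s \<mu> \<nu>) =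
    ennreal u * (\<integral>\<^sup>+z. f (snd (left_map u s z)) \<partial>\<mu>) + ennreal (1 - u) * (\<integral>\<^sup>+z. f (snd (right_map u s z)) \<partial>\<nu>)"
    by (rule nn_integral_permuton_tensor[OF u permuton_sets[OF \<mu>] permuton_sets[OF \<nu>]], measurable)+
  have 1: "(\<integral>\<^sup>+x. f (u * x) \<partial>Leb) = (\<integral>\<^sup>+z. f (u * fst z) \<partial>\<mu>)"
    "(\<integral>\<^sup>+x. f (u * x) \<partial>Leb) = (\<integral>\<^sup>+z. f (u * snd z) \<partial>\<mu>)"
    "(\<integral>\<^sup>+x. f (1 - u + u * x) \<partial>Leb) = (\<integral>\<^sup>+z. f (1 - u + u * snd z) \<partial>\<mu>)"
    "(\<integral>\<^sup>+x. f (u + (1 - u) * x) \<partial>Leb) = (\<integral>\<^sup>+z. f (u + (1 - u) * fst z) \<partial>\<nu>)"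
    "(\<integral>\<^sup>+x. f (u + (1 - u) * x) \<partial>Leb) = (\<integral>\<^sup>+z. f (u + (1 - u) * snd z) \<partial>\<nu>)"
    "(\<integral>\<^sup>+x. f ((1 - u) * x) \<partial>Leb) = (\<integral>\<^sup>+z. f ((1 - u) * snd z) \<partial>\<nu>)"
    by (rule permuton_nn_integral[symmetric], rule \<mu> \<nu>, measurable)+
  show "(\<integral>\<^sup>+z. f (fst z) \<partial>permuton_tensor u s \<mu> \<nu>) = (\<integral>\<^sup>+x. f x \<partial>Leb)"
    using nn_integral_Leb_split[OF u f]
    unfolding * by (simp add: 1(1,4) left_map_def right_map_def split_beta)
  show "(\<integral>\<^sup>+z. f (snd z) \<partial>permuton_tensor u s \<mu> \<nu>) = (\<integral>\<^sup>+x. f x \<partial>Leb)"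
  proof (cases s)
    case True
    then show ?thesis
      using nn_integral_Leb_split[OF u f]
      unfolding * by (simp add: 1(2,5) left_map_def right_map_def split_beta)
  next
    case False
    then show ?thesis
      using nn_integral_Leb_split[of "1 - u", OF _ _ f] u
      unfolding * by (simp add: 1(3,6) left_map_def right_map_def split_beta add.commute)
  qed
qed simp

section \<open>Measurability in the space of permutons\<close>

lemma openin_weak_topology_permuton:
  assumes "openin weak_topology W" shows "W \<subseteq> {\<mu>. permuton \<mu>}"
proof -
  have "topspace weak_topology \<subseteq> {\<mu>. permuton \<mu>}"
    unfolding weak_topology_def topology_generated_by_topspace by auto
  then show ?thesis using openin_subset[OF assms] by auto
qed

lemma space_permuton_space [simp]: "space permuton_space = {\<mu>. permuton \<mu>}"
  by (simp add: permuton_space_def space_measure_of_conv)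

lemma sets_permuton_space:
  "sets permuton_space = sigma_sets {\<mu>. permuton \<mu>} {W. openin weak_topology W}"
  unfolding permuton_space_def
  by (rule sets_measure_of) (use openin_weak_topology_permuton in auto)

definition cell :: "nat \<times> nat \<times> nat \<Rightarrow> (real \<times> real) set" where
  "cell = (\<lambda>(n, i, j). {z \<in> unit_square.
     \<lfloor>real (Suc n) * fst z\<rfloor> = int i \<and> \<lfloor>real (Suc n) * snd z\<rfloor> = int j})"

text \<open>The masses of countably many grid cells serve as coordinates on the space of permutons. Their range
lies in a countable product of lines, where every open set is a countable union of basic ones, so that
measurability of the coordinates yields measurability of all weakly open sets.\<close>

definition cell_masses :: "(real \<times> real) measure \<Rightarrow> nat \<times> nat \<times> nat \<Rightarrow> real" where
  "cell_masses \<mu> k = measure \<mu> (cell k)"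

definition grid_sum :: "nat \<Rightarrow> (real \<times> real \<Rightarrow> real) \<Rightarrow> (nat \<times> nat \<times> nat \<Rightarrow> real) \<Rightarrow> real" where
  "grid_sum n f v = (\<Sum>(i, j)\<in>{..Suc n} \<times> {..Suc n}. f (i / Suc n, j / Suc n) * v (n, i, j))"

lemma cell_sets [measurable]: "cell k \<in> sets square_borel"
proof -
  obtain n i j where k: "k = (n, i, j)" by (metis prod_cases3)
  have "cell k = {z \<in> space square_borel. \<lfloor>real (Suc n) * fst z\<rfloor> = int i \<and> \<lfloor>real (Suc n) * snd z\<rfloor> = int j}"
    by (simp add: cell_def k)
  also have "\<dots> \<in> sets square_borel" by measurable
  finally show ?thesis .
qed

lemma continuous_square_measurable:
  fixes f :: "real \<times> real \<Rightarrow> real"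
  assumes "continuous_on unit_square f" shows "f \<in> borel_measurable square_borel"
  unfolding square_borel_def using assms by (rule borel_measurable_continuous_on_restrict)

lemma continuous_square_integrable:
  fixes f :: "real \<times> real \<Rightarrow> real"
  assumes f: "continuous_on unit_square f" and \<mu>: "permuton \<mu>"
  shows "integrable \<mu> f"
proof -
  interpret prob_space \<mu> using \<mu> by (rule permuton_prob_space)
  have "compact unit_square" by (intro compact_Times) auto
  then have "bounded (f ` unit_square)"
    using f by (intro compact_imp_bounded compact_continuous_image)
  then obtain B where B: "\<And>z. z \<in> unit_square \<Longrightarrow> norm (f z) \<le> B"
    by (auto simp: bounded_iff)
  show ?thesis
  proof (rule integrable_const_bound[of _ B])
    show "AE z in \<mu>. norm (f z) \<le> B" using B by (auto simp: permuton_space[OF \<mu>])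
    show "f \<in> borel_measurable \<mu>"
      using continuous_square_measurable[OF f] by (simp add: measurable_cong_sets[OF permuton_sets[OF \<mu>] refl])
  qed
qed

text \<open>A continuous function on the square is uniformly continuous. Hence replacing it by its values at the
lower left corners of a fine grid changes all integrals against permutons by little, uniformly in the
permuton.\<close>

lemma grid_sum_approx:
  fixes f :: "real \<times> real \<Rightarrow> real"
  assumes f: "continuous_on unit_square f" and e: "0 < e"
  obtains n where "\<And>\<mu>. permuton \<mu> \<Longrightarrow> \<bar>(\<integral>z. f z \<partial>\<mu>) - grid_sum n f (cell_masses \<mu>)\<bar> < e"
proof -
  have "compact unit_square" by (intro compact_Times) auto
  with f have "uniformly_continuous_on unit_square f" by (rule compact_uniformly_continuous)
  then obtain d where d: "d > 0" "\<And>z z'. z \<in> unit_square \<Longrightarrow> z' \<in> unit_square \<Longrightarrow>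
      dist z' z < d \<Longrightarrow> dist (f z') (f z) < e / 2"
    using e unfolding uniformly_continuous_on_def by (metis half_gt_zero)
  \<comment> \<open>A cell of side \<open>1 / (n + 1)\<close> has diameter at most \<open>2 / (n + 1)\<close>.\<close>
  obtain n where n: "inverse (real (Suc n)) < d / 2"
    using d reals_Archimedean[of "d / 2"] by auto
  let ?N = "real (Suc n)"
  let ?K = "{..Suc n} \<times> {..Suc n}"
  define h where "h z = (\<Sum>(i, j)\<in>?K. f (i / Suc n, j / Suc n) * indicator (cell (n, i, j)) z)" for z
  have fh: "\<bar>f z - h z\<bar> \<le> e / 2" if z: "z \<in> unit_square" for z
  proof -
    define i j where "i = nat \<lfloor>?N * fst z\<rfloor>" and "j = nat \<lfloor>?N * snd z\<rfloor>"
    have z': "0 \<le> fst z" "fst z \<le> 1" "0 \<le> snd z" "snd z \<le> 1" using z by auto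
    have ij: "int i = \<lfloor>?N * fst z\<rfloor>" "int j = \<lfloor>?N * snd z\<rfloor>"
      using z' by (simp_all add: i_def j_def)
    have le: "?N * fst z \<le> ?N * 1" "?N * snd z \<le> ?N * 1"
      using z' by (intro mult_left_mono; simp)+
    have ijn: "i \<le> Suc n" "j \<le> Suc n"
      using floor_mono[OF le(1)] floor_mono[OF le(2)] ij
      by (simp_all del: of_nat_Suc)
    have "(i', j') \<in> ?K \<Longrightarrow> indicator (cell (n, i', j')) z = (if (i', j') = (i, j) then 1 else 0 :: real)" for i' j'
      using z ij by (auto simp: cell_def indicator_def)
    then have "h z = (\<Sum>k\<in>?K. if k = (i, j) then f (i / Suc n, j / Suc n) else 0)"
      unfolding h_def by (intro sum.cong) (auto split: if_splits)
    also have "\<dots> = f (i / Suc n, j / Suc n)" using ijn by simp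
    finally have h: "h z = f (i / Suc n, j / Suc n)" .
    have fl: "\<bar>real i - ?N * fst z\<bar> \<le> 1" "\<bar>real j - ?N * snd z\<bar> \<le> 1"
      using ij by linarith+
    have "\<bar>i / Suc n - fst z\<bar> = \<bar>real i - ?N * fst z\<bar> / ?N" "\<bar>j / Suc n - snd z\<bar> = \<bar>real j - ?N * snd z\<bar> / ?N"
      by (simp_all add: field_simps abs_divide[symmetric] del: of_nat_Suc)
    then have "\<bar>i / Suc n - fst z\<bar> \<le> inverse ?N" "\<bar>j / Suc n - snd z\<bar> \<le> inverse ?N"
      using fl by (simp_all add: divide_inverse mult_left_le_one_le del: of_nat_Suc)
    then have "dist (real i / Suc n, real j / Suc n) z \<le> 2 * inverse ?N"
      using sqrt_sum_squares_le_sum_abs[of "i / Suc n - fst z" "j / Suc n - snd z"]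
      by (simp add: dist_prod_def dist_real_def)
    also have "\<dots> < d" using n by simp
    finally have "dist (f (i / Suc n, j / Suc n)) (f z) < e / 2"
      using ijn z by (intro d(2)) auto
    then show ?thesis using h by (simp add: dist_real_def abs_minus_commute)
  qed
  show thesis
  proof
    fix \<mu> assume \<mu>: "permuton \<mu>"
    interpret prob_space \<mu> using \<mu> by (rule permuton_prob_space)
    have [measurable_cong]: "sets \<mu> = sets square_borel" using \<mu> by (rule permuton_sets)
    have ind: "integrable \<mu> (indicator (cell k) :: _ \<Rightarrow> real)" for k
      by (intro integrable_real_indicator) (simp_all add: less_top[symmetric])
    then have int: "integrable \<mu> (\<lambda>z. f (i / Suc n, j / Suc n) * indicator (cell (n, i, j)) z)" for i j :: nat
      by (intro integrable_mult_right)
    then have inth: "integrable \<mu> h" unfolding h_def split_beta by (intro Bochner_Integration.integrable_sum)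
    have "(\<integral>z. h z \<partial>\<mu>) = grid_sum n f (cell_masses \<mu>)"
      unfolding h_def grid_sum_def split_beta cell_masses_def
      by (subst Bochner_Integration.integral_sum) (use ind in \<open>auto intro!: sum.cong simp: split_beta\<close>)
    moreover have "\<bar>(\<integral>z. f z \<partial>\<mu>) - (\<integral>z. h z \<partial>\<mu>)\<bar> \<le> (\<integral>z. e / 2 \<partial>\<mu>)"
    proof -
      have "(\<integral>z. f z \<partial>\<mu>) - (\<integral>z. h z \<partial>\<mu>) = (\<integral>z. f z - h z \<partial>\<mu>)"
        using continuous_square_integrable[OF f \<mu>] inth by (rule Bochner_Integration.integral_diff[symmetric])
      also have "\<bar>\<dots>\<bar> \<le> (\<integral>z. \<bar>f z - h z\<bar> \<partial>\<mu>)" by (rule integral_abs_bound)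
      also have "\<dots> \<le> (\<integral>z. e / 2 \<partial>\<mu>)"
        using continuous_square_integrable[OF f \<mu>] inth fh
        by (intro integral_mono) (auto simp: permuton_space[OF \<mu>])
      finally show ?thesis .
    qed
    ultimately show "\<bar>(\<integral>z. f z \<partial>\<mu>) - grid_sum n f (cell_masses \<mu>)\<bar> < e"
      using e by (simp add: prob_space)
  qed
qed

lemma open_grid_sum: "open V \<Longrightarrow> open {v. grid_sum n f v \<in> V}"
  unfolding grid_sum_def vimage_def[symmetric] split_beta
  by (rule open_vimage) (auto intro!: continuous_intros continuous_on_product_coordinates)

text \<open>For a subbasic set, take the union of all open sets of coordinates whose preimage stays inside it. A
Riemann sum is a continuous function of the coordinates and approximates the integral, so this union
already captures every point of the subbasic set. Finite intersections and arbitrary unions pass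
through preimages.\<close>

lemma weak_open_vimage_cell_masses:
  assumes "openin weak_topology W"
  shows "\<exists>G. open G \<and> W = {\<mu>. permuton \<mu> \<and> cell_masses \<mu> \<in> G}"
proof -
  have "generate_topology_on {{\<mu>. permuton \<mu> \<and> (\<integral>z. f z \<partial>\<mu>) \<in> V} | (f :: real \<times> real \<Rightarrow> real) V.
        continuous_on unit_square f \<and> open V} W"
    using assms unfolding weak_topology_def by (rule openin_topology_generated_by)
  then show ?thesis
  proof induction
    case Empty
    show ?case by (rule exI[of _ "{}"]) auto
  next
    case (Int A B)
    then obtain G H where "open G" "A = {\<mu>. permuton \<mu> \<and> cell_masses \<mu> \<in> G}"
      "open H" "B = {\<mu>. permuton \<mu> \<and> cell_masses \<mu> \<in> H}" by auto
    then show ?case by (intro exI[of _ "G \<inter> H"]) auto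
  next
    case (UN K)
    then have "\<forall>k\<in>K. \<exists>G. open G \<and> k = {\<mu>. permuton \<mu> \<and> cell_masses \<mu> \<in> G}" by auto
    from bchoice[OF this] obtain G where
      G: "\<And>k. k \<in> K \<Longrightarrow> open (G k) \<and> k = {\<mu>. permuton \<mu> \<and> cell_masses \<mu> \<in> G k}" by auto
    have "\<Union>K = {\<mu>. permuton \<mu> \<and> cell_masses \<mu> \<in> (\<Union>k\<in>K. G k)}"
      using G by blast
    moreover have "open (\<Union>k\<in>K. G k)" using G by auto
    ultimately show ?case by blast
  next
    case (Basis s)
    then obtain f :: "real \<times> real \<Rightarrow> real" and V where f: "continuous_on unit_square f"
      and V: "open V" and s: "s = {\<mu>. permuton \<mu> \<and> (\<integral>z. f z \<partial>\<mu>) \<in> V}" by auto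
    \<comment> \<open>The largest open set of coordinates whose preimage is contained in \<open>s\<close>.\<close>
    define G where "G = \<Union>{G. open G \<and> (\<forall>\<mu>. permuton \<mu> \<and> cell_masses \<mu> \<in> G \<longrightarrow> \<mu> \<in> s)}"
    have "open G" unfolding G_def by auto
    moreover have "s = {\<mu>. permuton \<mu> \<and> cell_masses \<mu> \<in> G}"
    proof (intro equalityI subsetI)
      fix \<mu> assume "\<mu> \<in> s"
      then have \<mu>: "permuton \<mu>" "(\<integral>z. f z \<partial>\<mu>) \<in> V" by (auto simp: s)
      obtain e where e: "0 < e" "ball (\<integral>z. f z \<partial>\<mu>) e \<subseteq> V"
        using V \<mu>(2) open_contains_ball by blast
      obtain n where n: "\<And>\<mu>. permuton \<mu> \<Longrightarrow> \<bar>(\<integral>z. f z \<partial>\<mu>) - grid_sum n f (cell_masses \<mu>)\<bar> < e / 2"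
        using grid_sum_approx[OF f, of "e / 2"] e by auto
      define H where "H = {v. grid_sum n f v \<in> ball (\<integral>z. f z \<partial>\<mu>) (e / 2)}"
      have "open H" unfolding H_def by (rule open_grid_sum) simp
      moreover have "\<mu>' \<in> s" if \<mu>': "permuton \<mu>'" "cell_masses \<mu>' \<in> H" for \<mu>'
      proof -
        have "\<bar>(\<integral>z. f z \<partial>\<mu>) - (\<integral>z. f z \<partial>\<mu>')\<bar> < e"
          using \<mu>'(2) n[OF \<mu>'(1)] unfolding H_def mem_Collect_eq mem_ball dist_real_def by linarith
        then have "(\<integral>z. f z \<partial>\<mu>') \<in> V" using e by (auto simp: dist_real_def)
        then show ?thesis using \<mu>' by (simp add: s)
      qed
      moreover have "cell_masses \<mu> \<in> H" using n[OF \<mu>(1)] by (auto simp: H_def dist_real_def)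
      ultimately show "\<mu> \<in> {\<mu>. permuton \<mu> \<and> cell_masses \<mu> \<in> G}"
        using \<mu> unfolding G_def by blast
    qed (auto simp: G_def)
    ultimately show ?case by blast
  qed
qed

lemma measurable_permuton_spaceI:
  assumes X: "X \<in> measurable M (subprob_algebra square_borel)"
    and perm: "\<And>\<omega>. \<omega> \<in> space M \<Longrightarrow> permuton (X \<omega>)"
  shows "X \<in> measurable M permuton_space"
  unfolding permuton_space_def
proof (rule measurable_measure_of)
  show "{W. openin weak_topology W} \<subseteq> Pow {\<mu>. permuton \<mu>}"
    using openin_weak_topology_permuton by auto
  show "X \<in> space M \<rightarrow> {\<mu>. permuton \<mu>}" using perm by auto
  fix W assume "W \<in> {W. openin weak_topology W}"
  then obtain G where G: "open G" "W = {\<mu>. permuton \<mu> \<and> cell_masses \<mu> \<in> G}"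
    using weak_open_vimage_cell_masses by auto
  have [measurable]: "(\<lambda>\<omega>. cell_masses (X \<omega>)) \<in> borel_measurable M"
    unfolding cell_masses_def
    by (rule measurable_coordinatewise_then_product)
      (use measurable_measure_subprob_algebra[OF cell_sets] X in measurable)
  have "(\<lambda>\<omega>. cell_masses (X \<omega>)) -` G \<inter> space M \<in> sets M"
    using G(1) by measurable
  also have "(\<lambda>\<omega>. cell_masses (X \<omega>)) -` G \<inter> space M = X -` W \<inter> space M"
    using perm G by auto
  finally show "X -` W \<inter> space M \<in> sets M" .
qed

lemma measurable_permuton_integral:
  fixes f :: "real \<times> real \<Rightarrow> real"
  assumes X: "X \<in> measurable M permuton_space" and f: "continuous_on unit_square f"
  shows "(\<lambda>\<omega>. \<integral>z. f z \<partial>X \<omega>) \<in> borel_measurable M"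
proof (rule borel_measurableI)
  fix V :: "real set" assume "open V"
  then have "openin weak_topology {\<mu>. permuton \<mu> \<and> (\<integral>z. f z \<partial>\<mu>) \<in> V}"
    unfolding weak_topology_def using f by (intro topology_generated_by_Basis) auto
  then have "{\<mu>. permuton \<mu> \<and> (\<integral>z. f z \<partial>\<mu>) \<in> V} \<in> sets permuton_space"
    by (simp add: sets_permuton_space)
  from measurable_sets[OF X this]
  have "X -` {\<mu>. permuton \<mu> \<and> (\<integral>z. f z \<partial>\<mu>) \<in> V} \<inter> space M \<in> sets M" .
  also have "X -` {\<mu>. permuton \<mu> \<and> (\<integral>z. f z \<partial>\<mu>) \<in> V} \<inter> space M = (\<lambda>\<omega>. \<integral>z. f z \<partial>X \<omega>) -` V \<inter> space M"
    using measurable_space[OF X] by auto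
  finally show "(\<lambda>\<omega>. \<integral>z. f z \<partial>X \<omega>) -` V \<inter> space M \<in> sets M" .
qed

text \<open>Lipschitz functions that decrease to the indicator of a closed set.\<close>

definition bump :: "(real \<times> real) set \<Rightarrow> nat \<Rightarrow> real \<times> real \<Rightarrow> real" where
  "bump C n z = max 0 (1 - real n * infdist z C)"

lemma bump_lipschitz: "(real n)-lipschitz_on A (bump C n)"
proof (rule lipschitz_onI)
  fix z w
  have "\<bar>bump C n z - bump C n w\<bar> \<le> \<bar>real n * infdist z C - real n * infdist w C\<bar>"
    unfolding bump_def by (auto simp: max_def abs_if)
  also have "\<dots> = real n * \<bar>infdist z C - infdist w C\<bar>"
    by (simp add: right_diff_distrib[symmetric] abs_mult)
  also have "\<dots> \<le> real n * dist z w"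
    by (intro mult_left_mono infdist_triangle_abs) auto
  finally show "dist (bump C n z) (bump C n w) \<le> real n * dist z w" by (simp add: dist_real_def)
qed simp

lemma bump_tendsto_indicator:
  assumes "closed C" "C \<noteq> {}"
  shows "(\<lambda>n. bump C n z) \<longlonglongrightarrow> indicator C z"
proof (cases "z \<in> C")
  case True
  then show ?thesis by (simp add: bump_def)
next
  case False
  then have d: "infdist z C > 0"
    using assms in_closed_iff_infdist_zero[of C z] infdist_nonneg[of z C] by fastforce
  obtain N where N: "1 < real N * infdist z C" using d reals_Archimedean3 by blast
  have "bump C n z = 0" if "n \<ge> N" for n
  proof -
    have "real N * infdist z C \<le> real n * infdist z C"
      using that d by (intro mult_right_mono) auto
    then show ?thesis using N by (simp add: bump_def)
  qed
  then have "eventually (\<lambda>n. bump C n z = indicator C z) sequentially"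
    using False by (auto simp: eventually_sequentially)
  then show ?thesis by (rule tendsto_eventually)
qed

lemma sets_square_borel_closed:
  "sets square_borel = sigma_sets unit_square {C. closed C \<and> C \<subseteq> unit_square}"
proof -
  let ?Q = "unit_square"
  have Q: "closed ?Q" by (intro closed_Times) auto
  have "sets square_borel = (\<inter>) ?Q ` sigma_sets UNIV (Collect closed)"
    unfolding square_borel_def sets_restrict_space borel_eq_closed by (simp add: sets_measure_of)
  also have "\<dots> = sigma_sets ?Q ((\<inter>) ?Q ` Collect closed)"
    using Q by (intro sigma_sets_Int) auto
  also have "(\<inter>) ?Q ` Collect closed = {C. closed C \<and> C \<subseteq> ?Q}"
    using Q by (auto simp: image_iff intro: exI[of _ "_ :: (real \<times> real) set"])
  finally show ?thesis .
qed

lemma measurable_subprob_algebra_squareI: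
  assumes perm: "\<And>\<omega>. \<omega> \<in> space M \<Longrightarrow> permuton (X \<omega>)"
    and lip: "\<And>C n. closed C \<Longrightarrow> C \<noteq> {} \<Longrightarrow> (\<lambda>\<omega>. \<integral>z. bump C n z \<partial>X \<omega>) \<in> borel_measurable M"
  shows "X \<in> measurable M (subprob_algebra square_borel)"
proof (rule measurable_subprob_algebra_generated[OF sets_square_borel_closed])
  show "Int_stable {C. closed C \<and> C \<subseteq> unit_square}"
    by (auto simp: Int_stable_def)
  show "subprob_space (X \<omega>)" "sets (X \<omega>) = sets square_borel" if "\<omega> \<in> space M" for \<omega>
    using perm[OF that] by (auto simp: permuton_def intro: prob_space_imp_subprob_space)
  show meas: "(\<lambda>\<omega>. emeasure (X \<omega>) C) \<in> borel_measurable M"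
    if "C \<in> {C. closed C \<and> C \<subseteq> unit_square}" for C
  proof (cases "C = {}")
    case False
    have C: "closed C" "C \<subseteq> unit_square" using that by auto
    have "(\<lambda>\<omega>. measure (X \<omega>) C) \<in> borel_measurable M"
    proof (rule borel_measurable_LIMSEQ_real)
      fix \<omega> assume "\<omega> \<in> space M"
      then have \<mu>: "permuton (X \<omega>)" by (rule perm)
      interpret prob_space "X \<omega>" using \<mu> by (rule permuton_prob_space)
      have [measurable_cong]: "sets (X \<omega>) = sets square_borel" using \<mu> by (rule permuton_sets)
      have [measurable]: "bump C n \<in> borel_measurable square_borel" for n
        by (intro continuous_square_measurable lipschitz_on_continuous_on[OF bump_lipschitz])
      have CX: "C \<in> sets (X \<omega>)"
        using C permuton_sets[OF \<mu>] by (auto simp: sets_square_borel_closed)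
      have b1: "\<bar>bump C n z\<bar> \<le> 1" for n z by (simp add: bump_def infdist_nonneg)
      have "(\<lambda>n. \<integral>z. bump C n z \<partial>X \<omega>) \<longlonglongrightarrow> (\<integral>z. indicator C z \<partial>X \<omega>)"
        by (rule integral_dominated_convergence[where w = "\<lambda>_. 1"])
          (use CX bump_tendsto_indicator[OF C(1) False] b1 in auto)
      then show "(\<lambda>n. \<integral>z. bump C n z \<partial>X \<omega>) \<longlonglongrightarrow> measure (X \<omega>) C"
        using CX by simp
    qed (rule lip[OF C(1) False])
    then have "(\<lambda>\<omega>. ennreal (measure (X \<omega>) C)) \<in> borel_measurable M" by measurable
    also have "?this \<longleftrightarrow> ?thesis"
      by (rule measurable_cong) (metis perm permuton_prob_space finite_measure.emeasure_eq_measure prob_space_def)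
    finally show ?thesis .
  qed simp
  have "closed unit_square" by (intro closed_Times) auto
  then show "(\<lambda>\<omega>. emeasure (X \<omega>) unit_square) \<in> borel_measurable M"
    by (intro meas) auto
qed auto

text \<open>Integrals of continuous functions determine the masses of closed sets, and those determine all
masses by a \<open>\<pi>\<close>-\<open>\<lambda>\<close> argument; conversely the masses of the grid cells control all weakly open sets. After
this, kernel lemmas for the Giry monad apply to random permutons.\<close>

theorem measurable_permuton_space_iff:
  "X \<in> measurable M permuton_space \<longleftrightarrow>
     X \<in> measurable M (subprob_algebra square_borel) \<and> (\<forall>\<omega>\<in>space M. permuton (X \<omega>))"
proof safe
  assume X: "X \<in> measurable M permuton_space"
  then show perm: "permuton (X \<omega>)" if "\<omega> \<in> space M" for \<omega>
    using measurable_space[OF X that] by simp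
  show "X \<in> measurable M (subprob_algebra square_borel)"
    by (intro measurable_subprob_algebra_squareI perm measurable_permuton_integral[OF X]
        lipschitz_on_continuous_on[OF bump_lipschitz])
qed (auto intro: measurable_permuton_spaceI)

section \<open>The map on laws induced by the tensor operation\<close>

lemma sets_Phi_space [measurable_cong]:
  "sets (Phi_space p M) = sets (M \<Otimes>\<^sub>M M \<Otimes>\<^sub>M Leb \<Otimes>\<^sub>M count_space UNIV)"
  unfolding Phi_space_def by (intro sets_pair_measure_cong sets_measure_pmf_count_space refl)

lemma space_Phi_space: "space (Phi_space p M) = space M \<times> space M \<times> {0..1} \<times> UNIV"
  by (simp add: Phi_space_def space_pair_measure)

lemma prob_space_measure_pmf: "prob_space (measure_pmf q)"
  by unfold_locales

lemma prob_space_Phi_space: "prob_space M \<Longrightarrow> prob_space (Phi_space p M)"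
  unfolding Phi_space_def
  by (intro prob_space_pair prob_space_Leb prob_space_measure_pmf)

lemma measurable_permuton_space_sets:
  "X \<in> measurable M permuton_space \<Longrightarrow> \<omega> \<in> space M \<Longrightarrow> permuton (X \<omega>)"
  using measurable_space[of X M permuton_space \<omega>] by simp

text \<open>For a fixed event, the mass given by the tensor is a combination of masses of the two factors under
push-forwards whose maps depend jointly measurably on the cut, the sign and the point.\<close>

lemma Phi_measurable:
  assumes X: "X \<in> measurable N permuton_space"
  shows "Phi X \<in> measurable (Phi_space p N) permuton_space"
proof (rule measurable_permuton_spaceI)
  show perm: "permuton (Phi X \<omega>)" if "\<omega> \<in> space (Phi_space p N)" for \<omega>
    using that measurable_permuton_space_sets[OF X]
    by (auto simp: Phi_def space_Phi_space intro!: permuton_tensor_permuton)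
  have X' [measurable]: "X \<in> measurable N (subprob_algebra square_borel)"
    using X by (simp add: measurable_permuton_space_iff)
  show "Phi X \<in> measurable (Phi_space p N) (subprob_algebra square_borel)"
  proof (rule measurable_subprob_algebra)
    fix A assume A: "A \<in> sets square_borel"
    have l: "(\<lambda>(\<omega>, z). left_map (fst (snd (snd \<omega>))) (snd (snd (snd \<omega>))) z)
        \<in> measurable (Phi_space p N \<Otimes>\<^sub>M square_borel) square_borel"
      and r: "(\<lambda>(\<omega>, z). right_map (fst (snd (snd \<omega>))) (snd (snd (snd \<omega>))) z)
        \<in> measurable (Phi_space p N \<Otimes>\<^sub>M square_borel) square_borel"
      unfolding measurable_square_borel_iff
      by (auto simp: left_map_def right_map_def space_pair_measure space_Phi_space affine_in_unit split_beta')
    have [measurable]: "(\<lambda>\<omega>. distr (X (fst \<omega>)) square_borel (left_map (fst (snd (snd \<omega>))) (snd (snd (snd \<omega>)))))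
        \<in> measurable (Phi_space p N) (subprob_algebra square_borel)"
      by (rule measurable_distr2[OF l]) measurable
    have [measurable]: "(\<lambda>\<omega>. distr (X (fst (snd \<omega>))) square_borel (right_map (fst (snd (snd \<omega>))) (snd (snd (snd \<omega>)))))
        \<in> measurable (Phi_space p N) (subprob_algebra square_borel)"
      by (rule measurable_distr2[OF r]) measurable
    note emeas = measurable_compose[OF _ measurable_emeasure_subprob_algebra[OF A]]
    have u [measurable]: "(\<lambda>\<omega>. fst (snd (snd \<omega>))) \<in> borel_measurable (Phi_space p N)"
      by (rule Leb_borel) measurable
    have [measurable]: "(\<lambda>\<omega>. emeasure (distr (X (fst \<omega>)) square_borel
          (left_map (fst (snd (snd \<omega>))) (snd (snd (snd \<omega>))))) A) \<in> borel_measurable (Phi_space p N)"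
      by (rule emeas) measurable
    have [measurable]: "(\<lambda>\<omega>. emeasure (distr (X (fst (snd \<omega>))) square_borel
          (right_map (fst (snd (snd \<omega>))) (snd (snd (snd \<omega>))))) A) \<in> borel_measurable (Phi_space p N)"
      by (rule emeas) measurable
    have "(\<lambda>\<omega>. ennreal (fst (snd (snd \<omega>))) *
          emeasure (distr (X (fst \<omega>)) square_borel (left_map (fst (snd (snd \<omega>))) (snd (snd (snd \<omega>))))) A +
        ennreal (1 - fst (snd (snd \<omega>))) *
          emeasure (distr (X (fst (snd \<omega>))) square_borel (right_map (fst (snd (snd \<omega>))) (snd (snd (snd \<omega>))))) A)
        \<in> borel_measurable (Phi_space p N)"
      by measurable
    then show "(\<lambda>\<omega>. emeasure (Phi X \<omega>) A) \<in> borel_measurable (Phi_space p N)"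
      by (simp add: Phi_def split_beta emeasure_permuton_tensor[OF A])
  qed (use perm in \<open>auto simp: permuton_def intro: prob_space_imp_subprob_space\<close>)
qed

lemma Phi_space_distr:
  assumes N: "prob_space N" and f [measurable]: "f \<in> measurable N K"
  shows "Phi_space p (distr N K f) =
    distr (Phi_space p N) (Phi_space p (distr N K f)) (\<lambda>(x, y, r). (f x, f y, r))"
proof -
  let ?R = "Leb \<Otimes>\<^sub>M measure_pmf (bernoulli_pmf p)"
  have R: "prob_space ?R" by (intro prob_space_pair prob_space_Leb prob_space_measure_pmf)
  have D: "prob_space (distr N K f)" by (rule prob_space.prob_space_distr[OF N f])
  have "distr N K f \<Otimes>\<^sub>M ?R = distr N K f \<Otimes>\<^sub>M distr ?R ?R (\<lambda>r. r)"
    by (simp add: distr_id2)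
  also have "\<dots> = distr (N \<Otimes>\<^sub>M ?R) (K \<Otimes>\<^sub>M ?R) (\<lambda>(x, r). (f x, r))"
    using prob_space.prob_space_distr[OF R, of "\<lambda>r. r" ?R]
    by (intro pair_measure_distr) (auto intro!: prob_space_imp_sigma_finite)
  finally have 1: "distr N K f \<Otimes>\<^sub>M ?R = distr (N \<Otimes>\<^sub>M ?R) (K \<Otimes>\<^sub>M ?R) (\<lambda>(x, r). (f x, r))" .
  have "distr N K f \<Otimes>\<^sub>M (distr N K f \<Otimes>\<^sub>M ?R) =
      distr (N \<Otimes>\<^sub>M (N \<Otimes>\<^sub>M ?R)) (K \<Otimes>\<^sub>M (K \<Otimes>\<^sub>M ?R)) (\<lambda>(x, y). (f x, (\<lambda>(x, r). (f x, r)) y))"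
    unfolding 1
    by (intro pair_measure_distr prob_space_imp_sigma_finite prob_space.prob_space_distr prob_space_pair N R)
      simp_all
  also have "\<dots> = distr (Phi_space p N) (Phi_space p (distr N K f)) (\<lambda>(x, y, r). (f x, f y, r))"
    unfolding Phi_space_def by (intro distr_cong) (auto simp: split_beta intro!: sets_pair_measure_cong)
  finally show ?thesis by (simp add: Phi_space_def)
qed

lemma sets_Phi_space_distr:
  "sets (Phi_space p (distr N K f)) = sets (K \<Otimes>\<^sub>M K \<Otimes>\<^sub>M Leb \<Otimes>\<^sub>M count_space UNIV)"
  unfolding sets_Phi_space by (intro sets_pair_measure_cong refl) simp_all

text \<open>The law of \<open>\<Phi>(X)\<close> depends on \<open>X\<close> only through its law. Fixed points may therefore be studied as
measures on the space of permutons.\<close>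

lemma distr_Phi:
  assumes N: "prob_space N" and X [measurable]: "X \<in> measurable N permuton_space"
  shows "distr (Phi_space p N) permuton_space (Phi X) =
    distr (Phi_space p (distr N permuton_space X)) permuton_space (Phi (\<lambda>\<mu>. \<mu>))"
proof -
  have m: "(\<lambda>(x, y, r). (X x, X y, r)) \<in> measurable (Phi_space p N) (Phi_space p (distr N permuton_space X))"
    unfolding measurable_cong_sets[OF sets_Phi_space sets_Phi_space_distr] split_beta'
    by measurable
  have "distr (Phi_space p (distr N permuton_space X)) permuton_space (Phi (\<lambda>\<mu>. \<mu>)) =
      distr (Phi_space p N) permuton_space (Phi (\<lambda>\<mu>. \<mu>) \<circ> (\<lambda>(x, y, r). (X x, X y, r)))"
    by (subst Phi_space_distr[OF N X], subst distr_distr[OF _ m])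
      (auto intro!: Phi_measurable)
  also have "Phi (\<lambda>\<mu>. \<mu>) \<circ> (\<lambda>(x, y, r). (X x, X y, r)) = Phi X"
    by (auto simp: Phi_def)
  finally show ?thesis ..
qed

lemma distr_pair_snd:
  assumes M: "prob_space M" and N: "prob_space N"
  shows "distr (M \<Otimes>\<^sub>M N) N snd = N"
proof (rule measure_eqI)
  interpret M: prob_space M by (rule M)
  interpret N: prob_space N by (rule N)
  fix A assume "A \<in> sets (distr (M \<Otimes>\<^sub>M N) N snd)"
  then have A: "A \<in> sets N" by simp
  then have "snd -` A \<inter> space (M \<Otimes>\<^sub>M N) = space M \<times> A"
    using sets.sets_into_space by (auto simp: space_pair_measure)
  then show "emeasure (distr (M \<Otimes>\<^sub>M N) N snd) A = emeasure N A"
    using A by (simp add: emeasure_distr N.emeasure_pair_measure_Times M.emeasure_space_1)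
qed simp

lemma nn_integral_Leb_square:
  "(\<integral>\<^sup>+u. ennreal (u\<^sup>2) \<partial>Leb) = ennreal (1 / 3)"
  "(\<integral>\<^sup>+u. ennreal ((1 - u)\<^sup>2) \<partial>Leb) = ennreal (1 / 3)"
proof -
  have "(\<integral>\<^sup>+u. ennreal (u\<^sup>2) * indicator {0..1} u \<partial>lborel) = ennreal (1 ^ 3 / 3 - 0 ^ 3 / 3)"
    by (rule nn_integral_FTC_Icc[where F = "\<lambda>u. u ^ 3 / 3"]) (auto intro!: derivative_eq_intros)
  then show "(\<integral>\<^sup>+u. ennreal (u\<^sup>2) \<partial>Leb) = ennreal (1 / 3)" by (simp add: nn_integral_Leb)
  have "(\<integral>\<^sup>+u. ennreal ((1 - u)\<^sup>2) * indicator {0..1} u \<partial>lborel) = ennreal (- ((1 - 1) ^ 3 / 3) - - ((1 - 0) ^ 3 / 3))"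
    by (rule nn_integral_FTC_Icc[where F = "\<lambda>u. - ((1 - u) ^ 3 / 3)"])
      (auto intro!: derivative_eq_intros simp: power2_eq_square)
  then show "(\<integral>\<^sup>+u. ennreal ((1 - u)\<^sup>2) \<partial>Leb) = ennreal (1 / 3)" by (simp add: nn_integral_Leb)
qed

text \<open>The contraction constant: a uniform \<open>U\<close> has \<open>E(U\<^sup>2 + (1 - U)\<^sup>2) = 1/3 + 1/3\<close>. It is used both for the
expected radius of the coupling and for the expected defect of the second marginal.\<close>

lemma nn_integral_Phi_space_squares:
  assumes M: "prob_space M" and h [measurable]: "h \<in> borel_measurable M"
  shows "(\<integral>\<^sup>+(x, y, u, s). ennreal (u\<^sup>2) * h x + ennreal ((1 - u)\<^sup>2) * h y \<partial>Phi_space p M) =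
    ennreal (2 / 3) * (\<integral>\<^sup>+x. h x \<partial>M)"
proof -
  interpret M: prob_space M by (rule M)
  let ?B = "measure_pmf (bernoulli_pmf p)"
  interpret LB: prob_space "Leb \<Otimes>\<^sub>M ?B" by (intro prob_space_pair prob_space_Leb prob_space_measure_pmf)
  interpret MLB: prob_space "M \<Otimes>\<^sub>M (Leb \<Otimes>\<^sub>M ?B)" by (intro prob_space_pair M LB.prob_space_axioms)
  have [measurable_cong]: "sets ?B = sets (count_space UNIV)" by simp
  have e: "emeasure ?B UNIV = 1" using measure_pmf.emeasure_space_1[of "bernoulli_pmf p"] by simp
  have "(\<integral>\<^sup>+(x, y, u, s). ennreal (u\<^sup>2) * h x + ennreal ((1 - u)\<^sup>2) * h y \<partial>Phi_space p M) =
     (\<integral>\<^sup>+x. \<integral>\<^sup>+y. \<integral>\<^sup>+u. \<integral>\<^sup>+s. ennreal (u\<^sup>2) * h x + ennreal ((1 - u)\<^sup>2) * h y \<partial>?B \<partial>Leb \<partial>M \<partial>M)"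
    unfolding Phi_space_def
    by (simp add: MLB.nn_integral_fst[symmetric] LB.nn_integral_fst[symmetric]
        measure_pmf.nn_integral_fst[symmetric] split_beta)
  also have "\<dots> = (\<integral>\<^sup>+x. \<integral>\<^sup>+y. ennreal (1 / 3) * h x + ennreal (1 / 3) * h y \<partial>M \<partial>M)"
    by (simp add: nn_integral_add nn_integral_multc nn_integral_Leb_square e)
  also have "\<dots> = ennreal (1 / 3) * (\<integral>\<^sup>+x. h x \<partial>M) + ennreal (1 / 3) * (\<integral>\<^sup>+x. h x \<partial>M)"
    by (simp add: nn_integral_add nn_integral_cmult M.emeasure_space_1)
  also have "\<dots> = (ennreal (1 / 3) + ennreal (1 / 3)) * (\<integral>\<^sup>+x. h x \<partial>M)"
    by (simp only: distrib_right)
  also have "ennreal (1 / 3) + ennreal (1 / 3) = ennreal (2 / 3)"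
    by (subst ennreal_plus[symmetric]) auto
  finally show ?thesis .
qed

section \<open>Uniqueness of the invariant law\<close>

text \<open>One direction of a bound on the bounded-Lipschitz distance, stated for all Lipschitz constants at
once. Nonnegative test functions keep everything inside nonnegative integration, and a one-sided
inequality is enough because it will be used in both directions.\<close>

definition close_below :: "real \<Rightarrow> (real \<times> real) measure \<Rightarrow> (real \<times> real) measure \<Rightarrow> bool" where
  "close_below r \<mu> \<nu> \<longleftrightarrow> (\<forall>f L. L-lipschitz_on unit_square f \<and> (\<forall>z\<in>unit_square. 0 \<le> f z) \<longrightarrow>
     (\<integral>\<^sup>+z. f z \<partial>\<mu>) \<le> (\<integral>\<^sup>+z. f z \<partial>\<nu>) + ennreal (L * r))"

lemma dist_left_map: "0 \<le> u \<Longrightarrow> dist (left_map u s z) (left_map u s w) = u * dist z w"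
  and dist_right_map: "u \<le> 1 \<Longrightarrow> dist (right_map u s z) (right_map u s w) = (1 - u) * dist z w"
proof -
  have *: "sqrt ((c * a - c * a')\<^sup>2 + (c * b - c * b')\<^sup>2) = c * sqrt ((a - a')\<^sup>2 + (b - b')\<^sup>2)"
    if "0 \<le> c" for a b a' b' c :: real
    using that by (simp add: right_diff_distrib[symmetric] power_mult_distrib distrib_left[symmetric]
        real_sqrt_mult)
  show "0 \<le> u \<Longrightarrow> dist (left_map u s z) (left_map u s w) = u * dist z w"
    using *[of u] by (simp add: left_map_def dist_prod_def dist_real_def split_beta)
  show "u \<le> 1 \<Longrightarrow> dist (right_map u s z) (right_map u s w) = (1 - u) * dist z w"
    using *[of "1 - u"] by (simp add: right_map_def dist_prod_def dist_real_def split_beta)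
qed

lemma close_belowD:
  assumes "close_below r \<mu> \<nu>" "L-lipschitz_on unit_square f" "\<And>z. z \<in> unit_square \<Longrightarrow> 0 \<le> f z"
  shows "(\<integral>\<^sup>+z. f z \<partial>\<mu>) \<le> (\<integral>\<^sup>+z. f z \<partial>\<nu>) + ennreal (L * r)"
  using assms unfolding close_below_def by blast

lemma close_below_integral:
  assumes "close_below r \<mu> \<nu>" "close_below r \<nu> \<mu>" "permuton \<mu>" "permuton \<nu>" "0 \<le> r"
    and f: "L-lipschitz_on unit_square f" "\<And>z. z \<in> unit_square \<Longrightarrow> 0 \<le> f z"
  shows "\<bar>(\<integral>z. f z \<partial>\<mu>) - (\<integral>z. f z \<partial>\<nu>)\<bar> \<le> L * r"
proof -
  have *: "(\<integral>\<^sup>+z. f z \<partial>\<rho>) = ennreal (\<integral>z. f z \<partial>\<rho>)" "0 \<le> (\<integral>z. f z \<partial>\<rho>)" if "permuton \<rho>" for \<rho>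
    using that f(2) continuous_square_integrable[OF lipschitz_on_continuous_on[OF f(1)] that]
    by (auto intro!: nn_integral_eq_integral Bochner_Integration.integral_nonneg simp: permuton_space)
  have "0 \<le> L * r" using lipschitz_on_nonneg[OF f(1)] assms(5) by simp
  then show ?thesis
    using close_belowD[OF assms(1) f] close_belowD[OF assms(2) f] *[OF assms(3)] *[OF assms(4)]
    by (simp add: ennreal_plus[symmetric] abs_le_iff del: ennreal_plus)
qed

text \<open>Composing an \<open>L\<close>-Lipschitz function with a rescaling map gives an \<open>L u\<close>-Lipschitz or
\<open>L (1 - u)\<close>-Lipschitz function, and the corresponding block has mass \<open>u\<close> or \<open>1 - u\<close>. The product of the two
factors is the square in the new radius.\<close>

lemma close_below_permuton_tensor:
  assumes u: "0 \<le> u" "u \<le> 1" and rq: "0 \<le> r" "0 \<le> q"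
    and perm: "permuton \<mu>" "permuton \<mu>'" "permuton \<nu>" "permuton \<nu>'"
    and cl: "close_below r \<mu> \<mu>'" "close_below q \<nu> \<nu>'"
  shows "close_below (u\<^sup>2 * r + (1 - u)\<^sup>2 * q) (permuton_tensor u s \<mu> \<nu>) (permuton_tensor u s \<mu>' \<nu>')"
  unfolding close_below_def
proof (intro allI impI, elim conjE)
  fix f :: "real \<times> real \<Rightarrow> real" and L
  assume L: "L-lipschitz_on unit_square f" and f0: "\<forall>z\<in>unit_square. 0 \<le> f z"
  note L0 = lipschitz_on_nonneg[OF L]
  have [measurable]: "f \<in> borel_measurable square_borel"
    by (rule continuous_square_measurable[OF lipschitz_on_continuous_on[OF L]])
  note T = nn_integral_permuton_tensor[OF u, of _ _ "\<lambda>z. ennreal (f z)", OF permuton_sets permuton_sets]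
  have Q: "left_map u s z \<in> unit_square" "right_map u s z \<in> unit_square" if "z \<in> unit_square" for z
    using that measurable_space[OF left_map_measurable[OF u]] measurable_space[OF right_map_measurable[OF u]] by auto
  have "(L * u)-lipschitz_on unit_square (\<lambda>z. f (left_map u s z))"
    using lipschitz_onD[OF L Q(1) Q(1)] L0 u by (intro lipschitz_onI) (simp_all only: dist_left_map mult.assoc mult_nonneg_nonneg)
  then have a: "(\<integral>\<^sup>+z. f (left_map u s z) \<partial>\<mu>) \<le> (\<integral>\<^sup>+z. f (left_map u s z) \<partial>\<mu>') + ennreal (L * u * r)"
    by (rule close_belowD[OF cl(1)]) (rule f0[rule_format, OF Q(1)])
  have "(L * (1 - u))-lipschitz_on unit_square (\<lambda>z. f (right_map u s z))"
    using lipschitz_onD[OF L Q(2) Q(2)] L0 u by (intro lipschitz_onI) (simp_all only: dist_right_map mult.assoc mult_nonneg_nonneg diff_ge_0_iff_ge)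
  then have b: "(\<integral>\<^sup>+z. f (right_map u s z) \<partial>\<nu>) \<le> (\<integral>\<^sup>+z. f (right_map u s z) \<partial>\<nu>') + ennreal (L * (1 - u) * q)"
    by (rule close_belowD[OF cl(2)]) (rule f0[rule_format, OF Q(2)])
  have "(\<integral>\<^sup>+z. f z \<partial>permuton_tensor u s \<mu> \<nu>) \<le>
      ennreal u * ((\<integral>\<^sup>+z. f (left_map u s z) \<partial>\<mu>') + ennreal (L * u * r)) +
      ennreal (1 - u) * ((\<integral>\<^sup>+z. f (right_map u s z) \<partial>\<nu>') + ennreal (L * (1 - u) * q))"
    using a b by (subst T) (auto simp: perm intro!: add_mono mult_left_mono)
  also have "\<dots> = (\<integral>\<^sup>+z. f z \<partial>permuton_tensor u s \<mu>' \<nu>') + (ennreal (u * (L * u * r)) + ennreal ((1 - u) * (L * (1 - u) * q)))"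
    using u L0 rq by (subst T) (simp_all add: perm distrib_left ennreal_mult add_ac)
  also have "ennreal (u * (L * u * r)) + ennreal ((1 - u) * (L * (1 - u) * q)) = ennreal (L * (u\<^sup>2 * r + (1 - u)\<^sup>2 * q))"
    using u L0 rq by (subst ennreal_plus[symmetric], simp, simp) (simp add: power2_eq_square algebra_simps)
  finally show "(\<integral>\<^sup>+z. f z \<partial>permuton_tensor u s \<mu> \<nu>) \<le>
      (\<integral>\<^sup>+z. f z \<partial>permuton_tensor u s \<mu>' \<nu>') + ennreal (L * (u\<^sup>2 * r + (1 - u)\<^sup>2 * q))" .
qed

text \<open>The unit square has diameter at most 2, so an \<open>L\<close>-Lipschitz function oscillates by at most \<open>2 L\<close>.\<close>

lemma close_below_2:
  assumes \<mu>: "permuton \<mu>" and \<nu>: "permuton \<nu>" shows "close_below 2 \<mu> \<nu>"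
  unfolding close_below_def
proof (intro allI impI, elim conjE)
  fix f :: "real \<times> real \<Rightarrow> real" and L
  assume L: "L-lipschitz_on unit_square f" and f0: "\<forall>z\<in>unit_square. 0 \<le> f z"
  interpret \<mu>: prob_space \<mu> using \<mu> by (rule permuton_prob_space)
  interpret \<nu>: prob_space \<nu> using \<nu> by (rule permuton_prob_space)
  have le: "f z \<le> f w + L * 2" if "z \<in> unit_square" "w \<in> unit_square" for z w
  proof -
    have "dist z w \<le> \<bar>fst z - fst w\<bar> + \<bar>snd z - snd w\<bar>"
      using sqrt_sum_squares_le_sum_abs[of "fst z - fst w" "snd z - snd w"] by (simp add: dist_prod_def dist_real_def)
    also have "\<dots> \<le> 2" using that by auto
    finally have "L * dist z w \<le> L * 2" by (intro mult_left_mono lipschitz_on_nonneg[OF L])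
    then show ?thesis using lipschitz_onD[OF L that] by (simp add: dist_real_def)
  qed
  have "(\<integral>\<^sup>+z. f z \<partial>\<mu>) \<le> ennreal (f w) + ennreal (L * 2)" if "w \<in> space \<nu>" for w
  proof -
    have "(\<integral>\<^sup>+z. f z \<partial>\<mu>) \<le> (\<integral>\<^sup>+z. ennreal (f w + L * 2) \<partial>\<mu>)"
      using that le by (intro nn_integral_mono ennreal_leI) (auto simp: permuton_space \<mu> \<nu>)
    then show ?thesis
      using f0[rule_format, of w] that lipschitz_on_nonneg[OF L]
      by (simp add: \<mu>.emeasure_space_1 permuton_space[OF \<nu>] ennreal_plus[symmetric] del: ennreal_plus)
  qed
  then have "(\<integral>\<^sup>+w. (\<integral>\<^sup>+z. f z \<partial>\<mu>) \<partial>\<nu>) \<le> (\<integral>\<^sup>+w. ennreal (f w) + ennreal (L * 2) \<partial>\<nu>)" by (rule nn_integral_mono)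
  also have "\<dots> = (\<integral>\<^sup>+w. ennreal (f w) \<partial>\<nu>) + ennreal (L * 2)"
    using continuous_square_measurable[OF lipschitz_on_continuous_on[OF L]]
    by (subst nn_integral_add) (simp_all add: measurable_cong_sets[OF permuton_sets[OF \<nu>] refl] \<nu>.emeasure_space_1)
  finally show "(\<integral>\<^sup>+z. f z \<partial>\<mu>) \<le> (\<integral>\<^sup>+z. f z \<partial>\<nu>) + ennreal (L * 2)" by (simp add: \<nu>.emeasure_space_1)
qed

definition close_triples :: "((real \<times> real) measure \<times> (real \<times> real) measure \<times> real) set" where
  "close_triples = {(\<mu>, \<nu>, r). permuton \<mu> \<and> permuton \<nu> \<and> 0 \<le> r \<and> close_below r \<mu> \<nu> \<and> close_below r \<nu> \<mu>}"

text \<open>Two permutons together with a certified radius. The set of such triples need not be measurable, but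
restricting the \<open>\<sigma>\<close>-algebra to it is harmless: a map into the product that takes values in it is
measurable into the restricted space, and the closeness then holds at every point.\<close>

definition triple_space :: "((real \<times> real) measure \<times> (real \<times> real) measure \<times> real) measure" where
  "triple_space = restrict_space (permuton_space \<Otimes>\<^sub>M permuton_space \<Otimes>\<^sub>M borel) close_triples"

text \<open>The same cut and the same sign are applied to both coordinates of the coupling; this is what makes the
radius shrink.\<close>

definition coupled_tensor where
  "coupled_tensor = (\<lambda>((\<mu>, \<mu>', r), (\<nu>, \<nu>', q), u, s).
     (permuton_tensor u s \<mu> \<nu>, permuton_tensor u s \<mu>' \<nu>', u\<^sup>2 * r + (1 - u)\<^sup>2 * q :: real))"

primrec coupling :: "real \<Rightarrow> (real \<times> real) measure measure \<Rightarrow> (real \<times> real) measure measure \<Rightarrow> nat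
    \<Rightarrow> ((real \<times> real) measure \<times> (real \<times> real) measure \<times> real) measure" where
  "coupling p m m' 0 = distr (m \<Otimes>\<^sub>M m') triple_space (\<lambda>(\<mu>, \<nu>). (\<mu>, \<nu>, 2))"
| "coupling p m m' (Suc n) = distr (Phi_space p (coupling p m m' n)) triple_space coupled_tensor"

lemma space_triple_space: "space triple_space = close_triples"
  unfolding triple_space_def space_restrict_space
  by (auto simp: space_pair_measure close_triples_def)

lemma measurable_triple_space:
  "f \<in> measurable M triple_space \<longleftrightarrow>
     f \<in> measurable M (permuton_space \<Otimes>\<^sub>M permuton_space \<Otimes>\<^sub>M borel) \<and> (\<forall>x\<in>space M. f x \<in> close_triples)"
  unfolding triple_space_def measurable_restrict_space2_iff by auto

lemma triple_space_projections [measurable]: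
  "fst \<in> measurable triple_space permuton_space"
  "(\<lambda>t. fst (snd t)) \<in> measurable triple_space permuton_space"
  "(\<lambda>t. snd (snd t)) \<in> borel_measurable triple_space"
  unfolding triple_space_def by (intro measurable_restrict_space1; measurable)+

lemma coupled_tensor_measurable:
  assumes G: "sets G = sets triple_space"
  shows "coupled_tensor \<in> measurable (Phi_space p G) triple_space"
  unfolding measurable_triple_space
proof
  have [measurable_cong]: "sets G = sets triple_space" by (rule G)
  have fst: "fst \<in> measurable G permuton_space" and snd: "(\<lambda>t. fst (snd t)) \<in> measurable G permuton_space"
    by measurable
  note [measurable] = Phi_measurable[OF fst, of p] Phi_measurable[OF snd, of p]
  have u [measurable]: "(\<lambda>\<omega>. fst (snd (snd \<omega>))) \<in> borel_measurable (Phi_space p G)"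
    by (rule Leb_borel) measurable
  have [measurable]: "(\<lambda>\<omega>. snd (snd (fst \<omega>))) \<in> borel_measurable (Phi_space p G)"
    "(\<lambda>\<omega>. snd (snd (fst (snd \<omega>)))) \<in> borel_measurable (Phi_space p G)"
    by measurable
  have "(\<lambda>\<omega>. (Phi fst \<omega>, Phi (\<lambda>t. fst (snd t)) \<omega>, (fst (snd (snd \<omega>)))\<^sup>2 * snd (snd (fst \<omega>)) +
      (1 - fst (snd (snd \<omega>)))\<^sup>2 * snd (snd (fst (snd \<omega>)))))
    \<in> measurable (Phi_space p G) (permuton_space \<Otimes>\<^sub>M permuton_space \<Otimes>\<^sub>M borel)"
    by measurable
  then show "coupled_tensor \<in> measurable (Phi_space p G) (permuton_space \<Otimes>\<^sub>M permuton_space \<Otimes>\<^sub>M borel)"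
    by (simp add: coupled_tensor_def Phi_def split_beta')
  show "\<forall>x\<in>space (Phi_space p G). coupled_tensor x \<in> close_triples"
    using sets_eq_imp_space_eq[OF G]
    by (auto simp: space_Phi_space space_triple_space close_triples_def coupled_tensor_def
        intro!: permuton_tensor_permuton close_below_permuton_tensor)
qed

text \<open>Functionals that the coupling argument can compare, closed under pointwise minimum.\<close>

definition lipschitz_tests :: "((real \<times> real) measure \<Rightarrow> real) set" where
  "lipschitz_tests = {G. G \<in> borel_measurable permuton_space \<and> (\<forall>\<mu>. permuton \<mu> \<longrightarrow> 0 \<le> G \<mu> \<and> G \<mu> \<le> 1) \<and>
     (\<exists>C. \<forall>\<mu> \<nu> r. (\<mu>, \<nu>, r) \<in> close_triples \<longrightarrow> \<bar>G \<mu> - G \<nu>\<bar> \<le> C * r)}"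

text \<open>The sets whose indicator is a limit of such functionals. Stability under minimum makes them a
\<open>\<pi>\<close>-system.\<close>

definition test_sets :: "(real \<times> real) measure set set" where
  "test_sets = {A. A \<subseteq> {\<mu>. permuton \<mu>} \<and> (\<exists>G. (\<forall>n. G n \<in> lipschitz_tests) \<and>
     (\<forall>\<mu>. permuton \<mu> \<longrightarrow> (\<lambda>n :: nat. G n \<mu>) \<longlonglongrightarrow> indicator A \<mu>))}"

lemma lipschitz_tests_min: "G \<in> lipschitz_tests \<Longrightarrow> H \<in> lipschitz_tests \<Longrightarrow> (\<lambda>\<mu>. min (G \<mu>) (H \<mu>)) \<in> lipschitz_tests"
proof -
  assume G: "G \<in> lipschitz_tests" and H: "H \<in> lipschitz_tests"
  obtain C where C: "\<And>\<mu> \<nu> r. (\<mu>, \<nu>, r) \<in> close_triples \<Longrightarrow> \<bar>G \<mu> - G \<nu>\<bar> \<le> C * r" using G by (auto simp: lipschitz_tests_def)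
  obtain D where D: "\<And>\<mu> \<nu> r. (\<mu>, \<nu>, r) \<in> close_triples \<Longrightarrow> \<bar>H \<mu> - H \<nu>\<bar> \<le> D * r" using H by (auto simp: lipschitz_tests_def)
  have "\<bar>min (G \<mu>) (H \<mu>) - min (G \<nu>) (H \<nu>)\<bar> \<le> max C D * r" if t: "(\<mu>, \<nu>, r) \<in> close_triples" for \<mu> \<nu> r
  proof -
    have "0 \<le> r" using t by (auto simp: close_triples_def)
    then have "C * r \<le> max C D * r" "D * r \<le> max C D * r" by (auto intro: mult_right_mono)
    then show ?thesis using C[OF t] D[OF t] by linarith
  qed
  moreover have "(\<lambda>\<mu>. min (G \<mu>) (H \<mu>)) \<in> borel_measurable permuton_space"
    using G H by (intro borel_measurable_min) (auto simp: lipschitz_tests_def)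
  moreover have "0 \<le> min (G \<mu>) (H \<mu>) \<and> min (G \<mu>) (H \<mu>) \<le> 1" if "permuton \<mu>" for \<mu>
    using G H that by (auto simp: lipschitz_tests_def min_def)
  ultimately show ?thesis unfolding lipschitz_tests_def by blast
qed

lemma Int_stable_test_sets: "Int_stable test_sets"
proof (rule Int_stableI)
  fix A B assume "A \<in> test_sets" "B \<in> test_sets"
  then obtain G H where *: "A \<subseteq> {\<mu>. permuton \<mu>}" "\<And>n. G n \<in> lipschitz_tests" "\<And>n. H n \<in> lipschitz_tests"
    "\<And>\<mu>. permuton \<mu> \<Longrightarrow> (\<lambda>n :: nat. G n \<mu>) \<longlonglongrightarrow> indicator A \<mu>"
    "\<And>\<mu>. permuton \<mu> \<Longrightarrow> (\<lambda>n :: nat. H n \<mu>) \<longlonglongrightarrow> indicator B \<mu>"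
    unfolding test_sets_def by auto
  have "(\<lambda>n. min (G n \<mu>) (H n \<mu>)) \<longlonglongrightarrow> indicator (A \<inter> B) \<mu>" if "permuton \<mu>" for \<mu>
  proof -
    have "(\<lambda>n. min (G n \<mu>) (H n \<mu>)) \<longlonglongrightarrow> min (indicator A \<mu>) (indicator B \<mu>)"
      by (intro tendsto_min * that)
    also have "min (indicator A \<mu>) (indicator B \<mu>) = (indicator (A \<inter> B) \<mu> :: real)" by (auto simp: indicator_def)
    finally show ?thesis .
  qed
  with * show "A \<inter> B \<in> test_sets"
    unfolding test_sets_def by (auto intro!: exI[of _ "\<lambda>n \<mu>. min (G n \<mu>) (H n \<mu>)"] lipschitz_tests_min)
qed

text \<open>The indicator of \<open>{t. c < t}\<close> is the limit of the ramps \<open>t \<mapsto> max 0 (min 1 (n (t - c)))\<close>, which are Lipschitz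
and evaluated here at an integral.\<close>

lemma superlevel_test_sets:
  fixes f :: "real \<times> real \<Rightarrow> real"
  assumes f: "L-lipschitz_on (unit_square) f" "\<And>z. z \<in> unit_square \<Longrightarrow> 0 \<le> f z"
  shows "{\<mu>. permuton \<mu> \<and> c < (\<integral>z. f z \<partial>\<mu>)} \<in> test_sets" (is "?A \<in> _")
proof -
  define G where "G n \<mu> = max 0 (min 1 (real n * ((\<integral>z. f z \<partial>\<mu>) - c)))" for n \<mu>
  have "G n \<in> lipschitz_tests" for n
  proof -
    have "(\<lambda>\<mu>. \<integral>z. f z \<partial>\<mu>) \<in> borel_measurable permuton_space"
      by (rule measurable_permuton_integral[OF _ lipschitz_on_continuous_on[OF f(1)]]) simp
    then have "G n \<in> borel_measurable permuton_space" unfolding G_def by measurable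
    moreover have "\<bar>G n \<mu> - G n \<nu>\<bar> \<le> (real n * L) * r" if t: "(\<mu>, \<nu>, r) \<in> close_triples" for \<mu> \<nu> r
    proof -
      have "\<bar>(\<integral>z. f z \<partial>\<mu>) - (\<integral>z. f z \<partial>\<nu>)\<bar> \<le> L * r"
        using t by (intro close_below_integral f) (auto simp: close_triples_def)
      then have "real n * \<bar>(\<integral>z. f z \<partial>\<mu>) - (\<integral>z. f z \<partial>\<nu>)\<bar> \<le> real n * (L * r)"
        by (intro mult_left_mono) auto
      moreover have "\<bar>G n \<mu> - G n \<nu>\<bar> \<le> \<bar>real n * ((\<integral>z. f z \<partial>\<mu>) - c) - real n * ((\<integral>z. f z \<partial>\<nu>) - c)\<bar>"
        unfolding G_def by linarith
      moreover have "\<dots> = real n * \<bar>(\<integral>z. f z \<partial>\<mu>) - (\<integral>z. f z \<partial>\<nu>)\<bar>"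
        by (simp add: right_diff_distrib[symmetric] abs_mult)
      ultimately show ?thesis by (simp add: mult.assoc)
    qed
    ultimately show ?thesis by (auto simp: lipschitz_tests_def G_def intro!: exI[of _ "real n * L"])
  qed
  moreover have "(\<lambda>n. G n \<mu>) \<longlonglongrightarrow> indicator ?A \<mu>" if "permuton \<mu>" for \<mu>
  proof (cases "c < (\<integral>z. f z \<partial>\<mu>)")
    case True
    let ?d = "(\<integral>z. f z \<partial>\<mu>) - c"
    obtain N where N: "1 < real N * ?d" using True reals_Archimedean3[of ?d] by auto
    have "G n \<mu> = 1" if "N \<le> n" for n
    proof -
      have "real N * ?d \<le> real n * ?d" using that True by (intro mult_right_mono) auto
      then show ?thesis using N by (simp add: G_def)
    qed
    then have "eventually (\<lambda>n. G n \<mu> = indicator ?A \<mu>) sequentially"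
      using True that by (auto simp: eventually_sequentially)
    then show ?thesis by (rule tendsto_eventually)
  next
    case False
    then have nonpos: "real n * ((\<integral>z. f z \<partial>\<mu>) - c) \<le> 0" for n by (intro mult_nonneg_nonpos) auto
    have "G n \<mu> = 0" for n unfolding G_def using nonpos[of n] by linarith
    then show ?thesis using False by simp
  qed
  ultimately show ?thesis unfolding test_sets_def by auto
qed

lemma test_sets_measurable:
  assumes "A \<in> test_sets" shows "A \<in> sets permuton_space"
proof -
  obtain G where G: "A \<subseteq> {\<mu>. permuton \<mu>}" "\<And>n. G n \<in> lipschitz_tests"
    "\<And>\<mu>. permuton \<mu> \<Longrightarrow> (\<lambda>n :: nat. G n \<mu>) \<longlonglongrightarrow> indicator A \<mu>"
    using assms unfolding test_sets_def by auto
  have "(indicator A :: _ \<Rightarrow> real) \<in> borel_measurable permuton_space"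
    by (rule borel_measurable_LIMSEQ_real[of _ G]) (use G in \<open>auto simp: lipschitz_tests_def\<close>)
  then show ?thesis using G(1) by (simp add: borel_measurable_indicator_iff Int_absorb2 Int_absorb1)
qed

text \<open>Superlevel sets of integrals of bump functions are test sets. Hence these integrals are measurable for
the \<open>\<sigma>\<close>-algebra that the test sets generate, and so is the identity map into the space of permutons.\<close>

lemma sets_permuton_space_test_sets:
  "sets permuton_space = sigma_sets {\<mu>. permuton \<mu>} test_sets"
proof (intro equalityI)
  have sub: "test_sets \<subseteq> Pow {\<mu>. permuton \<mu>}" by (auto simp: test_sets_def)
  show "sigma_sets {\<mu>. permuton \<mu>} test_sets \<subseteq> sets permuton_space"
    using sets.sigma_sets_subset[of test_sets permuton_space] test_sets_measurable by auto
  let ?S = "sigma {\<mu>. permuton \<mu>} test_sets"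
  have S: "space ?S = {\<mu>. permuton \<mu>}" "sets ?S = sigma_sets {\<mu>. permuton \<mu>} test_sets"
    using sub by (simp_all add: space_measure_of_conv sets_measure_of)
  have "(\<lambda>\<mu>. \<mu>) \<in> measurable ?S permuton_space"
    unfolding measurable_permuton_space_iff
  proof
    show "(\<lambda>\<mu>. \<mu>) \<in> measurable ?S (subprob_algebra square_borel)"
    proof (rule measurable_subprob_algebra_squareI)
      fix C :: "(real \<times> real) set" and n
      show "(\<lambda>\<mu>. \<integral>z. bump C n z \<partial>\<mu>) \<in> borel_measurable ?S"
        unfolding borel_measurable_iff_greater
      proof
        fix a
        have "{\<mu> \<in> space ?S. a < (\<integral>z. bump C n z \<partial>\<mu>)} = {\<mu>. permuton \<mu> \<and> a < (\<integral>z. bump C n z \<partial>\<mu>)}"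
          by (simp add: S)
        also have "\<dots> \<in> test_sets" by (rule superlevel_test_sets[OF bump_lipschitz]) (simp add: bump_def)
        finally show "{\<mu> \<in> space ?S. a < (\<integral>z. bump C n z \<partial>\<mu>)} \<in> sets ?S" by (simp add: S)
      qed
    qed (simp add: S)
  qed (simp add: S)
  then have "A \<in> sets ?S" if "A \<in> sets permuton_space" for A
  proof -
    have "A \<subseteq> {\<mu>. permuton \<mu>}" using sets.sets_into_space[OF that] by simp
    then have "(\<lambda>\<mu>. \<mu>) -` A \<inter> space ?S = A" by (auto simp: S)
    then show ?thesis using measurable_sets[OF \<open>(\<lambda>\<mu>. \<mu>) \<in> measurable ?S permuton_space\<close> that] by simp
  qed
  then show "sets permuton_space \<subseteq> sigma_sets {\<mu>. permuton \<mu>} test_sets" using S by auto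
qed

context
  fixes p :: real and m m' :: "(real \<times> real) measure measure"
  assumes m: "prob_space m" "sets m = sets permuton_space"
      "distr (Phi_space p m) permuton_space (Phi (\<lambda>\<mu>. \<mu>)) = m"
    and m': "prob_space m'" "sets m' = sets permuton_space"
      "distr (Phi_space p m') permuton_space (Phi (\<lambda>\<mu>. \<mu>)) = m'"
begin

lemma sets_coupling [measurable_cong]: "sets (coupling p m m' n) = sets triple_space"
  by (cases n) simp_all

lemma initial_coupling_measurable:
  "(\<lambda>(\<mu>, \<nu>). (\<mu>, \<nu>, 2)) \<in> measurable (m \<Otimes>\<^sub>M m') triple_space"
  unfolding measurable_triple_space
proof
  have [measurable_cong]: "sets m = sets permuton_space" "sets m' = sets permuton_space" by (rule m m')+
  show "(\<lambda>(\<mu>, \<nu>). (\<mu>, \<nu>, 2)) \<in> measurable (m \<Otimes>\<^sub>M m') (permuton_space \<Otimes>\<^sub>M permuton_space \<Otimes>\<^sub>M borel)"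
    by measurable
  have "space m = {\<mu>. permuton \<mu>}" "space m' = {\<mu>. permuton \<mu>}"
    using m m' by (auto dest!: sets_eq_imp_space_eq)
  then show "\<forall>x\<in>space (m \<Otimes>\<^sub>M m'). (case x of (\<mu>, \<nu>) \<Rightarrow> (\<mu>, \<nu>, 2)) \<in> close_triples"
    by (auto simp: space_pair_measure close_triples_def close_below_2)
qed

lemma prob_space_coupling: "prob_space (coupling p m m' n)"
proof (induction n)
  case 0
  show ?case
    using initial_coupling_measurable m m'
    by (auto intro!: prob_space.prob_space_distr prob_space_pair)
next
  case (Suc n)
  then show ?case
    by (auto intro!: prob_space.prob_space_distr prob_space_Phi_space coupled_tensor_measurable sets_coupling)
qed

text \<open>Projecting the coupled step to one coordinate gives an ordinary step applied to that coordinate, and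
the law of that coordinate is invariant by assumption.\<close>

lemma coupling_marginals:
  "distr (coupling p m m' n) permuton_space fst = m"
  "distr (coupling p m m' n) permuton_space (\<lambda>t. fst (snd t)) = m'"
proof (induction n)
  case 0
  note im = initial_coupling_measurable
  case 1
  have "distr (coupling p m m' 0) permuton_space fst = distr (m \<Otimes>\<^sub>M m') m fst"
    unfolding coupling.simps distr_distr[OF triple_space_projections(1) im] by (rule distr_cong) (auto simp: m)
  then show ?case using prob_space.distr_pair_fst[OF m'(1)] by simp
  case 2
  have "distr (coupling p m m' 0) permuton_space (\<lambda>t. fst (snd t)) = distr (m \<Otimes>\<^sub>M m') m' snd"
    unfolding coupling.simps distr_distr[OF triple_space_projections(2) im] by (rule distr_cong) (auto simp: m')
  then show ?case using distr_pair_snd[OF m(1) m'(1)] by simp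
next
  case (Suc n)
  have ms: "coupled_tensor \<in> measurable (Phi_space p (coupling p m m' n)) triple_space"
    by (rule coupled_tensor_measurable[OF sets_coupling])
  have fst: "fst \<in> measurable (coupling p m m' n) permuton_space"
    and snd: "(\<lambda>t. fst (snd t)) \<in> measurable (coupling p m m' n) permuton_space"
    by measurable
  case 1
  have "distr (coupling p m m' (Suc n)) permuton_space fst =
      distr (Phi_space p (coupling p m m' n)) permuton_space (Phi fst)"
    using ms by (simp add: distr_distr triple_space_projections)
      (auto simp: coupled_tensor_def Phi_def intro!: distr_cong)
  also have "\<dots> = m"
    unfolding distr_Phi[OF prob_space_coupling fst] Suc.IH m ..
  finally show ?case .
  case 2
  have "distr (coupling p m m' (Suc n)) permuton_space (\<lambda>t. fst (snd t)) =
      distr (Phi_space p (coupling p m m' n)) permuton_space (Phi (\<lambda>t. fst (snd t)))"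
    using ms by (simp add: distr_distr triple_space_projections)
      (auto simp: coupled_tensor_def Phi_def intro!: distr_cong)
  also have "\<dots> = m'"
    unfolding distr_Phi[OF prob_space_coupling snd] Suc.IH m' ..
  finally show ?case .
qed

lemma coupling_radius:
  "(\<integral>\<^sup>+t. ennreal (snd (snd t)) \<partial>coupling p m m' n) = ennreal (2 * (2 / 3) ^ n)"
proof (induction n)
  case 0
  interpret prob_space "m \<Otimes>\<^sub>M m'" by (intro prob_space_pair m m')
  show ?case
    using initial_coupling_measurable
    by (simp add: nn_integral_distr split_beta emeasure_space_1)
next
  case (Suc n)
  have ms: "coupled_tensor \<in> measurable (Phi_space p (coupling p m m' n)) triple_space"
    by (rule coupled_tensor_measurable[OF sets_coupling])
  have "(\<integral>\<^sup>+t. ennreal (snd (snd t)) \<partial>coupling p m m' (Suc n)) =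
     (\<integral>\<^sup>+\<omega>. ennreal (snd (snd (coupled_tensor \<omega>))) \<partial>Phi_space p (coupling p m m' n))"
    using ms by (simp add: nn_integral_distr)
  also have "\<dots> = (\<integral>\<^sup>+(x, y, u, s). ennreal (u\<^sup>2) * ennreal (snd (snd x)) + ennreal ((1 - u)\<^sup>2) * ennreal (snd (snd y))
      \<partial>Phi_space p (coupling p m m' n))"
  proof (rule nn_integral_cong)
    fix \<omega> assume "\<omega> \<in> space (Phi_space p (coupling p m m' n))"
    then obtain \<mu> \<mu>' r \<nu> \<nu>' q u s where \<omega>: "\<omega> = ((\<mu>, \<mu>', r), (\<nu>, \<nu>', q), u, s)" and "0 \<le> r" "0 \<le> q"
      using sets_eq_imp_space_eq[OF sets_coupling[of n]]
      by (auto simp: space_Phi_space space_triple_space close_triples_def)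
    then show "ennreal (snd (snd (coupled_tensor \<omega>))) = (case \<omega> of (x, y, u, s) \<Rightarrow>
        ennreal (u\<^sup>2) * ennreal (snd (snd x)) + ennreal ((1 - u)\<^sup>2) * ennreal (snd (snd y)))"
      by (simp add: coupled_tensor_def ennreal_plus ennreal_mult)
  qed
  also have "\<dots> = ennreal (2 / 3) * (\<integral>\<^sup>+x. ennreal (snd (snd x)) \<partial>coupling p m m' n)"
    by (rule nn_integral_Phi_space_squares[OF prob_space_coupling]) measurable
  also have "\<dots> = ennreal (2 * (2 / 3) ^ Suc n)"
    by (simp add: Suc.IH ennreal_mult[symmetric])
  finally show ?case .
qed

text \<open>The difference of the two means is the mean of a difference under each coupling, hence at most a
constant times the expected radius, which tends to 0.\<close>

lemma coupled_integral_eq: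
  assumes G [measurable]: "G \<in> borel_measurable permuton_space"
    and bd: "\<And>\<mu>. permuton \<mu> \<Longrightarrow> \<bar>G \<mu>\<bar> \<le> (1 :: real)"
    and C: "\<And>\<mu> \<nu> r. (\<mu>, \<nu>, r) \<in> close_triples \<Longrightarrow> \<bar>G \<mu> - G \<nu>\<bar> \<le> C * r"
  shows "(\<integral>\<mu>. G \<mu> \<partial>m) = (\<integral>\<mu>. G \<mu> \<partial>m')"
proof -
  have "\<bar>(\<integral>\<mu>. G \<mu> \<partial>m) - (\<integral>\<mu>. G \<mu> \<partial>m')\<bar> \<le> \<bar>C\<bar> * (2 * (2 / 3) ^ n)" for n
  proof -
    let ?K = "coupling p m m' n"
    interpret K: prob_space ?K by (rule prob_space_coupling)
    have sK: "space ?K = close_triples"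
      using sets_eq_imp_space_eq[OF sets_coupling[of n]] by (simp add: space_triple_space)
    have fst [measurable]: "fst \<in> measurable ?K permuton_space"
      and snd [measurable]: "(\<lambda>t. fst (snd t)) \<in> measurable ?K permuton_space"
      and rad [measurable]: "(\<lambda>t. snd (snd t)) \<in> borel_measurable ?K"
      by measurable
    have i1: "integrable ?K (\<lambda>t. G (fst t))" and i2: "integrable ?K (\<lambda>t. G (fst (snd t)))"
      by (rule K.integrable_const_bound[of _ 1], use bd in \<open>auto simp: sK close_triples_def\<close>)+
    have r: "integrable ?K (\<lambda>t. snd (snd t))"
      using coupling_radius[of n] by (intro integrableI_nonneg) (auto simp: sK close_triples_def)
    have Er: "(\<integral>t. snd (snd t) \<partial>?K) = 2 * (2 / 3) ^ n"
      using coupling_radius[of n]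
      by (subst integral_eq_nn_integral) (auto simp: sK close_triples_def)
    have "(\<integral>\<mu>. G \<mu> \<partial>m) = (\<integral>t. G (fst t) \<partial>?K)"
      by (subst coupling_marginals(1)[of n, symmetric]) (simp add: integral_distr)
    moreover have "(\<integral>\<mu>. G \<mu> \<partial>m') = (\<integral>t. G (fst (snd t)) \<partial>?K)"
      by (subst coupling_marginals(2)[of n, symmetric]) (simp add: integral_distr)
    ultimately have "(\<integral>\<mu>. G \<mu> \<partial>m) - (\<integral>\<mu>. G \<mu> \<partial>m') = (\<integral>t. G (fst t) - G (fst (snd t)) \<partial>?K)"
      using i1 i2 by simp
    also have "\<bar>\<dots>\<bar> \<le> (\<integral>t. \<bar>G (fst t) - G (fst (snd t))\<bar> \<partial>?K)" by (rule integral_abs_bound)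
    also have "\<dots> \<le> (\<integral>t. \<bar>C\<bar> * snd (snd t) \<partial>?K)"
    proof (rule integral_mono)
      fix t assume "t \<in> space ?K"
      then obtain \<mu> \<nu> r where t: "t = (\<mu>, \<nu>, r)" "(\<mu>, \<nu>, r) \<in> close_triples" "0 \<le> r"
        unfolding sK by (auto simp: close_triples_def)
      have "\<bar>G \<mu> - G \<nu>\<bar> \<le> C * r" by (rule C[OF t(2)])
      also have "\<dots> \<le> \<bar>C\<bar> * r" using t(3) by (intro mult_right_mono) auto
      finally show "\<bar>G (fst t) - G (fst (snd t))\<bar> \<le> \<bar>C\<bar> * snd (snd t)" by (simp add: t(1))
    qed (use i1 i2 r in auto)
    also have "\<dots> = \<bar>C\<bar> * (2 * (2 / 3) ^ n)" using r by (simp add: Er)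
    finally show ?thesis .
  qed
  moreover have "(\<lambda>n. \<bar>C\<bar> * (2 * (2 / 3) ^ n)) \<longlonglongrightarrow> \<bar>C\<bar> * (2 * 0)"
    by (intro tendsto_intros LIMSEQ_realpow_zero) auto
  ultimately have "\<bar>(\<integral>\<mu>. G \<mu> \<partial>m) - (\<integral>\<mu>. G \<mu> \<partial>m')\<bar> \<le> \<bar>C\<bar> * (2 * 0)"
    by (intro LIMSEQ_le_const) auto
  then show ?thesis by simp
qed

lemma fixed_law_unique: "m = m'"
proof (rule measure_eqI_generator_eq[OF Int_stable_test_sets])
  interpret m: prob_space m by (rule m)
  interpret m': prob_space m' by (rule m')
  show "test_sets \<subseteq> Pow {\<mu>. permuton \<mu>}" by (auto simp: test_sets_def)
  show "sets m = sigma_sets {\<mu>. permuton \<mu>} test_sets" "sets m' = sigma_sets {\<mu>. permuton \<mu>} test_sets"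
    by (simp_all add: m m' sets_permuton_space_test_sets)
  have "(\<lambda>_. 1) \<in> lipschitz_tests" by (auto simp: lipschitz_tests_def close_triples_def intro!: exI[of _ 0])
  then have "{\<mu>. permuton \<mu>} \<in> test_sets"
    by (auto simp: test_sets_def intro!: exI[of _ "\<lambda>_ _. 1"])
  then show "range (\<lambda>_ :: nat. {\<mu>. permuton \<mu>}) \<subseteq> test_sets" by auto
  show "(\<Union>i :: nat. {\<mu>. permuton \<mu>}) = {\<mu>. permuton \<mu>}" by simp
  show "emeasure m {\<mu>. permuton \<mu>} \<noteq> \<infinity>" by simp
  fix A assume A: "A \<in> test_sets"
  then obtain G where G: "\<And>n. G n \<in> lipschitz_tests"
    "\<And>\<mu>. permuton \<mu> \<Longrightarrow> (\<lambda>n :: nat. G n \<mu>) \<longlonglongrightarrow> indicator A \<mu>"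
    unfolding test_sets_def by auto
  have lim: "(\<lambda>n. \<integral>\<mu>. G n \<mu> \<partial>k) \<longlonglongrightarrow> measure k A" if k: "prob_space k" "sets k = sets permuton_space" for k
  proof -
    interpret k: prob_space k by (rule k)
    have sk: "space k = {\<mu>. permuton \<mu>}" using sets_eq_imp_space_eq[OF k(2)] by simp
    have Ak: "A \<in> sets k" using test_sets_measurable[OF A] by (simp add: k)
    have "G n \<in> borel_measurable k" for n
      using G(1)[of n] by (simp add: lipschitz_tests_def measurable_cong_sets[OF k(2) refl])
    moreover have "norm (G n \<mu>) \<le> 1" if "permuton \<mu>" for n \<mu>
      using G(1)[of n] that by (auto simp: lipschitz_tests_def)
    ultimately have "(\<lambda>n. \<integral>\<mu>. G n \<mu> \<partial>k) \<longlonglongrightarrow> (\<integral>\<mu>. indicator A \<mu> \<partial>k)"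
      by (intro integral_dominated_convergence[where w = "\<lambda>_. 1"]) (use Ak G(2) in \<open>auto simp: sk\<close>)
    then show ?thesis using Ak by simp
  qed
  have "(\<integral>\<mu>. G n \<mu> \<partial>m) = (\<integral>\<mu>. G n \<mu> \<partial>m')" for n
  proof -
    obtain C where C: "\<And>\<mu> \<nu> r. (\<mu>, \<nu>, r) \<in> close_triples \<Longrightarrow> \<bar>G n \<mu> - G n \<nu>\<bar> \<le> C * r"
      using G(1)[of n] by (auto simp: lipschitz_tests_def)
    show ?thesis
      by (rule coupled_integral_eq[OF _ _ C]) (use G(1)[of n] in \<open>auto simp: lipschitz_tests_def\<close>)
  qed
  then have "measure m A = measure m' A"
    using lim[OF m(1,2)] lim[OF m'(1,2)] by (simp add: LIMSEQ_unique)
  then show "emeasure m A = emeasure m' A" by (simp add: m.emeasure_eq_measure m'.emeasure_eq_measure)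
qed

end

section \<open>Interleaving two sequences\<close>

text \<open>The recursion consumes one coin per step and one term of the sequence that the coin selects. This form
makes the law of the result computable by conditioning on the first coin.\<close>

fun interleave :: "(nat \<Rightarrow> 'c) \<Rightarrow> (nat \<Rightarrow> 'c) \<Rightarrow> (nat \<Rightarrow> bool) \<Rightarrow> nat \<Rightarrow> 'c" where
  "interleave A B c 0 = (if c 0 then A 0 else B 0)"
| "interleave A B c (Suc n) =
     (if c 0 then interleave (\<lambda>i. A (Suc i)) B (\<lambda>i. c (Suc i)) n
      else interleave A (\<lambda>i. B (Suc i)) (\<lambda>i. c (Suc i)) n)"

lemma interleave_swap: "interleave A B c n = interleave B A (\<lambda>i. \<not> c i) n"
  by (induction A B c n rule: interleave.induct) auto

text \<open>The first term that satisfies \<open>P\<close> exists and satisfies \<open>R\<close>. With \<open>P\<close> saying that a mark lies in an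
interval and \<open>R\<close> reading its sign, this is a comparison of the two endpoints of the interval.\<close>

definition first_hit :: "('c \<Rightarrow> bool) \<Rightarrow> ('c \<Rightarrow> bool) \<Rightarrow> (nat \<Rightarrow> 'c) \<Rightarrow> bool" where
  "first_hit P R z \<longleftrightarrow> (\<exists>j. P (z j) \<and> R (z j) \<and> (\<forall>i<j. \<not> P (z i)))"

lemma first_hit_Suc:
  "first_hit P R z \<longleftrightarrow> (if P (z 0) then R (z 0) else first_hit P R (\<lambda>i. z (Suc i)))"
proof (cases "P (z 0)")
  case True
  then show ?thesis unfolding first_hit_def by (metis gr0I not_less0)
next
  case False
  show ?thesis
  proof
    assume "first_hit P R z"
    then obtain j where j: "P (z j)" "R (z j)" "\<And>i. i < j \<Longrightarrow> \<not> P (z i)"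
      by (auto simp: first_hit_def)
    with False obtain k where "j = Suc k" by (cases j) auto
    with j False show "if P (z 0) then R (z 0) else first_hit P R (\<lambda>i. z (Suc i))"
      by (auto simp: first_hit_def)
  next
    assume "if P (z 0) then R (z 0) else first_hit P R (\<lambda>i. z (Suc i))"
    with False obtain j where j: "P (z (Suc j))" "R (z (Suc j))" "\<And>i. i < j \<Longrightarrow> \<not> P (z (Suc i))"
      by (auto simp: first_hit_def)
    have "\<not> P (z i)" if "i < Suc j" for i using that j(3) False by (cases i) auto
    with j show "first_hit P R z" by (auto simp: first_hit_def)
  qed
qed

text \<open>If a sequence is selected infinitely often, none of its terms is lost.\<close>

lemma hit_interleave:
  assumes "\<And>n. \<exists>i\<ge>n. c i"
  shows "\<exists>i. interleave A B c i = A j"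
  using assms
proof (induction j arbitrary: A B c)
  case 0
  define k where "k = (LEAST i. c i)"
  have "c k" using 0[of 0] LeastI_ex[of c] by (auto simp: k_def)
  moreover have "\<not> c i" if "i < k" for i using that not_less_Least by (auto simp: k_def)
  ultimately have "interleave A B c k = A 0"
  proof (induction k arbitrary: B c)
    case (Suc k)
    then show ?case using Suc.prems(2)[of 0] Suc.IH[of "\<lambda>i. c (Suc i)" "\<lambda>i. B (Suc i)"] by auto
  qed simp
  then show ?case ..
next
  case (Suc j)
  define k where "k = (LEAST i. c i)"
  have "c k" using Suc.prems[of 0] LeastI_ex[of c] by (auto simp: k_def)
  moreover have "\<not> c i" if "i < k" for i using that not_less_Least by (auto simp: k_def)
  ultimately show ?case using Suc.prems
  proof (induction k arbitrary: B c)
    case 0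
    have "\<exists>i\<ge>n. c (Suc i)" for n using 0(3)[of "Suc n"] by (metis Suc_le_D Suc_le_mono)
    from Suc.IH[of "\<lambda>i. c (Suc i)" "\<lambda>i. A (Suc i)" B, OF this]
    obtain i where "interleave (\<lambda>i. A (Suc i)) B (\<lambda>i. c (Suc i)) i = A (Suc j)" by auto
    then show ?case using 0 by (intro exI[of _ "Suc i"]) simp
  next
    case (Suc k)
    have "\<exists>i\<ge>n. c (Suc i)" for n using Suc.prems(3)[of "Suc n"] by (metis Suc_le_D Suc_le_mono)
    then obtain i where "interleave A (\<lambda>i. B (Suc i)) (\<lambda>i. c (Suc i)) i = A (Suc j)"
      using Suc.IH[of "\<lambda>i. c (Suc i)" "\<lambda>i. B (Suc i)"] Suc.prems by auto
    then show ?case using Suc.prems(2)[of 0] by (intro exI[of _ "Suc i"]) simp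
  qed
qed

lemma first_hit_interleaveD:
  assumes "P (interleave A B c n)" "R (interleave A B c n)" "\<And>i. i < n \<Longrightarrow> \<not> P (interleave A B c i)"
    and "\<And>j. \<not> P (B j)"
  shows "first_hit P R A"
  using assms
proof (induction n arbitrary: A B c)
  case 0
  then show ?case by (cases "c 0") (auto simp: first_hit_Suc[of P R A])
next
  case (Suc n)
  have no: "\<not> P (interleave A B c (Suc i))" if "i < n" for i using Suc.prems(3)[of "Suc i"] that by simp
  show ?case
  proof (cases "c 0")
    case True
    have "first_hit P R (\<lambda>i. A (Suc i))"
      by (rule Suc.IH[of "\<lambda>i. A (Suc i)" B "\<lambda>i. c (Suc i)"]) (use Suc.prems True no in auto)
    moreover have "\<not> P (A 0)" using Suc.prems(3)[of 0] True by simp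
    ultimately show ?thesis by (simp add: first_hit_Suc[of P R A])
  next
    case False
    then show ?thesis
      by (intro Suc.IH[of A "\<lambda>i. B (Suc i)" "\<lambda>i. c (Suc i)"]) (use Suc.prems no in auto)
  qed
qed

text \<open>Interleaving preserves the order of the terms of \<open>A\<close>, so inserted terms that do not satisfy \<open>P\<close> cannot
change which hit comes first.\<close>

lemma first_hit_interleave:
  assumes c: "\<And>n. \<exists>i\<ge>n. c i" and B: "\<And>j. \<not> P (B j)"
  shows "first_hit P R (interleave A B c) \<longleftrightarrow> first_hit P R A"
proof
  assume "first_hit P R (interleave A B c)"
  then show "first_hit P R A"
    unfolding first_hit_def[of P R "interleave A B c"] using first_hit_interleaveD[of P A B c _ R] B by blast
next
  assume hit: "first_hit P R A"
  then obtain j where j: "P (A j)" "R (A j)" "\<And>i. i < j \<Longrightarrow> \<not> P (A i)" by (auto simp: first_hit_def)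
  obtain k where "interleave A B c k = A j" using hit_interleave[OF c] by blast
  then have ex: "\<exists>n. P (interleave A B c n)" using j by metis
  define n where "n = (LEAST n. P (interleave A B c n))"
  have n: "P (interleave A B c n)" using LeastI_ex[OF ex] by (simp add: n_def)
  have n': "\<And>i. i < n \<Longrightarrow> \<not> P (interleave A B c i)" using not_less_Least by (auto simp: n_def)
  show "first_hit P R (interleave A B c)"
  proof (rule ccontr)
    assume "\<not> ?thesis"
    then have "\<not> R (interleave A B c n)" using n n' by (auto simp: first_hit_def)
    then have "first_hit P (\<lambda>x. \<not> R x) A"
      using first_hit_interleaveD[of P A B c n "\<lambda>x. \<not> R x"] n n' B by blast
    then obtain i where i: "P (A i)" "\<not> R (A i)" "\<And>k. k < i \<Longrightarrow> \<not> P (A k)" by (auto simp: first_hit_def)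
    then have "i = j" using j by (metis linorder_neqE_nat)
    with i j show False by simp
  qed
qed

section \<open>The law of an interleaving\<close>

abbreviation "mark_space \<equiv> Leb \<Otimes>\<^sub>M count_space (UNIV :: bool set)"
abbreviation "seq_space \<equiv> PiM (UNIV :: nat set) (\<lambda>_. mark_space)"

definition marks :: "real \<Rightarrow> (real \<times> bool) measure" where
  "marks p = Leb \<Otimes>\<^sub>M measure_pmf (bernoulli_pmf p)"

definition mark_sequences :: "real \<Rightarrow> (nat \<Rightarrow> real \<times> bool) measure" where
  "mark_sequences p = PiM UNIV (\<lambda>_. marks p)"

text \<open>Coins are represented by independent uniform variables that are compared with the cut \<open>u\<close>. The
randomness then does not depend on \<open>u\<close>, so a random cut can be treated by a product measure.\<close>

definition coin_sequences :: "(nat \<Rightarrow> real) measure" where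
  "coin_sequences = PiM UNIV (\<lambda>_. Leb)"

lemma sets_marks [measurable_cong]: "sets (marks p) = sets mark_space"
  unfolding marks_def by (intro sets_pair_measure_cong) simp_all

lemma sets_mark_sequences [measurable_cong]: "sets (mark_sequences p) = sets seq_space"
  unfolding mark_sequences_def by (intro sets_PiM_cong sets_marks refl)

lemma sets_coin_sequences [measurable_cong]: "sets coin_sequences = sets (PiM UNIV (\<lambda>_. Leb))"
  unfolding coin_sequences_def ..

lemma prob_space_marks: "prob_space (marks p)"
  unfolding marks_def by (intro prob_space_pair prob_space_Leb prob_space_measure_pmf)

lemma prob_space_mark_sequences: "prob_space (mark_sequences p)"
  unfolding mark_sequences_def by (intro prob_space_PiM prob_space_marks)

lemma prob_space_coin_sequences: "prob_space coin_sequences"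
  unfolding coin_sequences_def by (intro prob_space_PiM prob_space_Leb)

lemma nn_integral_PiM_case_nat:
  assumes M: "prob_space M" and f [measurable]: "f \<in> borel_measurable (PiM UNIV (\<lambda>_ :: nat. M))"
  shows "(\<integral>\<^sup>+z. f z \<partial>PiM UNIV (\<lambda>_. M)) = (\<integral>\<^sup>+x. \<integral>\<^sup>+z. f (case_nat x z) \<partial>PiM UNIV (\<lambda>_. M) \<partial>M)"
proof -
  interpret sequence_space M
    using M by (simp add: sequence_space_def product_prob_space_def product_sigma_finite_def
        product_prob_space_axioms_def prob_space_imp_sigma_finite)
  have "(\<integral>\<^sup>+z. f z \<partial>PiM UNIV (\<lambda>_. M)) =
     (\<integral>\<^sup>+z. f z \<partial>distr (M \<Otimes>\<^sub>M PiM UNIV (\<lambda>_. M)) (PiM UNIV (\<lambda>_. M)) (\<lambda>(s, \<omega>). case_nat s \<omega>))"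
    by (subst PiM_iter) simp
  also have "\<dots> = (\<integral>\<^sup>+x. \<integral>\<^sup>+z. f (case_nat x z) \<partial>PiM UNIV (\<lambda>_. M) \<partial>M)"
    by (simp add: nn_integral_distr P.nn_integral_fst[symmetric] split_beta')
  finally show ?thesis .
qed

text \<open>Cylinders over initial segments suffice, since a cylinder over a finite set of indices is one over any
longer initial segment with trivial constraints added.\<close>

lemma prob_measure_PiM_eqI:
  fixes M :: "'c measure"
  assumes M: "prob_space M" and Q: "prob_space Q" "sets Q = sets (PiM (UNIV :: nat set) (\<lambda>_. M))"
    and cyl: "\<And>n E. (\<And>i. E i \<in> sets M) \<Longrightarrow>
      emeasure Q {z \<in> space (PiM UNIV (\<lambda>_. M)). \<forall>i<n. z i \<in> E i} = (\<Prod>i<n. emeasure M (E i))"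
  shows "Q = PiM UNIV (\<lambda>_. M)"
proof -
  interpret product_prob_space "\<lambda>_ :: nat. M" UNIV
    using M by (simp add: product_prob_space_def product_sigma_finite_def
        product_prob_space_axioms_def prob_space_imp_sigma_finite)
  interpret M: prob_space M by (rule M)
  show ?thesis
  proof (rule PiM_eq[OF Q(2)])
    fix J :: "nat set" and F assume J: "finite J" and F: "\<And>j. j \<in> J \<Longrightarrow> F j \<in> sets M"
    obtain n where n: "J \<subseteq> {..<n}" using finite_nat_bounded[OF J] by auto
    then have nJ: "i < n" if "i \<in> J" for i using that by auto
    \<comment> \<open>Positions outside \<open>J\<close> are left unconstrained.\<close>
    define E where "E i = (if i \<in> J then F i else space M)" for i
    have "prod_emb UNIV (\<lambda>_. M) J (\<Pi>\<^sub>E j\<in>J. F j) = {z \<in> space (PiM UNIV (\<lambda>_. M)). \<forall>i<n. z i \<in> E i}"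
      using nJ F[THEN sets.sets_into_space] by (auto simp: prod_emb_def E_def space_PiM PiE_iff split: if_splits)
    then have "emeasure Q (prod_emb UNIV (\<lambda>_. M) J (\<Pi>\<^sub>E j\<in>J. F j)) = (\<Prod>i<n. emeasure M (E i))"
      using F by (simp add: cyl E_def)
    also have "\<dots> = (\<Prod>j\<in>J. emeasure M (F j))"
      using n by (intro prod.mono_neutral_cong_right) (auto simp: E_def M.emeasure_space_1)
    finally show "emeasure Q (prod_emb UNIV (\<lambda>_. M) J (\<Pi>\<^sub>E j\<in>J. F j)) = (\<Prod>j\<in>J. emeasure M (F j))" .
  qed
qed

lemma measurable_interleave:
  assumes "\<And>i. (\<lambda>\<omega>. A \<omega> i) \<in> measurable M N" "\<And>i. (\<lambda>\<omega>. B \<omega> i) \<in> measurable M N"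
    "\<And>i. Measurable.pred M (\<lambda>\<omega>. c \<omega> i)"
  shows "(\<lambda>\<omega>. interleave (A \<omega>) (B \<omega>) (c \<omega>) n) \<in> measurable M N"
  using assms
proof (induction n arbitrary: A B c)
  case 0
  note [measurable] = 0
  show ?case by simp
next
  case (Suc n)
  note [measurable] = Suc.prems
  have [measurable]: "(\<lambda>\<omega>. interleave (\<lambda>i. A \<omega> (Suc i)) (B \<omega>) (\<lambda>i. c \<omega> (Suc i)) n) \<in> measurable M N"
    "(\<lambda>\<omega>. interleave (A \<omega>) (\<lambda>i. B \<omega> (Suc i)) (\<lambda>i. c \<omega> (Suc i)) n) \<in> measurable M N"
    by (rule Suc.IH; measurable)+
  show ?case by simp
qed

definition left_mark :: "real \<Rightarrow> real \<times> bool \<Rightarrow> real \<times> bool" where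
  "left_mark u x = (u * fst x, snd x)"

definition right_mark :: "real \<Rightarrow> real \<times> bool \<Rightarrow> real \<times> bool" where
  "right_mark u x = (u + (1 - u) * fst x, snd x)"

text \<open>The inverse of splitting a sequence of marks at the cut \<open>u\<close>: the marks of \<open>A\<close> are placed to the left and
those of \<open>B\<close> to the right, in the order dictated by the coins.\<close>

definition merge_marks :: "real \<Rightarrow> (nat \<Rightarrow> real \<times> bool) \<Rightarrow> (nat \<Rightarrow> real \<times> bool) \<Rightarrow> (nat \<Rightarrow> real) \<Rightarrow> nat \<Rightarrow> real \<times> bool" where
  "merge_marks u A B V = interleave (\<lambda>i. left_mark u (A i)) (\<lambda>i. right_mark u (B i)) (\<lambda>i. V i \<le> u)"

lemma merge_marks_case_nat:
  "merge_marks u A B (case_nat v V) 0 = (if v \<le> u then left_mark u (A 0) else right_mark u (B 0))"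
  "merge_marks u A B (case_nat v V) (Suc n) =
    (if v \<le> u then merge_marks u (\<lambda>i. A (Suc i)) B V n else merge_marks u A (\<lambda>i. B (Suc i)) V n)"
  by (simp_all add: merge_marks_def)

lemma measurable_mark:
  assumes "u \<in> measurable M Leb" "x \<in> measurable M mark_space"
  shows "(\<lambda>\<omega>. left_mark (u \<omega>) (x \<omega>)) \<in> measurable M mark_space"
    "(\<lambda>\<omega>. right_mark (u \<omega>) (x \<omega>)) \<in> measurable M mark_space"
proof -
  note [measurable] = assms
  have [measurable]: "(\<lambda>\<omega>. fst (x \<omega>)) \<in> measurable M Leb" by measurable
  have 1: "u \<omega> \<in> {0..1}" "fst (x \<omega>) \<in> {0..1}" if "\<omega> \<in> space M" for \<omega>
    using measurable_space[OF assms(1) that] measurable_space[of "\<lambda>\<omega>. fst (x \<omega>)" M Leb \<omega>] that by simp_all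
  have [measurable]: "u \<in> borel_measurable M" "(\<lambda>\<omega>. fst (x \<omega>)) \<in> borel_measurable M"
    by (rule Leb_borel, measurable)+
  have [measurable]: "(\<lambda>\<omega>. u \<omega> * fst (x \<omega>)) \<in> measurable M Leb"
    "(\<lambda>\<omega>. u \<omega> + (1 - u \<omega>) * fst (x \<omega>)) \<in> measurable M Leb"
    using 1 by (auto simp: measurable_Leb_iff affine_in_unit)
  show "(\<lambda>\<omega>. left_mark (u \<omega>) (x \<omega>)) \<in> measurable M mark_space"
    "(\<lambda>\<omega>. right_mark (u \<omega>) (x \<omega>)) \<in> measurable M mark_space"
    unfolding left_mark_def right_mark_def by measurable
qed

lemma measurable_mark_const:
  assumes "0 \<le> u" "u \<le> 1"
  shows "left_mark u \<in> measurable mark_space mark_space" "right_mark u \<in> measurable mark_space mark_space"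
proof -
  have c: "(\<lambda>x. u) \<in> measurable mark_space Leb" using assms by (intro measurable_const) simp
  have i: "(\<lambda>x. x) \<in> measurable mark_space mark_space" by (rule measurable_ident_sets) (rule refl)
  show "left_mark u \<in> measurable mark_space mark_space" "right_mark u \<in> measurable mark_space mark_space"
    using measurable_mark[OF c i] .
qed

lemma measurable_merge_marks:
  assumes u: "u \<in> measurable M Leb" and A: "\<And>i. (\<lambda>\<omega>. A \<omega> i) \<in> measurable M mark_space"
    and B: "\<And>i. (\<lambda>\<omega>. B \<omega> i) \<in> measurable M mark_space" and V: "\<And>i. (\<lambda>\<omega>. V \<omega> i) \<in> measurable M Leb"
  shows "(\<lambda>\<omega>. merge_marks (u \<omega>) (A \<omega>) (B \<omega>) (V \<omega>) n) \<in> measurable M mark_space"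
  unfolding merge_marks_def
proof (rule measurable_interleave)
  have [measurable]: "u \<in> borel_measurable M" "(\<lambda>\<omega>. V \<omega> i) \<in> borel_measurable M" for i
    by (rule Leb_borel, rule u V)+
  show "Measurable.pred M (\<lambda>\<omega>. V \<omega> i \<le> u \<omega>)" for i by measurable
qed (intro measurable_mark u A B)+

lemma measurable_merge_marks_seq:
  assumes "u \<in> measurable M Leb" "A \<in> measurable M seq_space" "B \<in> measurable M seq_space"
    "V \<in> measurable M (PiM UNIV (\<lambda>_. Leb))"
  shows "(\<lambda>\<omega>. merge_marks (u \<omega>) (A \<omega>) (B \<omega>) (V \<omega>)) \<in> measurable M seq_space"
proof (rule measurable_PiM_single')
  note comp = measurable_compose[OF _ measurable_component_singleton[OF UNIV_I]]
  show "(\<lambda>\<omega>. merge_marks (u \<omega>) (A \<omega>) (B \<omega>) (V \<omega>) i) \<in> measurable M mark_space" for i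
    by (rule measurable_merge_marks[OF assms(1) comp[OF assms(2)] comp[OF assms(3)] comp[OF assms(4)]])
  then show "(\<lambda>\<omega>. merge_marks (u \<omega>) (A \<omega>) (B \<omega>) (V \<omega>)) \<in> space M \<rightarrow> (\<Pi>\<^sub>E i\<in>UNIV. space mark_space)"
    by (auto simp: PiE_iff dest: measurable_space)
qed

lemma nn_integral_triple:
  assumes N: "prob_space N" and K: "prob_space K" and f: "f \<in> borel_measurable (M \<Otimes>\<^sub>M N \<Otimes>\<^sub>M K)"
  shows "(\<integral>\<^sup>+\<omega>. f \<omega> \<partial>(M \<Otimes>\<^sub>M N \<Otimes>\<^sub>M K)) = (\<integral>\<^sup>+x. \<integral>\<^sup>+y. \<integral>\<^sup>+z. f (x, y, z) \<partial>K \<partial>N \<partial>M)"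
proof -
  interpret NK: prob_space "N \<Otimes>\<^sub>M K" by (intro prob_space_pair N K)
  interpret K: prob_space K by (rule K)
  have "(\<integral>\<^sup>+y. f (x, y) \<partial>(N \<Otimes>\<^sub>M K)) = (\<integral>\<^sup>+y. \<integral>\<^sup>+z. f (x, y, z) \<partial>K \<partial>N)" if "x \<in> space M" for x
    using f that by (intro K.nn_integral_fst[symmetric]) simp
  then show ?thesis unfolding NK.nn_integral_fst[OF f, symmetric] by (rule nn_integral_cong)
qed

lemma nn_integral_marks_split:
  assumes u: "0 \<le> u" "u \<le> 1" and h [measurable]: "h \<in> borel_measurable mark_space"
  shows "(\<integral>\<^sup>+x. h x \<partial>marks p) =
    ennreal u * (\<integral>\<^sup>+x. h (left_mark u x) \<partial>marks p) + ennreal (1 - u) * (\<integral>\<^sup>+x. h (right_mark u x) \<partial>marks p)"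
proof -
  let ?B = "measure_pmf (bernoulli_pmf p)"
  have [measurable_cong]: "sets ?B = sets (count_space UNIV)" by simp
  note affine_measurable_Leb[OF u, measurable]
  have [measurable]: "(\<lambda>a. \<integral>\<^sup>+s. h (a, s) \<partial>?B) \<in> borel_measurable Leb" by measurable
  have *: "(\<integral>\<^sup>+x. g x \<partial>marks p) = (\<integral>\<^sup>+a. \<integral>\<^sup>+s. g (a, s) \<partial>?B \<partial>Leb)" if [measurable]: "g \<in> borel_measurable mark_space" for g
    unfolding marks_def by (rule measure_pmf.nn_integral_fst[symmetric]) measurable
  note measurable_mark_const[OF u, measurable]
  have "(\<integral>\<^sup>+x. h x \<partial>marks p) = (\<integral>\<^sup>+a. \<integral>\<^sup>+s. h (a, s) \<partial>?B \<partial>Leb)" by (rule *[OF h])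
  also have "\<dots> = ennreal u * (\<integral>\<^sup>+a. \<integral>\<^sup>+s. h (u * a, s) \<partial>?B \<partial>Leb)
      + ennreal (1 - u) * (\<integral>\<^sup>+a. \<integral>\<^sup>+s. h (u + (1 - u) * a, s) \<partial>?B \<partial>Leb)"
    by (rule nn_integral_Leb_split[OF u]) measurable
  also have "(\<integral>\<^sup>+a. \<integral>\<^sup>+s. h (u * a, s) \<partial>?B \<partial>Leb) = (\<integral>\<^sup>+x. h (left_mark u x) \<partial>marks p)"
    by (subst *) (simp_all add: left_mark_def[abs_def])
  also have "(\<integral>\<^sup>+a. \<integral>\<^sup>+s. h (u + (1 - u) * a, s) \<partial>?B \<partial>Leb) = (\<integral>\<^sup>+x. h (right_mark u x) \<partial>marks p)"
    by (subst *) (simp_all add: right_mark_def[abs_def])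
  finally show ?thesis .
qed

lemma nn_integral_Leb_if:
  assumes "0 \<le> u" "u \<le> 1"
  shows "(\<integral>\<^sup>+v. (if v \<le> u then a else b) \<partial>Leb) = ennreal u * a + ennreal (1 - u) * b"
proof -
  have "(\<integral>\<^sup>+v. (if v \<le> u then a else b) \<partial>Leb) =
      (\<integral>\<^sup>+v. a * indicator {0..u} v + b * indicator {u<..1} v \<partial>lborel)"
    unfolding nn_integral_Leb using assms by (intro nn_integral_cong) (auto simp: indicator_def)
  also have "\<dots> = a * ennreal u + b * ennreal (1 - u)"
    using assms by (subst nn_integral_add) (auto simp: nn_integral_cmult)
  finally show ?thesis by (simp add: mult.commute)
qed

text \<open>A uniform mark is to the left of \<open>u\<close> with probability \<open>u\<close>, and is then uniform there. So a fresh mark may be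
drawn by first tossing a coin for the side. Conditioning on the first coin and on the first term of the
selected sequence leaves the same situation with one constraint less, so the probability of a
cylinder is a product by induction on its length.\<close>

lemma merge_marks_law:
  assumes u: "0 \<le> u" "u \<le> 1"
  shows "distr (mark_sequences p \<Otimes>\<^sub>M mark_sequences p \<Otimes>\<^sub>M coin_sequences) seq_space
    (\<lambda>(A, B, V). merge_marks u A B V) = mark_sequences p"
proof -
  let ?S = "mark_sequences p" and ?C = "coin_sequences"
  interpret S: prob_space ?S by (rule prob_space_mark_sequences)
  interpret C: prob_space ?C by (rule prob_space_coin_sequences)
  interpret SC: prob_space "?S \<Otimes>\<^sub>M ?C" by (intro prob_space_pair S.prob_space_axioms C.prob_space_axioms)
  interpret SSC: prob_space "?S \<Otimes>\<^sub>M ?S \<Otimes>\<^sub>M ?C" by (intro prob_space_pair S.prob_space_axioms SC.prob_space_axioms)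
  define I :: "nat \<Rightarrow> (nat \<Rightarrow> (real \<times> bool) set) \<Rightarrow> _ \<Rightarrow> _ \<Rightarrow> _ \<Rightarrow> ennreal"
    where "I n E A B V = (\<Prod>i<n. indicator (E i) (merge_marks u A B V i))" for n E A B V
  have I_meas: "(\<lambda>\<omega>. I n E (A \<omega>) (B \<omega>) (V \<omega>)) \<in> borel_measurable M"
    if "\<And>i. E i \<in> sets mark_space" "A \<in> measurable M seq_space" "B \<in> measurable M seq_space"
      "V \<in> measurable M (PiM UNIV (\<lambda>_. Leb))" for E A B V n and M :: "'x measure"
  proof -
    have "(\<lambda>\<omega>. merge_marks u (A \<omega>) (B \<omega>) (V \<omega>)) \<in> measurable M seq_space"
      by (rule measurable_merge_marks_seq[OF measurable_const that(2-4)]) (use u in simp)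
    then have [measurable]: "(\<lambda>\<omega>. merge_marks u (A \<omega>) (B \<omega>) (V \<omega>) i) \<in> measurable M mark_space" for i
      by (rule measurable_compose[OF _ measurable_component_singleton[OF UNIV_I]])
    note that(1) [measurable]
    show ?thesis unfolding I_def by measurable
  qed
  have tail: "(\<lambda>A i. A (Suc i)) \<in> measurable seq_space seq_space"
    by (rule measurable_PiM_single') (auto simp: space_PiM PiE_iff)
  have SI: "(\<integral>\<^sup>+A. h A \<partial>?S) = (\<integral>\<^sup>+a. \<integral>\<^sup>+A. h (case_nat a A) \<partial>?S \<partial>marks p)"
    if "h \<in> borel_measurable seq_space" for h
    unfolding mark_sequences_def
    by (rule nn_integral_PiM_case_nat[OF prob_space_marks])
      (use that in \<open>simp add: measurable_cong_sets[OF sets_mark_sequences[unfolded mark_sequences_def] refl]\<close>)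
  have main: "(\<integral>\<^sup>+A. \<integral>\<^sup>+B. \<integral>\<^sup>+V. I n E A B V \<partial>?C \<partial>?S \<partial>?S) = (\<Prod>i<n. emeasure (marks p) (E i))"
    if "\<And>i. E i \<in> sets mark_space" for n E
    using that
  proof (induction n arbitrary: E)
    case 0
    show ?case by (simp add: I_def S.emeasure_space_1 C.emeasure_space_1)
  next
    case (Suc n)
    note E [measurable] = Suc.prems
    let ?E = "\<lambda>i. E (Suc i)"
    define H where "H A B = (\<integral>\<^sup>+V. I n ?E A B V \<partial>?C)" for A B
    have H_meas [measurable]: "(\<lambda>\<omega>. H (A \<omega>) (B \<omega>)) \<in> borel_measurable M"
      if [measurable]: "A \<in> measurable M seq_space" "B \<in> measurable M seq_space" for A B and M :: "'x measure"
      unfolding H_def by (rule C.borel_measurable_nn_integral, unfold split_beta', rule I_meas) measurable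
    note measurable_mark_const[OF u, measurable]
    define l r where "l A = (indicator (E 0) (left_mark u (A 0)) :: ennreal)"
      and "r A = (indicator (E 0) (right_mark u (A 0)) :: ennreal)" for A :: "nat \<Rightarrow> real \<times> bool"
    have [measurable]: "l \<in> borel_measurable seq_space" "r \<in> borel_measurable seq_space"
      unfolding l_def[abs_def] r_def[abs_def]
      by (rule measurable_compose[OF measurable_compose[OF measurable_component_singleton[OF UNIV_I]]
            borel_measurable_indicator[OF E]], rule measurable_mark_const[OF u])+
    \<comment> \<open>Conditioning on the first coin: either the first term of \<open>A\<close> or the first term of \<open>B\<close> is used up.\<close>
    have 1: "(\<integral>\<^sup>+V. I (Suc n) E A B V \<partial>?C) =
        ennreal u * (l A * H (\<lambda>i. A (Suc i)) B) + ennreal (1 - u) * (r B * H A (\<lambda>i. B (Suc i)))"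
      if A: "A \<in> space seq_space" and B: "B \<in> space seq_space" for A B
    proof -
      have t: "(\<lambda>i. A (Suc i)) \<in> space seq_space" "(\<lambda>i. B (Suc i)) \<in> space seq_space"
        using A B by (auto simp: space_PiM PiE_iff)
      have Im: "(\<lambda>V. I k E' A' B' V) \<in> borel_measurable (PiM UNIV (\<lambda>_. Leb))"
        if "\<And>i. E' i \<in> sets mark_space" "A' \<in> space seq_space" "B' \<in> space seq_space" for k E' A' B'
        by (rule I_meas) (rule that measurable_const measurable_ident_sets refl)+
      have "(\<integral>\<^sup>+V. I (Suc n) E A B V \<partial>?C) = (\<integral>\<^sup>+v. \<integral>\<^sup>+V. I (Suc n) E A B (case_nat v V) \<partial>?C \<partial>Leb)"
        unfolding coin_sequences_def
        by (rule nn_integral_PiM_case_nat[OF prob_space_Leb]) (rule Im[OF E A B])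
      also have "\<dots> = (\<integral>\<^sup>+v. (if v \<le> u then l A * H (\<lambda>i. A (Suc i)) B else r B * H A (\<lambda>i. B (Suc i))) \<partial>Leb)"
      proof (rule nn_integral_cong)
        fix v
        have "I (Suc n) E A B (case_nat v V) =
          (if v \<le> u then l A * I n ?E (\<lambda>i. A (Suc i)) B V else r B * I n ?E A (\<lambda>i. B (Suc i)) V)" for V
          unfolding I_def prod.lessThan_Suc_shift merge_marks_case_nat l_def r_def by simp
        then show "(\<integral>\<^sup>+V. I (Suc n) E A B (case_nat v V) \<partial>?C) =
          (if v \<le> u then l A * H (\<lambda>i. A (Suc i)) B else r B * H A (\<lambda>i. B (Suc i)))"
          unfolding H_def using Im[OF E t(1) B] Im[OF E A t(2)]
          by (auto simp: nn_integral_cmult measurable_cong_sets[OF sets_coin_sequences refl])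
      qed
      finally show ?thesis by (simp add: nn_integral_Leb_if[OF u])
    qed
    have sp: "space ?S = space seq_space" by (rule sets_eq_imp_space_eq[OF sets_mark_sequences])
    have [measurable]: "(\<lambda>A. integral\<^sup>N ?S (H A)) \<in> borel_measurable seq_space"
      by (rule S.borel_measurable_nn_integral, unfold split_beta', rule H_meas) measurable
    then have [measurable]: "(\<lambda>A. integral\<^sup>N ?S (H (\<lambda>i. A (Suc i)))) \<in> borel_measurable seq_space"
      by (rule measurable_compose[OF tail])
    have H1 [measurable]: "H A \<in> borel_measurable seq_space" if "A \<in> space seq_space" for A
      by (rule H_meas) (rule measurable_const measurable_ident_sets refl that)+
    have H2 [measurable]: "(\<lambda>B. H A (\<lambda>i. B (Suc i))) \<in> borel_measurable seq_space" if "A \<in> space seq_space" for A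
      by (rule measurable_compose[OF tail H1[OF that]])
    have tA: "(\<lambda>i. A (Suc i)) \<in> space seq_space" if "A \<in> space seq_space" for A
      using that by (auto simp: space_PiM PiE_iff)
    have 2: "(\<integral>\<^sup>+A. l A * (\<integral>\<^sup>+B. H (\<lambda>i. A (Suc i)) B \<partial>?S) \<partial>?S) =
       (\<integral>\<^sup>+a. indicator (E 0) (left_mark u a) \<partial>marks p) * (\<Prod>i<n. emeasure (marks p) (?E i))"
      by (subst SI) (simp_all add: l_def nn_integral_cmult nn_integral_multc Suc.IH[OF E, symmetric] H_def[symmetric])
    have 3: "(\<integral>\<^sup>+B. r B * H A (\<lambda>i. B (Suc i)) \<partial>?S) =
       (\<integral>\<^sup>+a. indicator (E 0) (right_mark u a) \<partial>marks p) * (\<integral>\<^sup>+B. H A B \<partial>?S)" if "A \<in> space ?S" for A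
      using that by (subst SI) (simp_all add: r_def nn_integral_cmult nn_integral_multc sp)
    have "(\<integral>\<^sup>+A. \<integral>\<^sup>+B. \<integral>\<^sup>+V. I (Suc n) E A B V \<partial>?C \<partial>?S \<partial>?S) =
      (\<integral>\<^sup>+A. \<integral>\<^sup>+B. ennreal u * (l A * H (\<lambda>i. A (Suc i)) B) + ennreal (1 - u) * (r B * H A (\<lambda>i. B (Suc i))) \<partial>?S \<partial>?S)"
      by (intro nn_integral_cong 1) (simp_all add: sp)
    also have "\<dots> = (\<integral>\<^sup>+A. ennreal u * (l A * (\<integral>\<^sup>+B. H (\<lambda>i. A (Suc i)) B \<partial>?S)) +
        ennreal (1 - u) * ((\<integral>\<^sup>+a. indicator (E 0) (right_mark u a) \<partial>marks p) * (\<integral>\<^sup>+B. H A B \<partial>?S)) \<partial>?S)"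
    proof (rule nn_integral_cong)
      fix A assume "A \<in> space ?S"
      then have A: "A \<in> space seq_space" by (simp add: sp)
      note [measurable] = H1[OF tA[OF A]] H2[OF A]
      show "(\<integral>\<^sup>+B. ennreal u * (l A * H (\<lambda>i. A (Suc i)) B) + ennreal (1 - u) * (r B * H A (\<lambda>i. B (Suc i))) \<partial>?S) =
        ennreal u * (l A * (\<integral>\<^sup>+B. H (\<lambda>i. A (Suc i)) B \<partial>?S)) +
        ennreal (1 - u) * ((\<integral>\<^sup>+a. indicator (E 0) (right_mark u a) \<partial>marks p) * (\<integral>\<^sup>+B. H A B \<partial>?S))"
        by (simp add: nn_integral_add nn_integral_cmult 3 sp A)
    qed
    also have "\<dots> = ennreal u * ((\<integral>\<^sup>+a. indicator (E 0) (left_mark u a) \<partial>marks p) * (\<Prod>i<n. emeasure (marks p) (?E i))) +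
        ennreal (1 - u) * ((\<integral>\<^sup>+a. indicator (E 0) (right_mark u a) \<partial>marks p) * (\<Prod>i<n. emeasure (marks p) (?E i)))"
      by (simp add: nn_integral_add nn_integral_cmult 2 Suc.IH[OF E, symmetric] H_def[symmetric])
    also have "\<dots> = (ennreal u * (\<integral>\<^sup>+a. indicator (E 0) (left_mark u a) \<partial>marks p) +
        ennreal (1 - u) * (\<integral>\<^sup>+a. indicator (E 0) (right_mark u a) \<partial>marks p)) * (\<Prod>i<n. emeasure (marks p) (?E i))"
      by (simp add: distrib_right mult.assoc)
    also have "\<dots> = (\<integral>\<^sup>+a. indicator (E 0) a \<partial>marks p) * (\<Prod>i<n. emeasure (marks p) (?E i))"
      by (subst nn_integral_marks_split[OF u]) (simp_all add: E)
    also have "\<dots> = (\<Prod>i<Suc n. emeasure (marks p) (E i))"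
      unfolding prod.lessThan_Suc_shift by (simp add: E sets_marks)
    finally show ?case .
  qed
  have merge_seq: "(\<lambda>(A, B, V). merge_marks u A B V) \<in> measurable (?S \<Otimes>\<^sub>M ?S \<Otimes>\<^sub>M ?C) seq_space"
    unfolding split_beta' by (rule measurable_merge_marks_seq[OF measurable_const]) (use u in simp, measurable)
  show ?thesis
    unfolding mark_sequences_def
  proof (rule prob_measure_PiM_eqI[OF prob_space_marks], unfold mark_sequences_def[symmetric])
    let ?Q = "distr (?S \<Otimes>\<^sub>M ?S \<Otimes>\<^sub>M ?C) seq_space (\<lambda>(A, B, V). merge_marks u A B V)"
    show "prob_space ?Q" by (rule SSC.prob_space_distr[OF merge_seq])
    show "sets ?Q = sets ?S" by (simp add: sets_mark_sequences)
    fix n :: nat and E :: "nat \<Rightarrow> (real \<times> bool) set" assume "\<And>i. E i \<in> sets (marks p)"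
    then have E [measurable]: "E i \<in> sets mark_space" for i by (simp add: sets_marks)
    let ?X = "{z \<in> space seq_space. \<forall>i<n. z i \<in> E i}"
    have X: "?X \<in> sets seq_space" by measurable
    have Im: "(\<lambda>\<omega>. I n E (fst \<omega>) (fst (snd \<omega>)) (snd (snd \<omega>))) \<in> borel_measurable (?S \<Otimes>\<^sub>M ?S \<Otimes>\<^sub>M ?C)"
      by (rule I_meas[OF E]) measurable
    have "emeasure ?Q ?X = (\<integral>\<^sup>+\<omega>. indicator ?X (merge_marks u (fst \<omega>) (fst (snd \<omega>)) (snd (snd \<omega>))) \<partial>(?S \<Otimes>\<^sub>M ?S \<Otimes>\<^sub>M ?C))"
      using merge_seq X
      by (simp add: nn_integral_indicator[symmetric] nn_integral_distr split_beta' del: nn_integral_indicator)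
    also have "\<dots> = (\<integral>\<^sup>+\<omega>. I n E (fst \<omega>) (fst (snd \<omega>)) (snd (snd \<omega>)) \<partial>(?S \<Otimes>\<^sub>M ?S \<Otimes>\<^sub>M ?C))"
    proof (rule nn_integral_cong)
      fix \<omega> assume "\<omega> \<in> space (?S \<Otimes>\<^sub>M ?S \<Otimes>\<^sub>M ?C)"
      then have "merge_marks u (fst \<omega>) (fst (snd \<omega>)) (snd (snd \<omega>)) \<in> space seq_space"
        using measurable_space[OF merge_seq] by (simp add: split_beta')
      then show "indicator ?X (merge_marks u (fst \<omega>) (fst (snd \<omega>)) (snd (snd \<omega>))) = I n E (fst \<omega>) (fst (snd \<omega>)) (snd (snd \<omega>))"
        by (auto simp: I_def indicator_def)
    qed
    also have "\<dots> = (\<integral>\<^sup>+A. \<integral>\<^sup>+B. \<integral>\<^sup>+V. I n E A B V \<partial>?C \<partial>?S \<partial>?S)"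
      unfolding nn_integral_triple[OF S.prob_space_axioms C.prob_space_axioms Im] by simp
    also have "\<dots> = (\<Prod>i<n. emeasure (marks p) (E i))" by (rule main[OF E])
    finally show "emeasure ?Q {z \<in> space ?S. \<forall>i<n. z i \<in> E i} = (\<Prod>i<n. emeasure (marks p) (E i))"
      using sets_eq_imp_space_eq[OF sets_mark_sequences[of p]] by simp
  qed
qed

section \<open>Cutting a sequence of marks at its first term\<close>

text \<open>The parameters are arranged as in the domain of \<open>\<Phi>\<close> applied to sequences of marks: two sequences, a cut
and a sign; the coins are additional randomness that decides the interleaving.\<close>

definition glue :: "((nat \<Rightarrow> real \<times> bool) \<times> (nat \<Rightarrow> real \<times> bool) \<times> real \<times> bool) \<times> (nat \<Rightarrow> real)
    \<Rightarrow> nat \<Rightarrow> real \<times> bool" where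
  "glue = (\<lambda>((A, B, u, s), V). case_nat (u, s) (merge_marks u A B V))"

lemma measurable_glue: "glue \<in> measurable (Phi_space p (mark_sequences p) \<Otimes>\<^sub>M coin_sequences) seq_space"
proof -
  let ?M = "Phi_space p (mark_sequences p) \<Otimes>\<^sub>M coin_sequences"
  have *: "(\<lambda>\<omega>. glue \<omega> i) \<in> measurable ?M mark_space" for i
  proof (cases i)
    case 0
    have "(\<lambda>\<omega>. snd (snd (fst \<omega>))) \<in> measurable ?M mark_space" by measurable
    then show ?thesis by (simp add: 0 glue_def split_beta')
  next
    case (Suc n)
    have "(\<lambda>\<omega>. merge_marks (fst (snd (snd (fst \<omega>)))) (fst (fst \<omega>)) (fst (snd (fst \<omega>))) (snd \<omega>) n) \<in> measurable ?M mark_space"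
      by (rule measurable_merge_marks) measurable
    then show ?thesis by (simp add: Suc glue_def split_beta')
  qed
  show ?thesis
    by (rule measurable_PiM_single') (use * in \<open>auto simp: PiE_iff dest: measurable_space\<close>)
qed

text \<open>A sequence of marks consists of an independent first mark and tail. The tail may be generated by
merging at the cut given by the first mark, for every value of that mark; Fubini brings the parameters
into the required order.\<close>

lemma glue_law:
  "distr (Phi_space p (mark_sequences p) \<Otimes>\<^sub>M coin_sequences) seq_space glue = mark_sequences p"
proof (rule measure_eqI)
  let ?S = "mark_sequences p" and ?C = "coin_sequences" and ?M = "marks p"
  interpret S: prob_space ?S by (rule prob_space_mark_sequences)
  interpret C: prob_space ?C by (rule prob_space_coin_sequences)
  interpret M: prob_space ?M by (rule prob_space_marks)
  interpret P: pair_sigma_finite ?S ?M by unfold_locales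
  have Phi: "Phi_space p ?S = ?S \<Otimes>\<^sub>M ?S \<Otimes>\<^sub>M ?M" by (simp add: Phi_space_def marks_def)
  show "sets (distr (Phi_space p ?S \<Otimes>\<^sub>M ?C) seq_space glue) = sets ?S" by (simp add: sets_mark_sequences)
  have sp: "space ?S = space seq_space" "space ?M = space mark_space"
    by (rule sets_eq_imp_space_eq, rule sets_mark_sequences sets_marks)+
  fix X assume "X \<in> sets (distr (Phi_space p ?S \<Otimes>\<^sub>M ?C) seq_space glue)"
  then have X: "X \<in> sets seq_space" by simp
  define h where "h \<omega> = (indicator X (glue \<omega>) :: ennreal)" for \<omega>
  have h: "h \<in> borel_measurable (Phi_space p ?S \<Otimes>\<^sub>M ?C)"
    unfolding h_def by (rule measurable_compose[OF measurable_glue borel_measurable_indicator[OF X]])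
  \<comment> \<open>The coins are integrated out first; the remaining variables can then be reordered.\<close>
  define k where "k \<omega> = (\<integral>\<^sup>+V. h (\<omega>, V) \<partial>?C)" for \<omega>
  have k [measurable]: "k \<in> borel_measurable (?S \<Otimes>\<^sub>M ?S \<Otimes>\<^sub>M ?M)"
    unfolding k_def Phi[symmetric] by (rule C.borel_measurable_nn_integral) (use h in simp)
  have "emeasure (distr (Phi_space p ?S \<Otimes>\<^sub>M ?C) seq_space glue) X = (\<integral>\<^sup>+\<omega>. h \<omega> \<partial>(Phi_space p ?S \<Otimes>\<^sub>M ?C))"
    unfolding h_def using X
    by (simp add: nn_integral_indicator[symmetric] nn_integral_distr[OF measurable_glue] del: nn_integral_indicator)
  also have "\<dots> = (\<integral>\<^sup>+\<omega>. k \<omega> \<partial>(?S \<Otimes>\<^sub>M ?S \<Otimes>\<^sub>M ?M))"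
    unfolding k_def Phi[symmetric] by (rule C.nn_integral_fst[OF h, symmetric])
  also have "\<dots> = (\<integral>\<^sup>+A. \<integral>\<^sup>+B. \<integral>\<^sup>+x. k (A, B, x) \<partial>?M \<partial>?S \<partial>?S)"
    by (rule nn_integral_triple[OF S.prob_space_axioms M.prob_space_axioms k])
  also have "\<dots> = (\<integral>\<^sup>+A. \<integral>\<^sup>+x. \<integral>\<^sup>+B. k (A, B, x) \<partial>?S \<partial>?M \<partial>?S)"
    by (intro nn_integral_cong P.Fubini'[symmetric]) measurable
  also have "\<dots> = (\<integral>\<^sup>+x. \<integral>\<^sup>+A. \<integral>\<^sup>+B. k (A, B, x) \<partial>?S \<partial>?S \<partial>?M)"
    by (rule P.Fubini'[symmetric]) measurable
  also have "\<dots> = (\<integral>\<^sup>+x. \<integral>\<^sup>+z. indicator X (case_nat x z) \<partial>?S \<partial>?M)"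
  proof (rule nn_integral_cong)
    fix x assume x: "x \<in> space ?M"
    then have u: "0 \<le> fst x" "fst x \<le> 1" by (auto simp: sp space_pair_measure)
    let ?m = "\<lambda>(A, B, V). merge_marks (fst x) A B V"
    have xc: "(\<lambda>_. x) \<in> measurable seq_space mark_space" using x by (intro measurable_const) (simp add: sp)
    have cx: "(\<lambda>z. indicator X (case_nat x z) :: ennreal) \<in> borel_measurable seq_space"
      by (rule measurable_compose[OF _ borel_measurable_indicator[OF X]])
         (rule measurable_case_nat'[OF xc], rule measurable_ident_sets, rule refl)
    have mm: "?m \<in> measurable (?S \<Otimes>\<^sub>M ?S \<Otimes>\<^sub>M ?C) seq_space"
      unfolding split_beta' by (rule measurable_merge_marks_seq[OF measurable_const]) (use u in simp, measurable)
    have km: "(\<lambda>\<omega>. indicator X (case_nat x (?m \<omega>)) :: ennreal) \<in> borel_measurable (?S \<Otimes>\<^sub>M ?S \<Otimes>\<^sub>M ?C)"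
      by (rule measurable_compose[OF mm cx])
    have "(\<integral>\<^sup>+z. indicator X (case_nat x z) \<partial>?S) = (\<integral>\<^sup>+\<omega>. indicator X (case_nat x (?m \<omega>)) \<partial>(?S \<Otimes>\<^sub>M ?S \<Otimes>\<^sub>M ?C))"
      by (subst merge_marks_law[OF u, of p, symmetric]) (rule nn_integral_distr[OF mm], simp add: cx)
    also have "\<dots> = (\<integral>\<^sup>+A. \<integral>\<^sup>+B. \<integral>\<^sup>+V. indicator X (case_nat x (?m (A, B, V))) \<partial>?C \<partial>?S \<partial>?S)"
      by (rule nn_integral_triple[OF S.prob_space_axioms C.prob_space_axioms km])
    finally show "(\<integral>\<^sup>+A. \<integral>\<^sup>+B. k (A, B, x) \<partial>?S \<partial>?S) = (\<integral>\<^sup>+z. indicator X (case_nat x z) \<partial>?S)"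
      by (simp add: k_def h_def glue_def split_beta)
  qed
  also have "\<dots> = (\<integral>\<^sup>+z. indicator X z \<partial>?S)"
    unfolding mark_sequences_def
    by (rule nn_integral_PiM_case_nat[OF prob_space_marks, symmetric])
      (use X in \<open>simp add: measurable_cong_sets[OF sets_mark_sequences[unfolded mark_sequences_def] refl]\<close>)
  also have "\<dots> = emeasure ?S X" using X by (simp add: sets_mark_sequences)
  finally show "emeasure (distr (Phi_space p ?S \<Otimes>\<^sub>M ?C) seq_space glue) X = emeasure ?S X" .
qed

text \<open>The probability that \<open>m\<close> consecutive terms lie in \<open>D\<close> is a power of a number below 1.\<close>

lemma coins_infinitely_often:
  assumes D [measurable]: "D \<in> sets Leb" and lt: "emeasure Leb D < 1"
  shows "AE V in coin_sequences. \<forall>n. \<exists>i\<ge>n. V i \<notin> D"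
proof -
  interpret C: prob_space coin_sequences by (rule prob_space_coin_sequences)
  define N where "N n = {V \<in> space (PiM UNIV (\<lambda>_ :: nat. Leb)). \<forall>i\<ge>n. V i \<in> D}" for n :: nat
  have sp: "space coin_sequences = space (PiM UNIV (\<lambda>_ :: nat. Leb))" by (simp add: coin_sequences_def)
  have N: "N n \<in> sets coin_sequences" for n
    unfolding N_def sets_coin_sequences by measurable
  define q where "q = measure Leb D"
  have q: "0 \<le> q" "q < 1" using lt by (simp_all add: q_def Leb.emeasure_eq_measure)
  have "measure coin_sequences (N n) \<le> q ^ m" for n m
  proof -
    let ?E = "prod_emb UNIV (\<lambda>_. Leb) {n..<n + m} (\<Pi>\<^sub>E i\<in>{n..<n + m}. D)"
    have "emeasure coin_sequences ?E = (\<Prod>i\<in>{n..<n + m}. emeasure Leb D)"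
      unfolding coin_sequences_def by (rule emeasure_PiM_emb) (auto intro: prob_space_Leb)
    also have "\<dots> = ennreal (q ^ m)"
      by (simp add: Leb.emeasure_eq_measure q_def ennreal_power)
    finally have "measure coin_sequences ?E = q ^ m" using q by (simp add: measure_def)
    moreover have "?E \<in> sets coin_sequences"
      unfolding sets_coin_sequences by (rule sets_PiM_I) auto
    moreover have "N n \<subseteq> ?E" by (auto simp: N_def prod_emb_def space_PiM PiE_iff)
    ultimately show ?thesis using C.finite_measure_mono[of "N n" ?E] by simp
  qed
  then have "measure coin_sequences (N n) \<le> 0" for n
    using q by (intro LIMSEQ_le_const[OF LIMSEQ_realpow_zero]) auto
  then have "measure coin_sequences (N n) = 0" for n by (simp add: measure_le_0_iff)
  then have "N n \<in> null_sets coin_sequences" for n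
    by (simp add: null_sets_def N C.emeasure_eq_measure)
  then have "AE V in coin_sequences. \<forall>n. V \<notin> N n"
    by (simp add: AE_all_countable AE_not_in)
  then show ?thesis
    by (rule AE_mp) (rule AE_I2, auto simp: N_def sp)
qed

lemma coins_both_sides:
  assumes u: "0 < u" "u < 1"
  shows "AE V in coin_sequences. (\<forall>n. \<exists>i\<ge>n. V i \<le> u) \<and> (\<forall>n. \<exists>i\<ge>n. \<not> V i \<le> u)"
proof -
  have i: "(\<integral>\<^sup>+v. (if v \<le> u then a else b) \<partial>Leb) = ennreal u * a + ennreal (1 - u) * b" for a b
    using u by (intro nn_integral_Leb_if) auto
  have "(\<lambda>x. x) -` {..u} \<inter> space Leb \<in> sets Leb" "(\<lambda>x. x) -` {u<..} \<inter> space Leb \<in> sets Leb"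
    by (rule measurable_sets[OF borel_measurable_Leb], simp)+
  moreover have "(\<lambda>x. x) -` {..u} \<inter> space Leb = {v \<in> space Leb. v \<le> u}"
    "(\<lambda>x. x) -` {u<..} \<inter> space Leb = {v \<in> space Leb. \<not> v \<le> u}" by auto
  ultimately have s: "{v \<in> space Leb. v \<le> u} \<in> sets Leb" "{v \<in> space Leb. \<not> v \<le> u} \<in> sets Leb"
    by (simp_all only:)
  have "emeasure Leb {v \<in> space Leb. v \<le> u} = (\<integral>\<^sup>+v. (if v \<le> u then 1 else 0) \<partial>Leb)"
    by (subst nn_integral_indicator[symmetric]) (use s in \<open>auto intro!: nn_integral_cong simp: indicator_def simp del: nn_integral_indicator\<close>)
  then have 1: "emeasure Leb {v \<in> space Leb. v \<le> u} < 1" using u by (simp add: i ennreal_less_one_iff)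
  have "emeasure Leb {v \<in> space Leb. \<not> v \<le> u} = (\<integral>\<^sup>+v. (if v \<le> u then 0 else 1) \<partial>Leb)"
    by (subst nn_integral_indicator[symmetric]) (use s in \<open>auto intro!: nn_integral_cong simp: indicator_def simp del: nn_integral_indicator\<close>)
  then have 2: "emeasure Leb {v \<in> space Leb. \<not> v \<le> u} < 1" using u by (simp add: i ennreal_less_one_iff)
  show ?thesis
    using coins_infinitely_often[OF s(1) 1] coins_infinitely_often[OF s(2) 2] AE_space
  proof eventually_elim
    case (elim V)
    have "V i \<in> space Leb" for i
      using elim(3) by (auto simp: coin_sequences_def space_PiM PiE_iff)
    with elim(1,2) show ?case by blast
  qed
qed

text \<open>The constructions for driving sequences, expressed for a single sequence of marks.\<close>

definition seq_prec :: "(nat \<Rightarrow> real \<times> bool) \<Rightarrow> real \<Rightarrow> real \<Rightarrow> bool" where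
  "seq_prec z = rec_prec (\<lambda>j. fst (z j)) (\<lambda>j. snd (z j))"

definition seq_phi :: "(nat \<Rightarrow> real \<times> bool) \<Rightarrow> real \<Rightarrow> real" where
  "seq_phi z = rec_phi (\<lambda>j. fst (z j)) (\<lambda>j. snd (z j))"

definition seq_measure :: "(nat \<Rightarrow> real \<times> bool) \<Rightarrow> (real \<times> real) measure" where
  "seq_measure z = rec_measure (\<lambda>j. fst (z j)) (\<lambda>j. snd (z j))"

lemma first_hit_Least:
  "first_hit P R z \<longleftrightarrow> (\<exists>j. P (z j)) \<and> R (z (LEAST j. P (z j)))"
proof
  assume "first_hit P R z"
  then obtain j where j: "P (z j)" "R (z j)" "\<And>i. i < j \<Longrightarrow> \<not> P (z i)" by (auto simp: first_hit_def)
  then have "(LEAST j. P (z j)) = j" by (intro Least_equality) (auto simp: not_less[symmetric])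
  with j show "(\<exists>j. P (z j)) \<and> R (z (LEAST j. P (z j)))" by auto
next
  assume "(\<exists>j. P (z j)) \<and> R (z (LEAST j. P (z j)))"
  then show "first_hit P R z"
    unfolding first_hit_def using LeastI_ex[of "\<lambda>j. P (z j)"] not_less_Least[of _ "\<lambda>j. P (z j)"] by blast
qed

lemma seq_prec_first_hit:
  "seq_prec z a b \<longleftrightarrow> (a < b \<and> first_hit (\<lambda>x. fst x \<in> {a<..b}) snd z) \<or>
     (b < a \<and> first_hit (\<lambda>x. fst x \<in> {b<..a}) (\<lambda>x. \<not> snd x) z)"
  unfolding seq_prec_def rec_prec_def first_hit_Least by blast

lemma first_hit_comp: "first_hit P R (\<lambda>i. f (z i)) \<longleftrightarrow> first_hit (\<lambda>x. P (f x)) (\<lambda>x. R (f x)) z"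
  by (simp add: first_hit_def)

section \<open>The recursion for the graph measure\<close>

lemma measurable_seq_prec:
  assumes z: "z \<in> measurable M seq_space" and [measurable]: "a \<in> borel_measurable M" "b \<in> borel_measurable M"
  shows "Measurable.pred M (\<lambda>\<omega>. seq_prec (z \<omega>) (a \<omega>) (b \<omega>))"
proof -
  have zj: "(\<lambda>\<omega>. z \<omega> j) \<in> measurable M mark_space" for j
    using measurable_compose[OF z measurable_component_singleton[OF UNIV_I]] .
  have [measurable]: "(\<lambda>\<omega>. fst (z \<omega> j)) \<in> borel_measurable M" for j
    by (rule Leb_borel) (rule measurable_compose[OF zj measurable_fst])
  have [measurable]: "Measurable.pred M (\<lambda>\<omega>. snd (z \<omega> j))" for j
    by (rule measurable_compose[OF zj measurable_snd])
  show ?thesis unfolding seq_prec_first_hit first_hit_def greaterThanAtMost_iff by measurable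
qed

lemma ennreal_seq_phi:
  assumes z: "z \<in> space seq_space"
  shows "ennreal (seq_phi z x) = (\<integral>\<^sup>+y. (if seq_prec z y x then 1 else 0) \<partial>Leb)"
proof -
  have [measurable]: "Measurable.pred Leb (\<lambda>y. seq_prec z y x)"
    by (rule measurable_seq_prec) (use z in \<open>auto intro: measurable_const\<close>)
  have s: "{y \<in> space Leb. seq_prec z y x} \<in> sets Leb" by measurable
  have "ennreal (seq_phi z x) = emeasure Leb {y \<in> space Leb. seq_prec z y x}"
    by (simp add: seq_phi_def rec_phi_def seq_prec_def Leb.emeasure_eq_measure)
  also have "\<dots> = (\<integral>\<^sup>+y. indicator {y \<in> space Leb. seq_prec z y x} y \<partial>Leb)"
    using s by (rule nn_integral_indicator[symmetric])
  also have "\<dots> = (\<integral>\<^sup>+y. (if seq_prec z y x then 1 else 0) \<partial>Leb)"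
    by (rule nn_integral_cong) (simp add: indicator_def)
  finally show ?thesis .
qed

lemma measurable_seq_phi:
  assumes z [measurable]: "z \<in> measurable M seq_space" and x [measurable]: "x \<in> borel_measurable M"
  shows "(\<lambda>\<omega>. seq_phi (z \<omega>) (x \<omega>)) \<in> borel_measurable M"
proof -
  have [measurable]: "Measurable.pred (M \<Otimes>\<^sub>M Leb) (\<lambda>(\<omega>, y). seq_prec (z \<omega>) y (x \<omega>))" (is ?P)
  proof -
    have [measurable]: "snd \<in> borel_measurable (M \<Otimes>\<^sub>M Leb)" by (rule Leb_borel) measurable
    show ?P unfolding split_beta' by (rule measurable_seq_prec) measurable
  qed
  have "(\<lambda>\<omega>. enn2real (\<integral>\<^sup>+y. (if seq_prec (z \<omega>) y (x \<omega>) then 1 else 0) \<partial>Leb)) \<in> borel_measurable M"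
    by measurable
  also have "?this \<longleftrightarrow> ?thesis"
  proof (rule measurable_cong)
    fix \<omega> assume "\<omega> \<in> space M"
    then have "ennreal (seq_phi (z \<omega>) (x \<omega>)) = (\<integral>\<^sup>+y. (if seq_prec (z \<omega>) y (x \<omega>) then 1 else 0) \<partial>Leb)"
      by (intro ennreal_seq_phi measurable_space[OF z])
    from this[symmetric] show "enn2real (\<integral>\<^sup>+y. (if seq_prec (z \<omega>) y (x \<omega>) then 1 else 0) \<partial>Leb) = seq_phi (z \<omega>) (x \<omega>)"
      by (simp add: seq_phi_def rec_phi_def)
  qed
  finally show ?thesis .
qed

lemma seq_phi_range: "0 \<le> seq_phi z x" "seq_phi z x \<le> 1"
  by (simp_all add: seq_phi_def rec_phi_def)

lemma measurable_graph:
  assumes z: "z \<in> measurable M seq_space" and x: "x \<in> measurable M Leb"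
  shows "(\<lambda>\<omega>. (x \<omega>, seq_phi (z \<omega>) (x \<omega>))) \<in> measurable M square_borel"
  unfolding measurable_square_borel_iff
proof
  have [measurable]: "x \<in> borel_measurable M" by (rule Leb_borel[OF x])
  have [measurable]: "(\<lambda>\<omega>. seq_phi (z \<omega>) (x \<omega>)) \<in> borel_measurable M" by (rule measurable_seq_phi[OF z]) measurable
  show "(\<lambda>\<omega>. (x \<omega>, seq_phi (z \<omega>) (x \<omega>))) \<in> borel_measurable M" by measurable
  show "\<forall>\<omega>\<in>space M. (x \<omega>, seq_phi (z \<omega>) (x \<omega>)) \<in> unit_square"
    using measurable_space[OF x] by (auto simp: seq_phi_range)
qed

lemma seq_measure_eq: "seq_measure z = distr Leb square_borel (\<lambda>x. (x, seq_phi z x))"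
  by (simp add: seq_measure_def rec_measure_def seq_phi_def)

lemma graph_section:
  assumes "z \<in> space seq_space"
  shows "(\<lambda>x. (x, seq_phi z x)) \<in> measurable Leb square_borel"
  by (rule measurable_graph[OF measurable_const[OF assms]]) (rule measurable_ident_sets, rule refl)

lemma measurable_seq_measure: "seq_measure \<in> measurable seq_space (subprob_algebra square_borel)"
  unfolding seq_measure_eq[abs_def]
proof (rule measurable_distr2)
  show "(\<lambda>(z, x). (x, seq_phi z x)) \<in> measurable (seq_space \<Otimes>\<^sub>M Leb) square_borel"
    unfolding split_beta' by (rule measurable_graph) measurable
  show "(\<lambda>z. Leb) \<in> measurable seq_space (subprob_algebra Leb)"
    by (rule measurable_const) (simp add: space_subprob_algebra prob_space_imp_subprob_space prob_space_Leb)
qed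

lemma prob_space_seq_measure: "z \<in> space seq_space \<Longrightarrow> prob_space (seq_measure z)"
  unfolding seq_measure_eq by (rule prob_space.prob_space_distr[OF prob_space_Leb graph_section])

lemma sets_seq_measure [simp]: "sets (seq_measure z) = sets square_borel"
  by (simp add: seq_measure_eq)

lemma glue_in_seq_space:
  assumes "0 \<le> u" "u \<le> 1" "A \<in> space seq_space" "B \<in> space seq_space" "V \<in> space coin_sequences"
  shows "glue ((A, B, u, s), V) \<in> space seq_space"
proof -
  \<comment> \<open>The underlying set is the same for every parameter, so any value serves.\<close>
  have "((A, B, u, s), V) \<in> space (Phi_space 0 (mark_sequences 0) \<Otimes>\<^sub>M coin_sequences)"
    using assms sets_eq_imp_space_eq[OF sets_mark_sequences[of 0]]
    by (simp add: space_pair_measure space_Phi_space)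
  then show ?thesis by (rule measurable_space[OF measurable_glue])
qed

context
  fixes u :: real and s :: bool and A B :: "nat \<Rightarrow> real \<times> bool" and V :: "nat \<Rightarrow> real" and z
  assumes u: "0 < u" "u < 1"
    and AB: "A \<in> space seq_space" "B \<in> space seq_space" "V \<in> space coin_sequences"
    and V: "\<And>n. \<exists>i\<ge>n. V i \<le> u" "\<And>n. \<exists>i\<ge>n. \<not> V i \<le> u"
  defines "z \<equiv> glue ((A, B, u, s), V)"
begin

lemma z_space: "z \<in> space seq_space"
  unfolding z_def using u AB by (intro glue_in_seq_space) auto

lemma marks_in_unit: "fst (A i) \<in> {0..1}" "fst (B i) \<in> {0..1}"
  using AB(1,2) by (auto simp: space_PiM PiE_iff space_pair_measure mem_Times_iff)

lemma z_simps: "z 0 = (u, s)" "(\<lambda>i. z (Suc i)) = merge_marks u A B V"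
  by (simp_all add: z_def glue_def)

text \<open>Marks from the right half lie beyond \<open>u\<close> and hence outside an interval contained in \<open>[0, u)\<close>; the cut
itself is outside as well. What remains is the first hit of the rescaled interval in the left
sequence.\<close>

lemma first_hit_left:
  assumes ab: "0 \<le> a" "b < 1"
  shows "first_hit (\<lambda>x. fst x \<in> {u * a<..u * b}) R z \<longleftrightarrow> first_hit (\<lambda>x. fst x \<in> {a<..b}) (\<lambda>x. R (left_mark u x)) A"
proof -
  have ub: "u * b < u" using ab u by simp
  have "first_hit (\<lambda>x. fst x \<in> {u * a<..u * b}) R z \<longleftrightarrow> first_hit (\<lambda>x. fst x \<in> {u * a<..u * b}) R (merge_marks u A B V)"
    using ub by (simp add: first_hit_Suc[of _ _ z] z_simps)
  also have "\<dots> \<longleftrightarrow> first_hit (\<lambda>x. fst x \<in> {u * a<..u * b}) R (\<lambda>i. left_mark u (A i))"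
    unfolding merge_marks_def
  proof (rule first_hit_interleave[OF V(1)])
    fix j
    have "0 \<le> (1 - u) * fst (B j)" using u marks_in_unit(2)[of j] by simp
    then show "fst (right_mark u (B j)) \<notin> {u * a<..u * b}" using ub by (simp add: right_mark_def)
  qed
  also have "\<dots> \<longleftrightarrow> first_hit (\<lambda>x. fst x \<in> {a<..b}) (\<lambda>x. R (left_mark u x)) A"
    unfolding first_hit_comp[of _ _ "left_mark u" A] using u by (simp add: left_mark_def)
  finally show ?thesis .
qed

lemma first_hit_right:
  assumes ab: "0 \<le> a"
  shows "first_hit (\<lambda>x. fst x \<in> {u + (1 - u) * a<..u + (1 - u) * b}) R z \<longleftrightarrow>
    first_hit (\<lambda>x. fst x \<in> {a<..b}) (\<lambda>x. R (right_mark u x)) B"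
proof -
  have ua: "u \<le> u + (1 - u) * a" using ab u by simp
  have "first_hit (\<lambda>x. fst x \<in> {u + (1 - u) * a<..u + (1 - u) * b}) R z \<longleftrightarrow>
      first_hit (\<lambda>x. fst x \<in> {u + (1 - u) * a<..u + (1 - u) * b}) R (merge_marks u A B V)"
    using ua by (simp add: first_hit_Suc[of _ _ z] z_simps)
  also have "merge_marks u A B V = interleave (\<lambda>i. right_mark u (B i)) (\<lambda>i. left_mark u (A i)) (\<lambda>i. \<not> V i \<le> u)"
    unfolding merge_marks_def by (rule ext) (rule interleave_swap)
  also have "first_hit (\<lambda>x. fst x \<in> {u + (1 - u) * a<..u + (1 - u) * b}) R \<dots> \<longleftrightarrow>
      first_hit (\<lambda>x. fst x \<in> {u + (1 - u) * a<..u + (1 - u) * b}) R (\<lambda>i. right_mark u (B i))"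
  proof (rule first_hit_interleave[OF V(2)])
    fix j
    have "u * fst (A j) \<le> u * 1" using u marks_in_unit(1)[of j] by (intro mult_left_mono) auto
    then show "fst (left_mark u (A j)) \<notin> {u + (1 - u) * a<..u + (1 - u) * b}" using ua by (simp add: left_mark_def)
  qed
  also have "\<dots> \<longleftrightarrow> first_hit (\<lambda>x. fst x \<in> {a<..b}) (\<lambda>x. R (right_mark u x)) B"
    unfolding first_hit_comp[of _ _ "right_mark u" B] using u by (simp add: right_mark_def)
  finally show ?thesis .
qed

lemma seq_prec_z:
  shows "0 \<le> a \<Longrightarrow> a < 1 \<Longrightarrow> 0 \<le> b \<Longrightarrow> b < 1 \<Longrightarrow> seq_prec z (u * a) (u * b) \<longleftrightarrow> seq_prec A a b"
    and "0 \<le> a \<Longrightarrow> 0 \<le> b \<Longrightarrow> seq_prec z (u + (1 - u) * a) (u + (1 - u) * b) \<longleftrightarrow> seq_prec B a b"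
    and "a < 1 \<Longrightarrow> 0 \<le> b \<Longrightarrow> seq_prec z (u * a) (u + (1 - u) * b) \<longleftrightarrow> s"
    and "0 \<le> a \<Longrightarrow> b < 1 \<Longrightarrow> seq_prec z (u + (1 - u) * a) (u * b) \<longleftrightarrow> \<not> s"
proof -
  show "seq_prec z (u * a) (u * b) \<longleftrightarrow> seq_prec A a b" if "0 \<le> a" "a < 1" "0 \<le> b" "b < 1"
    using that u by (simp only: seq_prec_first_hit first_hit_left) (simp add: left_mark_def)
  show "seq_prec z (u + (1 - u) * a) (u + (1 - u) * b) \<longleftrightarrow> seq_prec B a b" if "0 \<le> a" "0 \<le> b"
    using that u by (simp only: seq_prec_first_hit first_hit_right) (simp add: right_mark_def)
  have lt: "u * a < u" "u \<le> u + (1 - u) * b" if "a < 1" "0 \<le> b" for a b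
    using that u by simp_all
  show "seq_prec z (u * a) (u + (1 - u) * b) \<longleftrightarrow> s" if "a < 1" "0 \<le> b"
    using lt[OF that] by (simp add: seq_prec_first_hit first_hit_Suc[of _ _ z] z_simps)
  show "seq_prec z (u + (1 - u) * a) (u * b) \<longleftrightarrow> \<not> s" if "0 \<le> a" "b < 1"
    using lt[OF that(2,1)] by (simp add: seq_prec_first_hit first_hit_Suc[of _ _ z] z_simps)
qed

lemma ennreal_seq_phi_z:
  "ennreal (seq_phi z x) =
    ennreal u * (\<integral>\<^sup>+y. (if seq_prec z (u * y) x then 1 else 0) \<partial>Leb) +
    ennreal (1 - u) * (\<integral>\<^sup>+y. (if seq_prec z (u + (1 - u) * y) x then 1 else 0) \<partial>Leb)"
proof -
  have [measurable]: "Measurable.pred Leb (\<lambda>y. seq_prec z y x)"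
    by (rule measurable_seq_prec) (use z_space in \<open>auto intro: measurable_const\<close>)
  show ?thesis
    unfolding ennreal_seq_phi[OF z_space] using u by (intro nn_integral_Leb_split) auto
qed

text \<open>A point to the left of the cut is preceded by the points of the left half that precede it there, and by
the whole right half exactly when the sign is negative. The boundary point 1 of the left half is
mapped to the cut itself and has to be excluded.\<close>

lemma seq_phi_left:
  assumes x: "0 \<le> x" "x < 1"
  shows "seq_phi z (u * x) = u * seq_phi A x + (if s then 0 else 1 - u)"
proof -
  have "(\<integral>\<^sup>+y. (if seq_prec z (u * y) (u * x) then 1 else 0) \<partial>Leb) = ennreal (seq_phi A x)"
    unfolding ennreal_seq_phi[OF AB(1)]
  proof (rule nn_integral_cong_AE)
    show "AE y in Leb. (if seq_prec z (u * y) (u * x) then 1 else 0) = (if seq_prec A y x then 1 else (0 :: ennreal))"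
      using AE_Leb_neq[of 1] AE_space
      by eventually_elim (use x in \<open>simp add: seq_prec_z(1)\<close>)
  qed
  moreover have "(\<integral>\<^sup>+y. (if seq_prec z (u + (1 - u) * y) (u * x) then 1 else 0) \<partial>Leb) = (\<integral>\<^sup>+y. (if s then 0 else 1) \<partial>Leb)"
    by (rule nn_integral_cong) (use x in \<open>simp add: seq_prec_z(4)\<close>)
  ultimately have "ennreal (seq_phi z (u * x)) = ennreal (u * seq_phi A x + (if s then 0 else 1 - u))"
    unfolding ennreal_seq_phi_z using u Leb.emeasure_space_1
    by (simp add: seq_phi_range ennreal_mult ennreal_plus)
  then show ?thesis using u by (subst (asm) ennreal_inj) (auto simp: seq_phi_range)
qed

lemma seq_phi_right:
  assumes x: "0 \<le> x"
  shows "seq_phi z (u + (1 - u) * x) = (if s then u else 0) + (1 - u) * seq_phi B x"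
proof -
  have "(\<integral>\<^sup>+y. (if seq_prec z (u + (1 - u) * y) (u + (1 - u) * x) then 1 else 0) \<partial>Leb) = ennreal (seq_phi B x)"
    unfolding ennreal_seq_phi[OF AB(2)]
    by (rule nn_integral_cong) (use x in \<open>simp add: seq_prec_z(2)\<close>)
  moreover have "(\<integral>\<^sup>+y. (if seq_prec z (u * y) (u + (1 - u) * x) then 1 else 0) \<partial>Leb) = (\<integral>\<^sup>+y. (if s then 1 else 0) \<partial>Leb)"
  proof (rule nn_integral_cong_AE)
    show "AE y in Leb. (if seq_prec z (u * y) (u + (1 - u) * x) then 1 else 0) = (if s then 1 else (0 :: ennreal))"
      using AE_Leb_neq[of 1] AE_space
      by eventually_elim (use x in \<open>simp add: seq_prec_z(3)\<close>)
  qed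
  ultimately have "ennreal (seq_phi z (u + (1 - u) * x)) = ennreal ((if s then u else 0) + (1 - u) * seq_phi B x)"
    unfolding ennreal_seq_phi_z using u Leb.emeasure_space_1
    by (simp add: seq_phi_range ennreal_mult ennreal_plus)
  then show ?thesis using u by (subst (asm) ennreal_inj) (auto simp: seq_phi_range)
qed

text \<open>By the previous two lemmas the graph of \<open>\<phi>\<close> over each side of the cut is the image of a graph of one of
the halves under the corresponding block map.\<close>

lemma seq_measure_tensor: "seq_measure z = permuton_tensor u s (seq_measure A) (seq_measure B)"
proof (rule measure_eqI)
  show "sets (seq_measure z) = sets (permuton_tensor u s (seq_measure A) (seq_measure B))" by simp
  fix X assume "X \<in> sets (seq_measure z)"
  then have X [measurable]: "X \<in> sets square_borel" by simp
  note [measurable] = graph_section[OF z_space] graph_section[OF AB(1)] graph_section[OF AB(2)]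
  have u': "0 \<le> u" "u \<le> 1" using u by auto
  note [measurable] = left_map_measurable[OF u', of s] right_map_measurable[OF u', of s]
  let ?h = "\<lambda>x. indicator X (x, seq_phi z x) :: ennreal"
  have "emeasure (seq_measure z) X = (\<integral>\<^sup>+x. ?h x \<partial>Leb)"
    by (simp add: seq_measure_eq nn_integral_distr nn_integral_indicator[symmetric] del: nn_integral_indicator)
  also have "\<dots> = ennreal u * (\<integral>\<^sup>+x. ?h (u * x) \<partial>Leb) + ennreal (1 - u) * (\<integral>\<^sup>+x. ?h (u + (1 - u) * x) \<partial>Leb)"
    by (rule nn_integral_Leb_split[OF u']) measurable
  also have "(\<integral>\<^sup>+x. ?h (u * x) \<partial>Leb) = (\<integral>\<^sup>+x. indicator X (left_map u s (x, seq_phi A x)) \<partial>Leb)"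
  proof (rule nn_integral_cong_AE)
    show "AE x in Leb. ?h (u * x) = indicator X (left_map u s (x, seq_phi A x))"
      using AE_Leb_neq[of 1] AE_space
      by eventually_elim (simp add: seq_phi_left left_map_def add.commute)
  qed
  also have "(\<integral>\<^sup>+x. ?h (u + (1 - u) * x) \<partial>Leb) = (\<integral>\<^sup>+x. indicator X (right_map u s (x, seq_phi B x)) \<partial>Leb)"
    by (rule nn_integral_cong) (simp add: seq_phi_right right_map_def)
  also have "ennreal u * (\<integral>\<^sup>+x. indicator X (left_map u s (x, seq_phi A x)) \<partial>Leb) +
      ennreal (1 - u) * (\<integral>\<^sup>+x. indicator X (right_map u s (x, seq_phi B x)) \<partial>Leb) =
      (\<integral>\<^sup>+w. indicator X w \<partial>permuton_tensor u s (seq_measure A) (seq_measure B))"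
    by (subst nn_integral_permuton_tensor[OF u']) (simp_all add: seq_measure_eq nn_integral_distr)
  finally show "emeasure (seq_measure z) X = emeasure (permuton_tensor u s (seq_measure A) (seq_measure B)) X"
    by simp
qed

end

section \<open>The second marginal of the graph measure\<close>

definition height_cdf :: "(real \<times> real) measure \<Rightarrow> real \<Rightarrow> real" where
  "height_cdf \<mu> t = measure \<mu> {w \<in> unit_square. snd w \<le> t}"

text \<open>The \<open>L\<^sup>1\<close> distance between the second marginal and the uniform law. An integral is preferred to a
supremum because it is measurable in the measure and additive over the blocks of a tensor.\<close>

definition height_defect :: "(real \<times> real) measure \<Rightarrow> ennreal" where
  "height_defect \<mu> = (\<integral>\<^sup>+t. ennreal \<bar>height_cdf \<mu> t - t\<bar> \<partial>Leb)"

lemma halfplane_sets [measurable]: "{w \<in> unit_square. snd w \<le> t} \<in> sets square_borel"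
proof -
  have "{w \<in> space square_borel. snd w \<le> t} \<in> sets square_borel" by measurable
  then show ?thesis by simp
qed

lemma height_cdf_extreme:
  assumes "prob_space \<mu>" "sets \<mu> = sets square_borel"
  shows "t < 0 \<Longrightarrow> height_cdf \<mu> t = 0" "1 \<le> t \<Longrightarrow> height_cdf \<mu> t = 1"
proof -
  interpret prob_space \<mu> by fact
  have sp: "space \<mu> = unit_square" using sets_eq_imp_space_eq[OF assms(2)] by simp
  show "height_cdf \<mu> t = 0" if "t < 0"
  proof -
    have "{w \<in> unit_square. snd w \<le> t} = ({} :: (real \<times> real) set)" using that by force
    then show ?thesis by (simp only: height_cdf_def measure_empty)
  qed
  show "height_cdf \<mu> t = 1" if "1 \<le> t"
  proof -
    have "{w \<in> unit_square. snd w \<le> t} = space \<mu>" using that by (force simp: sp)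
    then show ?thesis by (simp only: height_cdf_def prob_space)
  qed
qed

lemma height_cdf_mono:
  assumes "prob_space \<mu>" "sets \<mu> = sets square_borel"
  shows "mono (height_cdf \<mu>)"
proof -
  interpret prob_space \<mu> by fact
  show ?thesis unfolding height_cdf_def
    by (intro monoI finite_measure_mono) (auto simp: assms(2))
qed

lemma measurable_height_cdf:
  assumes [measurable]: "X \<in> measurable M (subprob_algebra square_borel)" "t \<in> borel_measurable M"
  shows "(\<lambda>\<omega>. height_cdf (X \<omega>) (t \<omega>)) \<in> borel_measurable M"
proof -
  have "(\<lambda>\<omega>. \<integral>\<^sup>+w. (if snd w \<le> t \<omega> then 1 else 0) \<partial>X \<omega>) \<in> borel_measurable M"
    by (rule nn_integral_measurable_subprob_algebra2) measurable
  then have "(\<lambda>\<omega>. enn2real (\<integral>\<^sup>+w. (if snd w \<le> t \<omega> then 1 else 0) \<partial>X \<omega>)) \<in> borel_measurable M" by measurable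
  also have "?this \<longleftrightarrow> ?thesis"
  proof (rule measurable_cong)
    fix \<omega> assume "\<omega> \<in> space M"
    then have X: "sets (X \<omega>) = sets square_borel" by (rule sets_kernel[OF assms(1)])
    then have sp: "space (X \<omega>) = unit_square" using sets_eq_imp_space_eq[OF X] by simp
    have "(\<integral>\<^sup>+w. (if snd w \<le> t \<omega> then 1 else 0) \<partial>X \<omega>) = (\<integral>\<^sup>+w. indicator {w \<in> unit_square. snd w \<le> t \<omega>} w \<partial>X \<omega>)"
      by (rule nn_integral_cong) (auto simp: sp indicator_def)
    also have "\<dots> = emeasure (X \<omega>) {w \<in> unit_square. snd w \<le> t \<omega>}"
      by (rule nn_integral_indicator) (simp add: X)
    finally show "enn2real (\<integral>\<^sup>+w. (if snd w \<le> t \<omega> then 1 else 0) \<partial>X \<omega>) = height_cdf (X \<omega>) (t \<omega>)"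
      by (simp add: height_cdf_def measure_def)
  qed
  finally show ?thesis .
qed

lemma measurable_height_defect:
  assumes X [measurable]: "X \<in> measurable M (subprob_algebra square_borel)"
  shows "(\<lambda>\<omega>. height_defect (X \<omega>)) \<in> borel_measurable M"
  unfolding height_defect_def
proof (rule Leb.borel_measurable_nn_integral)
  have t [measurable]: "snd \<in> borel_measurable (M \<Otimes>\<^sub>M Leb)" by (rule Leb_borel) measurable
  have [measurable]: "(\<lambda>\<omega>. height_cdf (X (fst \<omega>)) (snd \<omega>)) \<in> borel_measurable (M \<Otimes>\<^sub>M Leb)"
    by (rule measurable_height_cdf) measurable
  show "(\<lambda>(\<omega>, t). ennreal \<bar>height_cdf (X \<omega>) t - t\<bar>) \<in> borel_measurable (M \<Otimes>\<^sub>M Leb)"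
    unfolding split_beta' by measurable
qed

text \<open>Stacking two laws with weights \<open>w\<close> and \<open>1 - w\<close> splits the difference to the identity into two rescaled
pieces: below \<open>w\<close> the upper law contributes nothing, and above it the lower law contributes its full
mass. Each piece shrinks both in height and in length, whence the squares.\<close>

lemma stacked_defect:
  fixes c d :: "real \<Rightarrow> real"
  assumes w: "0 < w" "w < 1" and [measurable]: "c \<in> borel_measurable borel" "d \<in> borel_measurable borel"
    and c: "\<And>t. 1 \<le> t \<Longrightarrow> c t = 1" and d: "\<And>t. t < 0 \<Longrightarrow> d t = 0"
  shows "(\<integral>\<^sup>+t. ennreal \<bar>(w * c (t / w) + (1 - w) * d ((t - w) / (1 - w))) - t\<bar> \<partial>Leb) =
    ennreal (w\<^sup>2) * (\<integral>\<^sup>+t. ennreal \<bar>c t - t\<bar> \<partial>Leb) + ennreal ((1 - w)\<^sup>2) * (\<integral>\<^sup>+t. ennreal \<bar>d t - t\<bar> \<partial>Leb)"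
proof -
  let ?F = "\<lambda>t. w * c (t / w) + (1 - w) * d ((t - w) / (1 - w))"
  have "(\<integral>\<^sup>+t. ennreal \<bar>?F t - t\<bar> \<partial>Leb) =
      ennreal w * (\<integral>\<^sup>+t. ennreal \<bar>?F (w * t) - w * t\<bar> \<partial>Leb) +
      ennreal (1 - w) * (\<integral>\<^sup>+t. ennreal \<bar>?F (w + (1 - w) * t) - (w + (1 - w) * t)\<bar> \<partial>Leb)"
    using w by (intro nn_integral_Leb_split) auto
  also have "(\<integral>\<^sup>+t. ennreal \<bar>?F (w * t) - w * t\<bar> \<partial>Leb) = (\<integral>\<^sup>+t. ennreal w * ennreal \<bar>c t - t\<bar> \<partial>Leb)"
  proof (rule nn_integral_cong_AE)
    show "AE t in Leb. ennreal \<bar>?F (w * t) - w * t\<bar> = ennreal w * ennreal \<bar>c t - t\<bar>"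
      using AE_Leb_neq[of 1] AE_space
    proof eventually_elim
      case (elim t)
      then have "(w * t - w) / (1 - w) < 0" using w by (auto simp: divide_less_0_iff)
      then have "?F (w * t) - w * t = w * (c t - t)" using w d by (simp add: right_diff_distrib)
      then show ?case using w by (simp add: abs_mult ennreal_mult)
    qed
  qed
  also have "(\<integral>\<^sup>+t. ennreal \<bar>?F (w + (1 - w) * t) - (w + (1 - w) * t)\<bar> \<partial>Leb) = (\<integral>\<^sup>+t. ennreal (1 - w) * ennreal \<bar>d t - t\<bar> \<partial>Leb)"
  proof (rule nn_integral_cong)
    fix t assume "t \<in> space Leb"
    then have "0 \<le> (1 - w) * t" using w by simp
    then have "1 \<le> (w + (1 - w) * t) / w" using w by (simp add: le_divide_eq)
    then have "?F (w + (1 - w) * t) - (w + (1 - w) * t) = (1 - w) * (d t - t)"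
      using w c by (simp add: right_diff_distrib)
    then show "ennreal \<bar>?F (w + (1 - w) * t) - (w + (1 - w) * t)\<bar> = ennreal (1 - w) * ennreal \<bar>d t - t\<bar>"
      using w by (simp add: abs_mult ennreal_mult)
  qed
  also have "(\<integral>\<^sup>+t. ennreal w * ennreal \<bar>c t - t\<bar> \<partial>Leb) = ennreal w * (\<integral>\<^sup>+t. ennreal \<bar>c t - t\<bar> \<partial>Leb)"
    by (rule nn_integral_cmult) measurable
  also have "(\<integral>\<^sup>+t. ennreal (1 - w) * ennreal \<bar>d t - t\<bar> \<partial>Leb) = ennreal (1 - w) * (\<integral>\<^sup>+t. ennreal \<bar>d t - t\<bar> \<partial>Leb)"
    by (rule nn_integral_cmult) measurable
  finally show ?thesis
    using w by (simp only: mult.assoc[symmetric] ennreal_mult'[symmetric] power2_eq_square less_imp_le diff_ge_0_iff_ge)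
qed

text \<open>The second marginal of a tensor stacks those of the factors, from bottom to top in the order given by
the sign.\<close>

lemma height_cdf_tensor:
  assumes u: "0 < u" "u < 1"
    and \<mu>: "prob_space \<mu>" "sets \<mu> = sets square_borel" and \<nu>: "prob_space \<nu>" "sets \<nu> = sets square_borel"
  shows "height_cdf (permuton_tensor u s \<mu> \<nu>) t =
    (if s then u * height_cdf \<mu> (t / u) + (1 - u) * height_cdf \<nu> ((t - u) / (1 - u))
     else (1 - u) * height_cdf \<nu> (t / (1 - u)) + u * height_cdf \<mu> ((t - (1 - u)) / u))"
proof -
  interpret \<mu>: prob_space \<mu> by (rule \<mu>)
  interpret \<nu>: prob_space \<nu> by (rule \<nu>)
  have u': "0 \<le> u" "u \<le> 1" using u by auto
  have sp: "space \<mu> = unit_square" "space \<nu> = unit_square"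
    using sets_eq_imp_space_eq[OF \<mu>(2)] sets_eq_imp_space_eq[OF \<nu>(2)] by simp_all
  let ?X = "{w \<in> unit_square. snd w \<le> t}"
  have l: "left_map u s \<in> measurable \<mu> square_borel" and r: "right_map u s \<in> measurable \<nu> square_borel"
    using left_map_measurable[OF u'] right_map_measurable[OF u']
    by (simp_all add: measurable_cong_sets[OF \<mu>(2) refl] measurable_cong_sets[OF \<nu>(2) refl])
  have lX: "left_map u s -` ?X \<inter> space \<mu> = {w \<in> unit_square. snd w \<le> (if s then t / u else (t - (1 - u)) / u)}"
    using measurable_space[OF l] u unfolding sp
    by (auto simp: left_map_def le_divide_eq mult.commute algebra_simps split: if_splits)
  have rX: "right_map u s -` ?X \<inter> space \<nu> = {w \<in> unit_square. snd w \<le> (if s then (t - u) / (1 - u) else t / (1 - u))}"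
    using measurable_space[OF r] u unfolding sp
    by (auto simp: right_map_def le_divide_eq mult.commute algebra_simps split: if_splits)
  let ?r = "u * height_cdf \<mu> (if s then t / u else (t - (1 - u)) / u) +
     (1 - u) * height_cdf \<nu> (if s then (t - u) / (1 - u) else t / (1 - u))"
  have "emeasure (permuton_tensor u s \<mu> \<nu>) ?X =
     ennreal u * ennreal (height_cdf \<mu> (if s then t / u else (t - (1 - u)) / u)) +
     ennreal (1 - u) * ennreal (height_cdf \<nu> (if s then (t - u) / (1 - u) else t / (1 - u)))"
    using l r
    by (simp only: emeasure_permuton_tensor[OF halfplane_sets] emeasure_distr halfplane_sets lX rX
        \<mu>.emeasure_eq_measure \<nu>.emeasure_eq_measure height_cdf_def)
  also have "\<dots> = ennreal ?r"
    using u by (subst ennreal_plus) (auto simp: ennreal_mult height_cdf_def)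
  finally have "emeasure (permuton_tensor u s \<mu> \<nu>) ?X = ennreal ?r" .
  moreover have "0 \<le> ?r" using u by (auto simp: height_cdf_def)
  ultimately have "height_cdf (permuton_tensor u s \<mu> \<nu>) t = ?r"
    unfolding height_cdf_def[of "permuton_tensor u s \<mu> \<nu>"] measure_def[of "permuton_tensor u s \<mu> \<nu>"]
    by (simp only: enn2real_ennreal)
  then show ?thesis by (simp add: add.commute)
qed

lemma height_defect_tensor:
  assumes u: "0 < u" "u < 1"
    and \<mu>: "prob_space \<mu>" "sets \<mu> = sets square_borel" and \<nu>: "prob_space \<nu>" "sets \<nu> = sets square_borel"
  shows "height_defect (permuton_tensor u s \<mu> \<nu>) =
    ennreal (u\<^sup>2) * height_defect \<mu> + ennreal ((1 - u)\<^sup>2) * height_defect \<nu>"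
proof -
  have m: "height_cdf \<mu> \<in> borel_measurable borel" "height_cdf \<nu> \<in> borel_measurable borel"
    by (intro borel_measurable_mono height_cdf_mono \<mu> \<nu>)+
  note e = height_cdf_extreme[OF \<mu>] height_cdf_extreme[OF \<nu>]
  show ?thesis
  proof (cases s)
    case True
    show ?thesis
      using stacked_defect[OF u m e(2,3)]
      unfolding height_defect_def height_cdf_tensor[OF u \<mu> \<nu>] if_P[OF True] .
  next
    case False
    have "0 < 1 - u" "1 - u < 1" "1 - (1 - u) = u" using u by auto
    then show ?thesis
      using stacked_defect[OF _ _ m(2,1) e(4,1), of "1 - u"]
      unfolding height_defect_def height_cdf_tensor[OF u \<mu> \<nu>] if_not_P[OF False] by (simp add: add.commute)
  qed
qed

section \<open>The recursive separable permuton is an invariant permuton\<close>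

lemma permuton_height_cdf:
  assumes \<mu>: "permuton \<mu>" and t: "0 \<le> t" "t \<le> 1" shows "height_cdf \<mu> t = t"
proof -
  interpret prob_space \<mu> using \<mu> by (rule permuton_prob_space)
  have "emeasure \<mu> {w \<in> unit_square. snd w \<le> t} =
      (\<integral>\<^sup>+w. indicator {w \<in> unit_square. snd w \<le> t} w \<partial>\<mu>)"
    by (rule nn_integral_indicator[symmetric]) (simp add: permuton_sets[OF \<mu>])
  also have "\<dots> = (\<integral>\<^sup>+w. (if snd w \<le> t then 1 else 0) \<partial>\<mu>)"
    by (rule nn_integral_cong) (simp add: permuton_space[OF \<mu>] indicator_def)
  also have "\<dots> = (\<integral>\<^sup>+v. (if v \<le> t then 1 else 0) \<partial>Leb)"
    by (rule permuton_nn_integral(2)[OF \<mu>]) measurable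
  also have "\<dots> = ennreal t" using t by (subst nn_integral_Leb_if) auto
  finally show ?thesis using t by (simp add: height_cdf_def measure_def)
qed

text \<open>A monotone function that equals the identity almost everywhere does so everywhere: a deviation at one
point would force a deviation on an interval next to it.\<close>

lemma height_cdf_eq:
  assumes \<mu>: "prob_space \<mu>" "sets \<mu> = sets square_borel" and zero: "height_defect \<mu> = 0"
    and t: "0 \<le> t" "t \<le> 1"
  shows "height_cdf \<mu> t = t"
proof -
  let ?G = "height_cdf \<mu>"
  have mono: "mono ?G" by (rule height_cdf_mono[OF \<mu>])
  then have [measurable]: "?G \<in> borel_measurable borel" by (rule borel_measurable_mono)
  \<comment> \<open>The integrand of the defect vanishes almost everywhere.\<close>
  have "AE t in Leb. ?G t = t"
    using zero unfolding height_defect_def by (subst (asm) nn_integral_0_iff_AE) auto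
  then have ae: "AE t in lborel. t \<in> {0..1} \<longrightarrow> ?G t = t"
    unfolding Leb_def by (subst (asm) AE_restrict_space_iff) auto
  \<comment> \<open>An interval of positive length cannot consist of exceptional points.\<close>
  have dense: "\<exists>t\<in>{a<..<b}. ?G t = t" if "0 \<le> a" "a < b" "b \<le> 1" for a b
  proof (rule ccontr)
    assume no: "\<not> ?thesis"
    have "AE t in lborel. t \<notin> {a<..<b}"
      using ae by eventually_elim (use no that in auto)
    then have "emeasure lborel {a<..<b} = 0"
      by (subst (asm) AE_iff_measurable[where N = "{a<..<b}"]) auto
    then show False using that by simp
  qed
  have G01: "0 \<le> ?G t" "?G t \<le> 1"
  proof -
    interpret prob_space \<mu> by fact
    show "0 \<le> ?G t" "?G t \<le> 1" by (simp_all add: height_cdf_def)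
  qed
  show ?thesis
  proof (rule antisym)
    show "?G t \<le> t"
    proof (rule ccontr)
      assume "\<not> ?G t \<le> t"
      then obtain r where "r \<in> {t<..<?G t}" "?G r = r" using dense[of t "?G t"] t G01 by auto
      then show False using monoD[OF mono, of t r] by auto
    qed
    show "t \<le> ?G t"
    proof (rule ccontr)
      assume "\<not> t \<le> ?G t"
      then obtain r where "r \<in> {?G t<..<t}" "?G r = r" using dense[of "?G t" t] t G01 by auto
      then show False using monoD[OF mono, of r t] by auto
    qed
  qed
qed

lemma snd_marginal_eqI:
  assumes \<mu>: "prob_space \<mu>" "sets \<mu> = sets square_borel" and \<nu>: "prob_space \<nu>" "sets \<nu> = sets square_borel"
    and eq: "height_cdf \<mu> = height_cdf \<nu>"
  shows "distr \<mu> Leb snd = distr \<nu> Leb snd"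
proof (rule measure_eqI)
  have *: "real_distribution (distr \<rho> borel snd)" "cdf (distr \<rho> borel snd) = height_cdf \<rho>"
    "\<And>X. X \<in> sets Leb \<Longrightarrow> emeasure (distr \<rho> Leb snd) X = emeasure (distr \<rho> borel snd) X"
    if \<rho>: "prob_space \<rho>" "sets \<rho> = sets square_borel" for \<rho> :: "(real \<times> real) measure"
  proof -
    have [measurable_cong]: "sets \<rho> = sets square_borel" by (rule \<rho>)
    have sp: "space \<rho> = unit_square" using sets_eq_imp_space_eq[OF \<rho>(2)] by simp
    show "real_distribution (distr \<rho> borel snd)"
      unfolding real_distribution_def real_distribution_axioms_def
      by (auto intro!: prob_space.prob_space_distr[OF \<rho>(1)])
    show "cdf (distr \<rho> borel snd) = height_cdf \<rho>"
      unfolding cdf_def height_cdf_def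
      by (rule ext, subst measure_distr) (auto simp: sp intro!: arg_cong[where f = "measure _"])
    show "emeasure (distr \<rho> Leb snd) X = emeasure (distr \<rho> borel snd) X" if "X \<in> sets Leb" for X
      using that by (simp add: emeasure_distr sets_Leb sets_restrict_space_iff)
  qed
  have "distr \<mu> borel snd = distr \<nu> borel snd"
    by (rule cdf_unique) (simp_all add: *[OF \<mu>] *[OF \<nu>] eq)
  then show "emeasure (distr \<mu> Leb snd) X = emeasure (distr \<nu> Leb snd) X" if "X \<in> sets (distr \<mu> Leb snd)" for X
    using that by (simp add: *(3)[OF \<mu>] *(3)[OF \<nu>])
qed simp

lemma diagonal_measurable: "(\<lambda>x. (x, x)) \<in> measurable Leb square_borel"
  unfolding measurable_square_borel_iff by auto

lemma permuton_diagonal: "permuton (distr Leb square_borel (\<lambda>x. (x, x)))"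
proof (rule permutonI)
  fix f :: "real \<Rightarrow> ennreal" assume [measurable]: "f \<in> borel_measurable Leb"
  show "(\<integral>\<^sup>+z. f (fst z) \<partial>distr Leb square_borel (\<lambda>x. (x, x))) = (\<integral>\<^sup>+x. f x \<partial>Leb)"
    "(\<integral>\<^sup>+z. f (snd z) \<partial>distr Leb square_borel (\<lambda>x. (x, x))) = (\<integral>\<^sup>+x. f x \<partial>Leb)"
    by (subst nn_integral_distr[OF diagonal_measurable]; simp)+
qed simp

text \<open>The diagonal permuton provides a measure whose second marginal is known to be uniform, so comparing
distribution functions with it settles the second marginal. Expressing the property through the defect
makes it a measurable condition on the sequence.\<close>

lemma permuton_seq_measure:
  assumes z: "z \<in> space seq_space"
  shows "permuton (seq_measure z) \<longleftrightarrow> height_defect (seq_measure z) = 0"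
proof
  assume zero: "height_defect (seq_measure z) = 0"
  let ?\<mu> = "seq_measure z" and ?D = "distr Leb square_borel (\<lambda>x. (x, x))"
  note P = prob_space_seq_measure[OF z] sets_seq_measure[of z]
  note D = permuton_prob_space[OF permuton_diagonal] permuton_sets[OF permuton_diagonal]
  note graph_section[OF z, measurable]
  have "distr ?\<mu> Leb fst = distr Leb Leb (\<lambda>x. x)"
    unfolding seq_measure_eq by (subst distr_distr) (auto simp: o_def)
  then have fst: "distr ?\<mu> Leb fst = Leb" by (simp add: distr_id)
  have "height_cdf ?\<mu> t = height_cdf ?D t" for t
    using height_cdf_extreme[OF P, of t] height_cdf_extreme[OF D, of t]
      height_cdf_eq[OF P zero, of t] permuton_height_cdf[OF permuton_diagonal, of t]
    by (cases "t < 0"; cases "1 \<le> t") auto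
  then have "distr ?\<mu> Leb snd = distr ?D Leb snd" by (intro snd_marginal_eqI P D) auto
  also have "\<dots> = Leb" using permuton_diagonal by (simp add: permuton_def)
  finally show "permuton ?\<mu>" unfolding permuton_def using P fst by auto
next
  assume "permuton (seq_measure z)"
  then have "height_defect (seq_measure z) = (\<integral>\<^sup>+t. 0 \<partial>Leb)"
    unfolding height_defect_def by (intro nn_integral_cong) (simp add: permuton_height_cdf)
  then show "height_defect (seq_measure z) = 0" by simp
qed

lemma AE_pair_fst:
  assumes "prob_space M" "prob_space N" "AE x in M. Q x" shows "AE \<omega> in M \<Otimes>\<^sub>M N. Q (fst \<omega>)"
  by (rule AE_distrD[OF measurable_fst]) (use assms in \<open>simp only: prob_space.distr_pair_fst\<close>)

lemma AE_pair_snd: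
  assumes "prob_space M" "prob_space N" "AE x in N. Q x" shows "AE \<omega> in M \<Otimes>\<^sub>M N. Q (snd \<omega>)"
  by (rule AE_distrD[OF measurable_snd]) (use assms in \<open>simp only: distr_pair_snd\<close>)

lemma AE_Phi_space:
  assumes M: "prob_space M"
  shows "AE x in M. Q x \<Longrightarrow> AE \<omega> in Phi_space p M. Q (fst \<omega>)"
    "AE x in M. Q x \<Longrightarrow> AE \<omega> in Phi_space p M. Q (fst (snd \<omega>))"
    "AE x in Leb. R x \<Longrightarrow> AE \<omega> in Phi_space p M. R (fst (snd (snd \<omega>)))"
proof -
  let ?B = "measure_pmf (bernoulli_pmf p)"
  note P = M prob_space_Leb prob_space_measure_pmf[of "bernoulli_pmf p"]
  have LB: "prob_space (Leb \<Otimes>\<^sub>M ?B)" by (intro prob_space_pair P)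
  have MLB: "prob_space (M \<Otimes>\<^sub>M Leb \<Otimes>\<^sub>M ?B)" by (intro prob_space_pair P)
  show "AE x in M. Q x \<Longrightarrow> AE \<omega> in Phi_space p M. Q (fst \<omega>)"
    unfolding Phi_space_def by (rule AE_pair_fst[OF M MLB])
  show "AE x in M. Q x \<Longrightarrow> AE \<omega> in Phi_space p M. Q (fst (snd \<omega>))"
    unfolding Phi_space_def by (rule AE_pair_snd[OF M MLB]) (rule AE_pair_fst[OF M LB])
  show "AE x in Leb. R x \<Longrightarrow> AE \<omega> in Phi_space p M. R (fst (snd (snd \<omega>)))"
    unfolding Phi_space_def
    by (rule AE_pair_snd[OF M MLB], rule AE_pair_snd[OF M LB], rule AE_pair_fst[OF P(2,3)])
qed

lemma AE_glue_generic:
  "AE \<omega> in Phi_space p (mark_sequences p) \<Otimes>\<^sub>M coin_sequences.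
    0 < fst (snd (snd (fst \<omega>))) \<and> fst (snd (snd (fst \<omega>))) < 1 \<and>
    (\<forall>n. \<exists>i\<ge>n. snd \<omega> i \<le> fst (snd (snd (fst \<omega>)))) \<and> (\<forall>n. \<exists>i\<ge>n. \<not> snd \<omega> i \<le> fst (snd (snd (fst \<omega>))))"
proof -
  let ?P = "Phi_space p (mark_sequences p)" and ?C = "coin_sequences"
  interpret C: prob_space ?C by (rule prob_space_coin_sequences)
  interpret P: prob_space ?P by (rule prob_space_Phi_space[OF prob_space_mark_sequences])
  interpret PC: pair_sigma_finite ?P ?C by unfold_locales
  have [measurable]: "(\<lambda>\<omega>. fst (snd (snd (fst \<omega>)))) \<in> borel_measurable (?P \<Otimes>\<^sub>M ?C)"
    "(\<lambda>\<omega>. snd \<omega> i) \<in> borel_measurable (?P \<Otimes>\<^sub>M ?C)" for i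
    by (rule Leb_borel, measurable)+
  show ?thesis
  proof (rule PC.AE_pair_measure)
    show "AE x in ?P. AE y in ?C. 0 < fst (snd (snd (fst (x, y)))) \<and> fst (snd (snd (fst (x, y)))) < 1 \<and>
       (\<forall>n. \<exists>i\<ge>n. snd (x, y) i \<le> fst (snd (snd (fst (x, y))))) \<and> (\<forall>n. \<exists>i\<ge>n. \<not> snd (x, y) i \<le> fst (snd (snd (fst (x, y)))))"
      using AE_Phi_space(3)[OF prob_space_mark_sequences AE_Leb_neq[of 0], of p p]
        AE_Phi_space(3)[OF prob_space_mark_sequences AE_Leb_neq[of 1], of p p] AE_space
    proof eventually_elim
      case (elim x)
      then have u: "0 < fst (snd (snd x))" "fst (snd (snd x)) < 1" by (auto simp: space_Phi_space)
      show ?case using coins_both_sides[OF u] by eventually_elim (use u in simp)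
    qed
  qed measurable
qed

lemma AE_seq_measure_glue:
  "AE \<omega> in Phi_space p (mark_sequences p) \<Otimes>\<^sub>M coin_sequences.
    0 < fst (snd (snd (fst \<omega>))) \<and> fst (snd (snd (fst \<omega>))) < 1 \<and>
    seq_measure (glue \<omega>) = permuton_tensor (fst (snd (snd (fst \<omega>)))) (snd (snd (snd (fst \<omega>))))
      (seq_measure (fst (fst \<omega>))) (seq_measure (fst (snd (fst \<omega>))))"
  using AE_glue_generic AE_space
proof eventually_elim
  case (elim \<omega>)
  obtain A B u s V where \<omega>: "\<omega> = ((A, B, u, s), V)" by (metis prod.exhaust)
  have sp: "A \<in> space seq_space" "B \<in> space seq_space" "V \<in> space coin_sequences"
    using elim(2) sets_eq_imp_space_eq[OF sets_mark_sequences[of p]]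
    by (auto simp: \<omega> space_pair_measure space_Phi_space)
  from elim(1) have *: "0 < u" "u < 1" "\<forall>n. \<exists>i\<ge>n. V i \<le> u" "\<forall>n. \<exists>i\<ge>n. \<not> V i \<le> u"
    unfolding \<omega> fst_conv snd_conv by blast+
  show ?case
    using seq_measure_tensor[OF *(1,2) sp *(3,4)[rule_format], of s] *(1,2) by (simp add: \<omega>)
qed

text \<open>The expected defect is a finite number that equals \<open>2/3\<close> of itself.\<close>

lemma AE_permuton_seq_measure: "AE z in mark_sequences p. permuton (seq_measure z)"
proof -
  let ?S = "mark_sequences p"
  interpret S: prob_space ?S by (rule prob_space_mark_sequences)
  interpret P: prob_space "Phi_space p ?S" by (rule prob_space_Phi_space[OF prob_space_mark_sequences])
  interpret C: prob_space "coin_sequences" by (rule prob_space_coin_sequences)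
  define h where "h z = height_defect (seq_measure z)" for z
  have h: "h \<in> borel_measurable seq_space"
    unfolding h_def by (rule measurable_height_defect[OF measurable_seq_measure])
  then have hS [measurable]: "h \<in> borel_measurable ?S" by (simp add: measurable_cong_sets[OF sets_mark_sequences refl])
  have sp: "space ?S = space seq_space" by (rule sets_eq_imp_space_eq[OF sets_mark_sequences])
  define E where "E = (\<integral>\<^sup>+z. h z \<partial>?S)"
  let ?k = "\<lambda>(A, B, u, s). ennreal (u\<^sup>2) * h A + ennreal ((1 - u)\<^sup>2) * h B"
  have k: "?k \<in> borel_measurable (Phi_space p ?S)"
  proof -
    have [measurable]: "(\<lambda>\<omega>. fst (snd (snd \<omega>))) \<in> borel_measurable (Phi_space p ?S)"
      by (rule Leb_borel) measurable
    show ?thesis unfolding split_beta' by measurable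
  qed
  have "E = (\<integral>\<^sup>+\<omega>. h (glue \<omega>) \<partial>(Phi_space p ?S \<Otimes>\<^sub>M coin_sequences))"
    unfolding E_def
    by (subst glue_law[symmetric]) (rule nn_integral_distr[OF measurable_glue], simp add: h)
  also have "\<dots> = (\<integral>\<^sup>+\<omega>. ?k (fst \<omega>) \<partial>(Phi_space p ?S \<Otimes>\<^sub>M coin_sequences))"
  proof (rule nn_integral_cong_AE)
    show "AE \<omega> in Phi_space p ?S \<Otimes>\<^sub>M coin_sequences. h (glue \<omega>) = ?k (fst \<omega>)"
      using AE_seq_measure_glue AE_space
    proof eventually_elim
      case (elim \<omega>)
      then have "fst (fst \<omega>) \<in> space seq_space" "fst (snd (fst \<omega>)) \<in> space seq_space"
        by (auto simp: space_pair_measure space_Phi_space sp)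
      with elim(1) show ?case
        by (simp add: h_def split_beta height_defect_tensor prob_space_seq_measure)
    qed
  qed
  also have "\<dots> = (\<integral>\<^sup>+\<omega>. ?k \<omega> \<partial>Phi_space p ?S)"
  proof -
    have "(\<lambda>\<omega>. ?k (fst \<omega>)) \<in> borel_measurable (Phi_space p ?S \<Otimes>\<^sub>M coin_sequences)"
      by (rule measurable_compose[OF measurable_fst k])
    from C.nn_integral_fst[OF this] show ?thesis by (simp add: C.emeasure_space_1)
  qed
  also have "\<dots> = ennreal (2 / 3) * E"
    unfolding E_def by (rule nn_integral_Phi_space_squares[OF prob_space_mark_sequences hS])
  finally have E: "E = ennreal (2 / 3) * E" .
  have "h z \<le> 1" if "z \<in> space ?S" for z
  proof -
    interpret prob_space "seq_measure z" using that by (intro prob_space_seq_measure) (simp add: sp)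
    have "h z \<le> (\<integral>\<^sup>+t. 1 \<partial>Leb)"
      unfolding h_def height_defect_def
    proof (rule nn_integral_mono)
      fix t assume "t \<in> space Leb"
      then have "0 \<le> t" "t \<le> 1" by simp_all
      then have "\<bar>height_cdf (seq_measure z) t - t\<bar> \<le> 1"
        using prob_le_1[of "{w \<in> unit_square. snd w \<le> t}"] measure_nonneg[of "seq_measure z" "{w \<in> unit_square. snd w \<le> t}"]
        unfolding height_cdf_def by linarith
      then show "ennreal \<bar>height_cdf (seq_measure z) t - t\<bar> \<le> 1" by simp
    qed
    then show ?thesis using Leb.emeasure_space_1 by simp
  qed
  then have "E \<le> (\<integral>\<^sup>+z. 1 \<partial>?S)" unfolding E_def by (rule nn_integral_mono)
  then have "E \<le> 1" by (simp add: S.emeasure_space_1)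
  then obtain e where e: "0 \<le> e" "E = ennreal e" by (cases E) (auto simp: top_unique)
  \<comment> \<open>The bound by 1 rules out an infinite expectation, for which the equation would say nothing.\<close>
  have "e = 2 / 3 * e" using E e by (simp add: ennreal_mult[symmetric])
  then have "E = 0" using e by simp
  then have "AE z in ?S. h z = 0" unfolding E_def by (simp add: nn_integral_0_iff_AE)
  then show ?thesis using AE_space
    by eventually_elim (simp add: permuton_seq_measure h_def sp)
qed

definition seq_permuton :: "(nat \<Rightarrow> real \<times> bool) \<Rightarrow> (real \<times> real) measure" where
  "seq_permuton z = rec_permuton (\<lambda>j. fst (z j)) (\<lambda>j. snd (z j))"

lemma seq_permuton_eq:
  "seq_permuton z = (if permuton (seq_measure z) then seq_measure z else distr Leb square_borel (\<lambda>x. (x, x)))"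
  by (simp add: seq_permuton_def rec_permuton_def seq_measure_def)

lemma permuton_seq_permuton: "permuton (seq_permuton z)"
  by (simp add: seq_permuton_eq permuton_diagonal)

lemma measurable_seq_permuton: "seq_permuton \<in> measurable seq_space permuton_space"
proof (rule measurable_permuton_spaceI[OF _ permuton_seq_permuton])
  note m [measurable] = measurable_height_defect[OF measurable_seq_measure] measurable_seq_measure
  have "(\<lambda>z. distr Leb square_borel (\<lambda>x. (x, x))) \<in> measurable seq_space (subprob_algebra square_borel)"
    using permuton_diagonal
    by (intro measurable_const) (simp add: space_subprob_algebra permuton_prob_space prob_space_imp_subprob_space)
  then have "(\<lambda>z. if height_defect (seq_measure z) = 0 then seq_measure z else distr Leb square_borel (\<lambda>x. (x, x)))
      \<in> measurable seq_space (subprob_algebra square_borel)"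
    by measurable
  also have "?this \<longleftrightarrow> seq_permuton \<in> measurable seq_space (subprob_algebra square_borel)"
    by (rule measurable_cong) (simp add: seq_permuton_eq permuton_seq_measure)
  finally show "seq_permuton \<in> measurable seq_space (subprob_algebra square_borel)" .
qed

text \<open>Almost surely gluing turns the permutons of the two halves into their tensor, while gluing preserves
the law of sequences of marks. Exceptional sequences, where the diagonal is substituted, have
probability 0.\<close>

lemma seq_permuton_law_fixed:
  "distr (mark_sequences p) permuton_space seq_permuton =
    distr (Phi_space p (mark_sequences p)) permuton_space (Phi seq_permuton)"
proof -
  let ?S = "mark_sequences p"
  let ?P = "Phi_space p ?S"
  let ?K = "?P \<Otimes>\<^sub>M coin_sequences"
  interpret C: prob_space coin_sequences by (rule prob_space_coin_sequences)
  have P: "prob_space ?P" by (rule prob_space_Phi_space[OF prob_space_mark_sequences])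
  have m: "seq_permuton \<in> measurable ?S permuton_space"
    using measurable_seq_permuton by (simp add: measurable_cong_sets[OF sets_mark_sequences refl])
  note mP = Phi_measurable[OF m, of p]
  have "distr ?S permuton_space seq_permuton = distr (distr ?K seq_space glue) permuton_space seq_permuton"
    by (simp add: glue_law)
  also have "\<dots> = distr ?K permuton_space (seq_permuton \<circ> glue)"
    by (rule distr_distr[OF measurable_seq_permuton measurable_glue])
  also have "\<dots> = distr ?K permuton_space (Phi seq_permuton \<circ> fst)"
  proof (rule distr_cong_AE)
    have A: "AE \<omega> in ?K. permuton (seq_measure (fst (fst \<omega>)))"
      by (rule AE_pair_fst[OF P prob_space_coin_sequences],
          rule AE_Phi_space(1)[OF prob_space_mark_sequences AE_permuton_seq_measure])
    have B: "AE \<omega> in ?K. permuton (seq_measure (fst (snd (fst \<omega>))))"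
      by (rule AE_pair_fst[OF P prob_space_coin_sequences],
          rule AE_Phi_space(2)[OF prob_space_mark_sequences AE_permuton_seq_measure])
    show "AE \<omega> in ?K. (seq_permuton \<circ> glue) \<omega> = (Phi seq_permuton \<circ> fst) \<omega>"
      using A B AE_seq_measure_glue
    proof eventually_elim
      case (elim \<omega>)
      then have "permuton (seq_measure (glue \<omega>))"
        by (auto intro: permuton_tensor_permuton)
      then show ?case using elim by (simp add: seq_permuton_eq Phi_def split_beta)
    qed
    show "seq_permuton \<circ> glue \<in> measurable ?K permuton_space"
      by (rule measurable_comp[OF measurable_glue measurable_seq_permuton])
    show "Phi seq_permuton \<circ> fst \<in> measurable ?K permuton_space"
      by (rule measurable_comp[OF measurable_fst mP])
  qed (rule refl)+
  also have "\<dots> = distr (distr ?K ?P fst) permuton_space (Phi seq_permuton)"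
    by (rule distr_distr[OF mP measurable_fst, symmetric])
  also have "distr ?K ?P fst = ?P" by (rule C.distr_pair_fst)
  finally show ?thesis .
qed

context driving_sequences
begin

definition driving_marks :: "'a \<Rightarrow> nat \<Rightarrow> real \<times> bool" where
  "driving_marks \<omega> = (\<lambda>j. (U j \<omega>, S j \<omega>))"

lemma U_measurable: "U j \<in> measurable M Leb" and S_measurable: "S j \<in> measurable M (count_space UNIV)"
  using U_iid(1) S_iid(1) by (auto simp: indep_vars_def2)

lemma mark_measurable: "(\<lambda>\<omega>. (U j \<omega>, S j \<omega>)) \<in> measurable M mark_space"
  by (intro measurable_Pair U_measurable S_measurable)

lemma driving_marks_measurable: "driving_marks \<in> measurable M seq_space"
  by (rule measurable_PiM_single')
    (use mark_measurable in \<open>auto simp: driving_marks_def PiE_iff dest: measurable_space\<close>)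

text \<open>Independence of the two sequences separates positions from signs, and independence within each
sequence factorizes both parts.\<close>

lemma prob_rectangles:
  assumes J: "finite J" "J \<noteq> {}" and a: "\<And>j. j \<in> J \<Longrightarrow> a j \<in> sets Leb"
  shows "prob (\<Inter>j\<in>J. (\<lambda>\<omega>. (U j \<omega>, S j \<omega>)) -` (a j \<times> b j) \<inter> space M) =
    (\<Prod>j\<in>J. prob (U j -` a j \<inter> space M) * prob (S j -` b j \<inter> space M))"
proof -
  let ?VU = "vimage_algebra (space M) (\<lambda>\<omega> j. U j \<omega>) (PiM UNIV (\<lambda>_ :: nat. Leb))"
  let ?VS = "vimage_algebra (space M) (\<lambda>\<omega> j. S j \<omega>) (PiM UNIV (\<lambda>_ :: nat. count_space (UNIV :: bool set)))"
  let ?X = "\<Inter>j\<in>J. U j -` a j \<inter> space M" and ?Y = "\<Inter>j\<in>J. S j -` b j \<inter> space M"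
  have X: "?X \<in> sets ?VU"
  proof (intro sets.finite_INT J)
    fix j assume "j \<in> J"
    then have "{f \<in> space (PiM UNIV (\<lambda>_ :: nat. Leb)). f j \<in> a j} \<in> sets (PiM UNIV (\<lambda>_. Leb))"
      using a[of j] by measurable
    then have "(\<lambda>\<omega> j. U j \<omega>) -` {f \<in> space (PiM UNIV (\<lambda>_ :: nat. Leb)). f j \<in> a j} \<inter> space M \<in> sets ?VU"
      by (rule in_vimage_algebra)
    also have "(\<lambda>\<omega> j. U j \<omega>) -` {f \<in> space (PiM UNIV (\<lambda>_ :: nat. Leb)). f j \<in> a j} \<inter> space M = U j -` a j \<inter> space M"
      using measurable_space[OF U_measurable] by (auto simp: space_PiM PiE_iff)
    finally show "U j -` a j \<inter> space M \<in> sets ?VU" .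
  qed
  have Y: "?Y \<in> sets ?VS"
  proof (intro sets.finite_INT J)
    fix j assume "j \<in> J"
    have "{f \<in> space (PiM UNIV (\<lambda>_ :: nat. count_space (UNIV :: bool set))). f j \<in> b j} \<in> sets (PiM UNIV (\<lambda>_. count_space UNIV))"
      by measurable
    then have "(\<lambda>\<omega> j. S j \<omega>) -` {f \<in> space (PiM UNIV (\<lambda>_ :: nat. count_space (UNIV :: bool set))). f j \<in> b j} \<inter> space M \<in> sets ?VS"
      by (rule in_vimage_algebra)
    also have "(\<lambda>\<omega> j. S j \<omega>) -` {f \<in> space (PiM UNIV (\<lambda>_ :: nat. count_space (UNIV :: bool set))). f j \<in> b j} \<inter> space M = S j -` b j \<inter> space M"
      by (auto simp: space_PiM PiE_iff)
    finally show "S j -` b j \<inter> space M \<in> sets ?VS" .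
  qed
  have "(\<Inter>j\<in>J. (\<lambda>\<omega>. (U j \<omega>, S j \<omega>)) -` (a j \<times> b j) \<inter> space M) = ?X \<inter> ?Y"
    using J by auto
  also have "prob (?X \<inter> ?Y) = prob ?X * prob ?Y"
    by (rule indep_setD[OF U_S_indep X Y])
  also have "prob ?X = (\<Prod>j\<in>J. prob (U j -` a j \<inter> space M))"
    by (rule indep_varsD[OF U_iid(1) J(2,1)]) (use a in auto)
  also have "prob ?Y = (\<Prod>j\<in>J. prob (S j -` b j \<inter> space M))"
    by (rule indep_varsD[OF S_iid(1) J(2,1)]) auto
  finally show ?thesis by (simp add: prod.distrib)
qed

lemma distr_mark: "distr M mark_space (\<lambda>\<omega>. (U j \<omega>, S j \<omega>)) = marks p"
  unfolding marks_def
proof (rule pair_measure_eqI[symmetric])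
  show "sigma_finite_measure Leb" "sigma_finite_measure (measure_pmf (bernoulli_pmf p))"
    by unfold_locales
  show "sets (Leb \<Otimes>\<^sub>M measure_pmf (bernoulli_pmf p)) = sets (distr M mark_space (\<lambda>\<omega>. (U j \<omega>, S j \<omega>)))"
    using sets_marks[of p] by (simp add: marks_def)
  fix a b assume a: "a \<in> sets Leb" and "b \<in> sets (measure_pmf (bernoulli_pmf p))"
  have ab: "a \<times> b \<in> sets mark_space" using a by auto
  have "emeasure (distr M mark_space (\<lambda>\<omega>. (U j \<omega>, S j \<omega>))) (a \<times> b) =
      ennreal (prob (U j -` a \<inter> space M) * prob (S j -` b \<inter> space M))"
    using prob_rectangles[of "{j}" "\<lambda>_. a" "\<lambda>_. b"] a
    by (simp add: emeasure_distr[OF mark_measurable ab] emeasure_eq_measure)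
  also have "\<dots> = emeasure (distr M Leb (U j)) a * emeasure (distr M (count_space UNIV) (S j)) b"
    using a by (simp add: emeasure_distr U_measurable S_measurable emeasure_eq_measure ennreal_mult)
  finally show "emeasure Leb a * emeasure (measure_pmf (bernoulli_pmf p)) b =
      emeasure (distr M mark_space (\<lambda>\<omega>. (U j \<omega>, S j \<omega>))) (a \<times> b)"
    by (simp add: U_iid S_iid)
qed

text \<open>Products of a set of positions and a set of signs form a stable generator, on which joint independence
is the factorization just obtained.\<close>

lemma indep_marks: "indep_vars (\<lambda>_. mark_space) (\<lambda>j \<omega>. (U j \<omega>, S j \<omega>)) UNIV"
proof -
  have fin: "indep_vars (\<lambda>_. mark_space) (\<lambda>j \<omega>. (U j \<omega>, S j \<omega>)) J" if J: "finite J" "J \<noteq> {}" for J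
  proof (subst indep_vars_finite[where E = "\<lambda>_. {a \<times> b | a b. a \<in> sets Leb \<and> b \<in> sets (count_space UNIV)}", OF J(2,1)])
    show "sets mark_space = sigma_sets (space mark_space) {a \<times> b | a b. a \<in> sets Leb \<and> b \<in> sets (count_space UNIV)}"
      unfolding sets_pair_measure space_pair_measure ..
    show "(\<lambda>\<omega>. (U j \<omega>, S j \<omega>)) \<in> measurable M mark_space" for j by (rule mark_measurable)
    show "Int_stable {a \<times> b | a b. a \<in> sets Leb \<and> b \<in> sets (count_space (UNIV :: bool set))}"
      by (rule Int_stable_pair_measure_generator)
    show "space mark_space \<in> {a \<times> b | a b. a \<in> sets Leb \<and> b \<in> sets (count_space (UNIV :: bool set))}"
      unfolding space_pair_measure by blast
    show "{a \<times> b | a b. a \<in> sets Leb \<and> b \<in> sets (count_space (UNIV :: bool set))} \<subseteq> Pow (space mark_space)"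
      unfolding space_pair_measure using sets.sets_into_space[of _ Leb] by fastforce
    show "\<forall>A\<in>J \<rightarrow> {a \<times> b | a b. a \<in> sets Leb \<and> b \<in> sets (count_space UNIV)}.
      prob (\<Inter>j\<in>J. (\<lambda>\<omega>. (U j \<omega>, S j \<omega>)) -` A j \<inter> space M) = (\<Prod>j\<in>J. prob ((\<lambda>\<omega>. (U j \<omega>, S j \<omega>)) -` A j \<inter> space M))"
    proof
      fix A assume "A \<in> J \<rightarrow> {a \<times> b | a b. a \<in> sets Leb \<and> b \<in> sets (count_space (UNIV :: bool set))}"
      then have "\<forall>j\<in>J. \<exists>ab. fst ab \<in> sets Leb \<and> A j = fst ab \<times> snd ab" by fastforce
      from bchoice[OF this] obtain f where f: "\<And>j. j \<in> J \<Longrightarrow> fst (f j) \<in> sets Leb" "\<And>j. j \<in> J \<Longrightarrow> A j = fst (f j) \<times> snd (f j)"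
        by auto
      have "prob (\<Inter>j\<in>J. (\<lambda>\<omega>. (U j \<omega>, S j \<omega>)) -` A j \<inter> space M) =
          prob (\<Inter>j\<in>J. (\<lambda>\<omega>. (U j \<omega>, S j \<omega>)) -` (fst (f j) \<times> snd (f j)) \<inter> space M)"
        by (intro arg_cong[where f = prob] INF_cong refl) (simp add: f(2))
      also have "\<dots> = (\<Prod>j\<in>J. prob (U j -` fst (f j) \<inter> space M) * prob (S j -` snd (f j) \<inter> space M))"
        by (rule prob_rectangles[OF J f(1)])
      also have "\<dots> = (\<Prod>j\<in>J. prob ((\<lambda>\<omega>. (U j \<omega>, S j \<omega>)) -` A j \<inter> space M))"
      proof (rule prod.cong)
        fix j assume j: "j \<in> J"
        show "prob (U j -` fst (f j) \<inter> space M) * prob (S j -` snd (f j) \<inter> space M) = prob ((\<lambda>\<omega>. (U j \<omega>, S j \<omega>)) -` A j \<inter> space M)"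
          using prob_rectangles[of "{j}" "\<lambda>_. fst (f j)" "\<lambda>_. snd (f j)"] f[OF j] by simp
      qed simp
      finally show "prob (\<Inter>j\<in>J. (\<lambda>\<omega>. (U j \<omega>, S j \<omega>)) -` A j \<inter> space M) = (\<Prod>j\<in>J. prob ((\<lambda>\<omega>. (U j \<omega>, S j \<omega>)) -` A j \<inter> space M))" .
    qed
  qed
  show ?thesis
    unfolding indep_vars_def2
  proof (intro conjI ballI mark_measurable)
    show "indep_sets (\<lambda>i. {(\<lambda>\<omega>. (U i \<omega>, S i \<omega>)) -` A \<inter> space M |A. A \<in> sets mark_space}) UNIV"
      by (subst indep_sets_finite_index_sets) (use fin in \<open>auto simp: indep_vars_def2\<close>)
  qed
qed

lemma distr_driving_marks: "distr M seq_space driving_marks = mark_sequences p"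
proof -
  have "distr M seq_space (\<lambda>\<omega>. \<lambda>i\<in>UNIV. (U i \<omega>, S i \<omega>)) = PiM UNIV (\<lambda>i. distr M mark_space (\<lambda>\<omega>. (U i \<omega>, S i \<omega>)))"
    by (subst indep_vars_iff_distr_eq_PiM'[symmetric]) (auto intro: mark_measurable indep_marks)
  then show ?thesis
    by (simp add: distr_mark mark_sequences_def driving_marks_def[abs_def] restrict_UNIV)
qed

lemma random_rec_permuton_eq: "random_rec_permuton U S = seq_permuton \<circ> driving_marks"
  by (simp add: fun_eq_iff random_rec_permuton_def seq_permuton_def driving_marks_def)

lemma random_rec_permuton_measurable: "random_rec_permuton U S \<in> measurable M permuton_space"
  unfolding random_rec_permuton_eq by (rule measurable_comp[OF driving_marks_measurable measurable_seq_permuton])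

lemma random_rec_permuton_law:
  "distr M permuton_space (random_rec_permuton U S) = distr (mark_sequences p) permuton_space seq_permuton"
  unfolding random_rec_permuton_eq distr_driving_marks[symmetric]
  by (rule distr_distr[OF measurable_seq_permuton driving_marks_measurable, symmetric])

lemma random_rec_permuton_AE:
  "AE \<omega> in M. random_rec_permuton U S \<omega> = rec_measure (\<lambda>j. U j \<omega>) (\<lambda>j. S j \<omega>)"
proof -
  have "AE z in distr M seq_space driving_marks. permuton (seq_measure z)"
    unfolding distr_driving_marks by (rule AE_permuton_seq_measure)
  then have "AE \<omega> in M. permuton (seq_measure (driving_marks \<omega>))"
    by (rule AE_distrD[OF driving_marks_measurable])
  then show ?thesis
    by eventually_elim (simp add: random_rec_permuton_eq seq_permuton_eq seq_measure_def driving_marks_def)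
qed

lemma random_rec_permuton_fixed:
  "distr M permuton_space (random_rec_permuton U S) =
    distr (Phi_space p M) permuton_space (Phi (random_rec_permuton U S))"
proof -
  have m: "seq_permuton \<in> measurable (mark_sequences p) permuton_space"
    using measurable_seq_permuton by (simp add: measurable_cong_sets[OF sets_mark_sequences refl])
  show ?thesis
    unfolding distr_Phi[OF prob_space_axioms random_rec_permuton_measurable]
    unfolding random_rec_permuton_law
    unfolding distr_Phi[OF prob_space_mark_sequences m, symmetric]
    by (rule seq_permuton_law_fixed)
qed

end

lemma fixed_law_of_random_permuton:
  assumes "random_permuton N \<nu>" "eq_in_law N \<nu> (Phi_space p N) (Phi \<nu>)"
  defines "m \<equiv> distr N permuton_space \<nu>"
  shows "prob_space m" "sets m = sets permuton_space" "distr (Phi_space p m) permuton_space (Phi (\<lambda>\<mu>. \<mu>)) = m"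
proof -
  have N: "prob_space N" and \<nu>: "\<nu> \<in> measurable N permuton_space" using assms(1) by (auto simp: random_permuton_def)
  show "prob_space m" unfolding m_def by (rule prob_space.prob_space_distr[OF N \<nu>])
  show "sets m = sets permuton_space" by (simp add: m_def)
  show "distr (Phi_space p m) permuton_space (Phi (\<lambda>\<mu>. \<mu>)) = m"
    using assms(2) unfolding m_def eq_in_law_def distr_Phi[OF N \<nu>] by (rule sym)
qed

theorem proposition1p6:
  fixes M :: "'a measure" and p :: real
    and U :: "nat \<Rightarrow> 'a \<Rightarrow> real" and S :: "nat \<Rightarrow> 'a \<Rightarrow> bool"
  assumes "0 \<le> p" "p \<le> 1"
    and "driving_sequences M p U S"
  shows "(AE \<omega> in M. random_rec_permuton U S \<omega> = rec_measure (\<lambda>j. U j \<omega>) (\<lambda>j. S j \<omega>))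
    \<and> random_permuton M (random_rec_permuton U S)
    \<and> eq_in_law M (random_rec_permuton U S) (Phi_space p M) (Phi (random_rec_permuton U S))
    \<and> (\<forall>(N :: 'b measure) \<nu>.
          random_permuton N \<nu> \<and> eq_in_law N \<nu> (Phi_space p N) (Phi \<nu>)
            \<longrightarrow> eq_in_law N \<nu> M (random_rec_permuton U S))"
proof -
  interpret driving_sequences M p U S by fact
  have rp: "random_permuton M (random_rec_permuton U S)"
    unfolding random_permuton_def using prob_space_axioms random_rec_permuton_measurable by blast
  have fixed: "eq_in_law M (random_rec_permuton U S) (Phi_space p M) (Phi (random_rec_permuton U S))"
    unfolding eq_in_law_def by (rule random_rec_permuton_fixed)
  have "eq_in_law N \<nu> M (random_rec_permuton U S)"
    if "random_permuton N \<nu>" "eq_in_law N \<nu> (Phi_space p N) (Phi \<nu>)" for N :: "'b measure" and \<nu>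
    unfolding eq_in_law_def
    by (rule fixed_law_unique[OF fixed_law_of_random_permuton[OF that] fixed_law_of_random_permuton[OF rp fixed]])
  with random_rec_permuton_AE rp fixed show ?thesis by blast
qed

end
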